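(* Let $r \ge 2$, let $d_i \ge 2$ be integers, $D_i = [d_i]$ for $i \in [r]$, and $n = \sum_{i\in[r]} d_i$. Suppose we are explicitly given functions $c_i : D_i \to \mathbf{R}_+$ ($i\in[r]$) and $c_{ij} : D_i \times D_j \to \mathbf{R}_+\cup\{+\infty\}$ ($1 \le i<j\le r$, with $c_{ji}(b,a) := c_{ij}(a,b)$) such that the function $$f(x_1,\dots,x_r) = \sum_{i\in[r]} c_i(x_i) + \sum_{1\le i<j\le r} c_{ij}(x_i,x_j)$$ on $D_1\times\cdots\times D_r$ satisfies the joint winner property and is Z-free. Then a minimizer of $f$ can be computed in $O(nr^3 + nr\log n + n^2)$ time.
   Context: Conventions: $a<+\infty$, $a+(+\infty)=+\infty$ for $a\in\mathbf{R}$; $\mathbf{R}_+$ is the set of nonnegative reals. $f$ satisfies the joint winner property if $c_{ij}(a,b) \ge \min\{c_{jk}(b,c), c_{ik}(a,c)\}$ for all distinct $i,j,k\in[r]$ and all $a\in D_i, b\in D_j, c\in D_k$. A function with the joint winner property is Z-free if for all distinct $i,j\in[r]$, all distinct $a,b\in D_i$ and all distinct $c,d\in D_j$, the minimum of $c_{ij}(a,c), c_{ij}(a,d), c_{ij}(b,c), c_{ij}(b,d)$ is attained by at least two of these four entries. Running time counts arithmetic operations and comparisons on values in $\mathbf{R}\cup\{+\infty\}$ as unit cost, with all values of the $c_i$ and $c_{ij}$ given as input tables. *)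

theory Defs
  imports Complex_Main "HOL-Library.Extended_Real" "HOL-Library.FuncSet"
    "HOL-Library.Monad_Syntax"
begin

section \<open>Binary valued CSP instances\<close>

text \<open>
  Variables are numbered from 1 to \<open>nvars I\<close>, and the domain of variable \<open>i\<close> is
  \<open>{1..dsize I i}\<close>.  Only the entries \<open>bin_table I i j a b\<close> with \<open>i < j\<close> are meaningful.
  Elements of the reals extended by plus infinity are represented in \<^typ>\<open>ereal\<close>; minus infinity
  is excluded by \<open>wf_inst\<close> for the input, and by the partiality of the operations below
  for all values arising during a computation.
\<close>

record inst =
  nvars :: nat
  dsize :: "nat \<Rightarrow> nat"
  un_table :: "nat \<Rightarrow> nat \<Rightarrow> real"
  bin_table :: "nat \<Rightarrow> nat \<Rightarrow> nat \<Rightarrow> nat \<Rightarrow> ereal"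

definition dom_of :: "inst \<Rightarrow> nat \<Rightarrow> nat set" where
  "dom_of I i = {1..dsize I i}"

definition total_size :: "inst \<Rightarrow> nat" where
  "total_size I = (\<Sum>i\<in>{1..nvars I}. dsize I i)"

definition wf_inst :: "inst \<Rightarrow> bool" where
  "wf_inst I \<longleftrightarrow>
     2 \<le> nvars I \<and>
     (\<forall>i\<in>{1..nvars I}. 2 \<le> dsize I i) \<and>
     (\<forall>i\<in>{1..nvars I}. \<forall>a\<in>dom_of I i. 0 \<le> un_table I i a) \<and>
     (\<forall>i\<in>{1..nvars I}. \<forall>j\<in>{1..nvars I}. i < j \<longrightarrow>
        (\<forall>a\<in>dom_of I i. \<forall>b\<in>dom_of I j. 0 \<le> bin_table I i j a b))"

definition bcost :: "inst \<Rightarrow> nat \<Rightarrow> nat \<Rightarrow> nat \<Rightarrow> nat \<Rightarrow> ereal" where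
  "bcost I i j a b = (if i < j then bin_table I i j a b else bin_table I j i b a)"

definition assignments :: "inst \<Rightarrow> (nat \<Rightarrow> nat) set" where
  "assignments I = (\<Pi>\<^sub>E i\<in>{1..nvars I}. dom_of I i)"

definition objective :: "inst \<Rightarrow> (nat \<Rightarrow> nat) \<Rightarrow> ereal" where
  "objective I x =
     (\<Sum>i\<in>{1..nvars I}. ereal (un_table I i (x i))) +
     (\<Sum>(i, j)\<in>{(i, j). 1 \<le> i \<and> i < j \<and> j \<le> nvars I}. bcost I i j (x i) (x j))"

definition joint_winner :: "inst \<Rightarrow> bool" where
  "joint_winner I \<longleftrightarrow>
     (\<forall>i\<in>{1..nvars I}. \<forall>j\<in>{1..nvars I}. \<forall>k\<in>{1..nvars I}.
        i \<noteq> j \<and> j \<noteq> k \<and> i \<noteq> k \<longrightarrow>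
        (\<forall>a\<in>dom_of I i. \<forall>b\<in>dom_of I j. \<forall>c\<in>dom_of I k.
           bcost I i j a b \<ge> min (bcost I j k b c) (bcost I i k a c)))"

text \<open>The set whose cardinality is taken consists of positions, not of values.\<close>

definition z_free :: "inst \<Rightarrow> bool" where
  "z_free I \<longleftrightarrow>
     (\<forall>i\<in>{1..nvars I}. \<forall>j\<in>{1..nvars I}. i \<noteq> j \<longrightarrow>
        (\<forall>a\<in>dom_of I i. \<forall>b\<in>dom_of I i. \<forall>c\<in>dom_of I j. \<forall>d\<in>dom_of I j.
           a \<noteq> b \<and> c \<noteq> d \<longrightarrow>
           2 \<le> card {p \<in> {a, b} \<times> {c, d}.
                 bcost I i j (fst p) (snd p) =
                 Min ((\<lambda>q. bcost I i j (fst q) (snd q)) ` ({a, b} \<times> {c, d}))}))"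


section \<open>Unit-cost programs\<close>

text \<open>
  Running time is measured on a random access machine over the extended reals, presented as a
  structured imperative language.  There are two sorts of data, each with scalar variables and
  unbounded one-dimensional arrays: natural numbers, used for indices and control, and values.
  The input tables are read-only.  The only way to pass from values to
  indices is to branch on a comparison, and conversely.  Programs are finite
  syntactic objects that do not depend on the instance.

  On indices there are only addition and truncated subtraction: with multiplication at unit cost,
  huge numbers could be used to perform unbounded computations in one step.  For the
  same reason the only value constants are 0, 1 and plus infinity, as an arbitrary real constant
  could encode an infinite amount of advice.
\<close>

type_synonym vname = string

datatype iexp =
    IConst nat
  | IVar vname
  | IArr vname iexp
  | IAdd iexp iexp
  | ISub iexp iexp
  | NumVars
  | DomSize iexp

datatype vexp =
    VZero
  | VOne
  | VInf
  | VVar vname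
  | VArr vname iexp
  | UnTable iexp iexp
  | BinTable iexp iexp iexp iexp
  | VAdd vexp vexp
  | VSub vexp vexp
  | VMul vexp vexp
  | VDiv vexp vexp

datatype bexp =
    ILess iexp iexp
  | VLess vexp vexp
  | BNot bexp
  | BAnd bexp bexp

datatype com =
    Skip
  | IAssign vname iexp
  | IStore vname iexp iexp
  | VAssign vname vexp
  | VStore vname iexp vexp
  | Seq com com
  | If bexp com com
  | While bexp com

record state =
  ivar :: "vname \<Rightarrow> nat"
  iarr :: "vname \<Rightarrow> nat \<Rightarrow> nat"
  vvar :: "vname \<Rightarrow> ereal"
  varr :: "vname \<Rightarrow> nat \<Rightarrow> ereal"

definition init_state :: state where
  "init_state = \<lparr>ivar = (\<lambda>_. 0), iarr = (\<lambda>_ _. 0), vvar = (\<lambda>_. 0), varr = (\<lambda>_ _. 0)\<rparr>"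

text \<open>
  Evaluation is partial: \<^const>\<open>None\<close> means that a table is accessed outside its range or that an
  arithmetic operation is undefined (subtraction of infinity, multiplication or division
  involving infinity, division by zero).  A program evaluating such an expression gets stuck.
\<close>

fun ieval :: "inst \<Rightarrow> state \<Rightarrow> iexp \<Rightarrow> nat option" where
  "ieval I s (IConst k) = Some k"
| "ieval I s (IVar x) = Some (ivar s x)"
| "ieval I s (IArr x e) = do { i \<leftarrow> ieval I s e; Some (iarr s x i) }"
| "ieval I s (IAdd e1 e2) = do { m \<leftarrow> ieval I s e1; n \<leftarrow> ieval I s e2; Some (m + n) }"
| "ieval I s (ISub e1 e2) = do { m \<leftarrow> ieval I s e1; n \<leftarrow> ieval I s e2; Some (m - n) }"
| "ieval I s NumVars = Some (nvars I)"
| "ieval I s (DomSize e) =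
     do { i \<leftarrow> ieval I s e; if i \<in> {1..nvars I} then Some (dsize I i) else None }"

fun veval :: "inst \<Rightarrow> state \<Rightarrow> vexp \<Rightarrow> ereal option" where
  "veval I s VZero = Some 0"
| "veval I s VOne = Some 1"
| "veval I s VInf = Some \<infinity>"
| "veval I s (VVar x) = Some (vvar s x)"
| "veval I s (VArr x e) = do { i \<leftarrow> ieval I s e; Some (varr s x i) }"
| "veval I s (UnTable e1 e2) =
     do { i \<leftarrow> ieval I s e1; a \<leftarrow> ieval I s e2;
          if i \<in> {1..nvars I} \<and> a \<in> dom_of I i then Some (ereal (un_table I i a)) else None }"
| "veval I s (BinTable e1 e2 e3 e4) =
     do { i \<leftarrow> ieval I s e1; j \<leftarrow> ieval I s e2; a \<leftarrow> ieval I s e3; b \<leftarrow> ieval I s e4;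
          if 1 \<le> i \<and> i < j \<and> j \<le> nvars I \<and> a \<in> dom_of I i \<and> b \<in> dom_of I j
          then Some (bin_table I i j a b) else None }"
| "veval I s (VAdd e1 e2) = do { u \<leftarrow> veval I s e1; v \<leftarrow> veval I s e2; Some (u + v) }"
| "veval I s (VSub e1 e2) =
     do { u \<leftarrow> veval I s e1; v \<leftarrow> veval I s e2; if v = \<infinity> then None else Some (u - v) }"
| "veval I s (VMul e1 e2) =
     do { u \<leftarrow> veval I s e1; v \<leftarrow> veval I s e2;
          if u = \<infinity> \<or> v = \<infinity> then None else Some (u * v) }"
| "veval I s (VDiv e1 e2) =
     do { u \<leftarrow> veval I s e1; v \<leftarrow> veval I s e2;
          if u = \<infinity> \<or> v = \<infinity> \<or> v = 0 then None else Some (u / v) }"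

fun beval :: "inst \<Rightarrow> state \<Rightarrow> bexp \<Rightarrow> bool option" where
  "beval I s (ILess e1 e2) = do { m \<leftarrow> ieval I s e1; n \<leftarrow> ieval I s e2; Some (m < n) }"
| "beval I s (VLess e1 e2) = do { u \<leftarrow> veval I s e1; v \<leftarrow> veval I s e2; Some (u < v) }"
| "beval I s (BNot b) = do { p \<leftarrow> beval I s b; Some (\<not> p) }"
| "beval I s (BAnd b1 b2) = do { p \<leftarrow> beval I s b1; q \<leftarrow> beval I s b2; Some (p \<and> q) }"

text \<open>Every node of an expression is evaluated exactly once and is charged one unit.\<close>

fun icost :: "iexp \<Rightarrow> nat" where
  "icost (IConst k) = 1"
| "icost (IVar x) = 1"
| "icost (IArr x e) = 1 + icost e"
| "icost (IAdd e1 e2) = 1 + icost e1 + icost e2"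
| "icost (ISub e1 e2) = 1 + icost e1 + icost e2"
| "icost NumVars = 1"
| "icost (DomSize e) = 1 + icost e"

fun vcost :: "vexp \<Rightarrow> nat" where
  "vcost VZero = 1"
| "vcost VOne = 1"
| "vcost VInf = 1"
| "vcost (VVar x) = 1"
| "vcost (VArr x e) = 1 + icost e"
| "vcost (UnTable e1 e2) = 1 + icost e1 + icost e2"
| "vcost (BinTable e1 e2 e3 e4) = 1 + icost e1 + icost e2 + icost e3 + icost e4"
| "vcost (VAdd e1 e2) = 1 + vcost e1 + vcost e2"
| "vcost (VSub e1 e2) = 1 + vcost e1 + vcost e2"
| "vcost (VMul e1 e2) = 1 + vcost e1 + vcost e2"
| "vcost (VDiv e1 e2) = 1 + vcost e1 + vcost e2"

fun bexp_cost :: "bexp \<Rightarrow> nat" where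
  "bexp_cost (ILess e1 e2) = 1 + icost e1 + icost e2"
| "bexp_cost (VLess e1 e2) = 1 + vcost e1 + vcost e2"
| "bexp_cost (BNot b) = 1 + bexp_cost b"
| "bexp_cost (BAnd b1 b2) = 1 + bexp_cost b1 + bexp_cost b2"

text \<open>
  \<open>exec I p s t s'\<close>: on input \<open>I\<close>, program \<open>p\<close> started in \<open>s\<close> terminates in \<open>s'\<close> after
  \<open>t\<close> time units.
\<close>

inductive exec :: "inst \<Rightarrow> com \<Rightarrow> state \<Rightarrow> nat \<Rightarrow> state \<Rightarrow> bool" for I :: inst where
  Skip: "exec I Skip s 1 s"
| IAssign: "ieval I s e = Some k \<Longrightarrow>
    exec I (IAssign x e) s (1 + icost e) (s\<lparr>ivar := (ivar s)(x := k)\<rparr>)"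
| IStore: "ieval I s e1 = Some i \<Longrightarrow> ieval I s e2 = Some k \<Longrightarrow>
    exec I (IStore x e1 e2) s (1 + icost e1 + icost e2)
      (s\<lparr>iarr := (iarr s)(x := (iarr s x)(i := k))\<rparr>)"
| VAssign: "veval I s e = Some v \<Longrightarrow>
    exec I (VAssign x e) s (1 + vcost e) (s\<lparr>vvar := (vvar s)(x := v)\<rparr>)"
| VStore: "ieval I s e1 = Some i \<Longrightarrow> veval I s e2 = Some v \<Longrightarrow>
    exec I (VStore x e1 e2) s (1 + icost e1 + vcost e2)
      (s\<lparr>varr := (varr s)(x := (varr s x)(i := v))\<rparr>)"
| Seq: "exec I p1 s t1 s' \<Longrightarrow> exec I p2 s' t2 s'' \<Longrightarrow> exec I (Seq p1 p2) s (t1 + t2) s''"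
| IfTrue: "beval I s b = Some True \<Longrightarrow> exec I p1 s t s' \<Longrightarrow>
    exec I (If b p1 p2) s (1 + bexp_cost b + t) s'"
| IfFalse: "beval I s b = Some False \<Longrightarrow> exec I p2 s t s' \<Longrightarrow>
    exec I (If b p1 p2) s (1 + bexp_cost b + t) s'"
| WhileFalse: "beval I s b = Some False \<Longrightarrow>
    exec I (While b p) s (1 + bexp_cost b) s"
| WhileTrue: "beval I s b = Some True \<Longrightarrow> exec I p s t1 s' \<Longrightarrow>
    exec I (While b p) s' t2 s'' \<Longrightarrow>
    exec I (While b p) s (1 + bexp_cost b + t1 + t2) s''"

inductive_cases SkipE: "exec I Skip s t s'"
inductive_cases IAssignE: "exec I (IAssign x e) s t s'"
inductive_cases IStoreE: "exec I (IStore x e1 e2) s t s'"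
inductive_cases VAssignE: "exec I (VAssign x e) s t s'"
inductive_cases VStoreE: "exec I (VStore x e1 e2) s t s'"
inductive_cases SeqE: "exec I (Seq p1 p2) s t s'"
inductive_cases IfE: "exec I (If b p1 p2) s t s'"
inductive_cases WhileE: "exec I (While b p) s t s'"

text \<open>
  Execution is deterministic, so a statement asserting the existence of a run with certain
  properties is one about the unique run.
\<close>

lemma exec_deterministic:
  "exec I p s t s' \<Longrightarrow> exec I p s u s'' \<Longrightarrow> u = t \<and> s'' = s'"
proof (induction arbitrary: u s'' rule: exec.induct)
  case (Skip s)
  from Skip.prems show ?case by (rule SkipE) simp
next
  case (IAssign s e k x)
  from IAssign.prems show ?case by (rule IAssignE) (use IAssign.hyps in simp)
next
  case (IStore s e1 i e2 k x)
  from IStore.prems show ?case by (rule IStoreE) (use IStore.hyps in simp)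
next
  case (VAssign s e v x)
  from VAssign.prems show ?case by (rule VAssignE) (use VAssign.hyps in simp)
next
  case (VStore s e1 i e2 v x)
  from VStore.prems show ?case by (rule VStoreE) (use VStore.hyps in simp)
next
  case (Seq p1 s t1 s1 p2 t2 s2)
  from Seq.prems obtain v1 w v2 where u: "u = v1 + v2"
    and 1: "exec I p1 s v1 w" and 2: "exec I p2 w v2 s''"
    by (blast elim: SeqE)
  from Seq.IH(1)[OF 1] have "v1 = t1" "w = s1" by auto
  with 2 Seq.IH(2) u show ?case by blast
next
  case (IfTrue s b p1 t s' p2)
  from IfTrue.prems show ?case
    by (rule IfE) (use IfTrue.IH IfTrue.hyps(1) in auto)
next
  case (IfFalse s b p2 t s' p1)
  from IfFalse.prems show ?case
    by (rule IfE) (use IfFalse.IH IfFalse.hyps(1) in auto)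
next
  case (WhileFalse s b p)
  from WhileFalse.prems show ?case by (rule WhileE) (use WhileFalse.hyps in simp_all)
next
  case (WhileTrue s b p t1 s' t2 s2)
  from WhileTrue.prems obtain v1 w v2 where u: "u = 1 + bexp_cost b + v1 + v2"
    and 1: "exec I p s v1 w" and 2: "exec I (While b p) w v2 s''"
    by (rule WhileE) (use WhileTrue.hyps(1) in simp_all)
  from WhileTrue.IH(1)[OF 1] have "v1 = t1" "w = s'" by auto
  with 2 WhileTrue.IH(2) u show ?case by blast
qed

text \<open>A program returns an assignment in the index array named \<open>x\<close>.\<close>

definition result :: "inst \<Rightarrow> state \<Rightarrow> nat \<Rightarrow> nat" where
  "result I s = restrict (iarr s ''x'') {1..nvars I}"

definition computes_minimizer_within :: "com \<Rightarrow> inst \<Rightarrow> real \<Rightarrow> bool" where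
  "computes_minimizer_within p I T \<longleftrightarrow>
     (\<exists>t s. exec I p init_state t s \<and> real t \<le> T \<and>
        is_arg_min (objective I) (\<lambda>x. x \<in> assignments I) (result I s))"

end

theory Submission imports Defs begin

text \<open>
  Replacing infinity by a large real and extending the binary costs suitably to pairs of values of
  one variable, one obtains a symmetric function \<open>W\<close> on all values of all variables with
  \<open>W p q \<ge> min (W p z) (W q z)\<close>, and an assignment is a transversal of the partition of the values.

  Variables are released one at a time, the others being frozen at an arbitrary value.  Releasing
  variable \<open>i\<close> requires one augmentation: a cheapest closed walk through \<open>i\<close>, with as few steps as
  possible, in the digraph on the released variables in which the arc from \<open>j\<close> to \<open>l\<close> is weighted
  by the cheapest exchange of the chosen value of \<open>l\<close> for a new value of \<open>j\<close>.  Every change of the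
  assignment is at least as expensive as some permutation in this digraph (a greedy matching).
  Conversely, by the four-point condition for ultrametrics, the interaction of two exchanges is at
  most zero unless swapping their targets preserves the cost; but such a swap splits the walk into
  two closed walks, which the choice of the walk excludes.  The arcs cost time \<open>n r\<close> and the
  shortest walks \<open>r^3\<close> per variable; computing \<open>W\<close> takes time \<open>n^2\<close>.
\<close>

section \<open>Walks and greedy matchings\<close>

text \<open>The obstacle is that \<open>F\<close> is quadratic: exchanges carried out together
  interact, so the cost of a walk need not predict the change that it causes. The linearization is
  rescued by M-convexity: on sets of fixed size, a quadratic function with such a \<open>W\<close>
  is the negative of a valuated matroid, and choosing a best transversal is its intersection with a
  partition matroid. \<open>exchange_lower_bound\<close> and \<open>apply_walk_cost_le\<close> play
  the roles of the upper-bound and unique-max lemmas of that theory and are proved directly. Asking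
  for fewest steps matters in the second: a swap of equal cost would leave a closed walk through the
  new part with fewer steps, and no dearer, because closed walks among the parts released earlier
  cost at least 0. Infinity has to go since exchange costs are differences. Z-freeness enters where
  two values of one variable are compared: together with two values of another variable they span a
  rectangle, about which the joint winner property says nothing.\<close>

fun walk_cost :: "('a \<Rightarrow> 'a \<Rightarrow> real) \<Rightarrow> 'a list \<Rightarrow> real" where
  "walk_cost a (x # y # zs) = a x y + walk_cost a (y # zs)"
| "walk_cost a _ = 0"

lemma walk_cost_append:
  "xs \<noteq> [] \<Longrightarrow> ys \<noteq> [] \<Longrightarrow>
   walk_cost a (xs @ ys) = walk_cost a xs + a (last xs) (hd ys) + walk_cost a ys"
proof (induction xs rule: induct_list012)
  case (2 x)
  then show ?case by (cases ys) auto
next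
  case (3 x y zs)
  then show ?case by simp
qed simp

lemma walk_cost_join:
  "walk_cost a (xs @ y # ys) = walk_cost a (xs @ [y]) + walk_cost a (y # ys)"
  by (cases "xs = []") (auto simp: walk_cost_append)

lemma walk_cost_conv_sum:
  "walk_cost a zs = (\<Sum>t<length zs - 1. a (zs ! t) (zs ! Suc t))"
proof (induction zs rule: induct_list012)
  case (3 x y zs)
  have "walk_cost a (x # y # zs) = a x y + (\<Sum>t<length zs. a ((y # zs) ! t) ((y # zs) ! Suc t))"
    using 3 by simp
  also have "\<dots> = (\<Sum>t<Suc (length zs). a ((x # y # zs) ! t) ((x # y # zs) ! Suc t))"
    by (subst sum.lessThan_Suc_shift) simp
  finally show ?case by simp
qed auto

text \<open>Pairing off a closest cross pair first makes every remaining term nonnegative.\<close>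

lemma greedy_matching:
  fixes W :: "'b \<Rightarrow> 'b \<Rightarrow> real" and u v :: "'a \<Rightarrow> 'b"
  assumes "finite A" "finite B" "card A = card B"
    and sym: "\<And>p q. W p q = W q p" and refl: "\<And>p. W p p = 0"
    and v: "\<And>x y z. x \<in> A \<Longrightarrow> y \<in> A \<Longrightarrow> x \<noteq> y \<Longrightarrow> z \<in> B \<Longrightarrow>
              min (W (v x) (u z)) (W (v y) (u z)) \<le> W (v x) (v y)"
    and u: "\<And>x y z. x \<in> B \<Longrightarrow> y \<in> B \<Longrightarrow> x \<noteq> y \<Longrightarrow> z \<in> A \<Longrightarrow>
              min (W (u x) (v z)) (W (u y) (v z)) \<le> W (u x) (u y)"
  shows "\<exists>\<pi>. bij_betw \<pi> A B \<and>
     - (\<Sum>j\<in>A. W (v j) (u (\<pi> j))) \<le>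
     (\<Sum>j\<in>A. \<Sum>k\<in>A. W (v j) (v k)) / 2 + (\<Sum>j\<in>B. \<Sum>k\<in>B. W (u j) (u k)) / 2
       - (\<Sum>j\<in>A. \<Sum>k\<in>B. W (v j) (u k))"
  using assms(1-3) v u
proof (induction "card A" arbitrary: A B)
  case 0
  then have "A = {}" "B = {}" by auto
  then show ?case by (auto simp: bij_betw_def)
next
  case (Suc m A B)
  have "A \<times> B \<noteq> {}" "finite (A \<times> B)" using Suc.hyps(2) Suc.prems by auto
  then have "Max ((\<lambda>(x, y). W (v x) (u y)) ` (A \<times> B)) \<in> (\<lambda>(x, y). W (v x) (u y)) ` (A \<times> B)"
    by (intro Max_in) auto
  then obtain a b where a: "a \<in> A" and b: "b \<in> B"
    and eq: "W (v a) (u b) = Max ((\<lambda>(x, y). W (v x) (u y)) ` (A \<times> B))" by auto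
  have max: "W (v x) (u y) \<le> W (v a) (u b)" if "x \<in> A" "y \<in> B" for x y
    unfolding eq using that \<open>finite (A \<times> B)\<close> by (intro Max_ge) auto
  define A' B' where "A' = A - {a}" and "B' = B - {b}"
  have A: "A = insert a A'" "a \<notin> A'" "finite A'" and B: "B = insert b B'" "b \<notin> B'" "finite B'"
    using a b Suc.prems by (auto simp: A'_def B'_def)
  have "\<exists>\<pi>. bij_betw \<pi> A' B' \<and>
     - (\<Sum>j\<in>A'. W (v j) (u (\<pi> j))) \<le>
     (\<Sum>j\<in>A'. \<Sum>k\<in>A'. W (v j) (v k)) / 2 + (\<Sum>j\<in>B'. \<Sum>k\<in>B'. W (u j) (u k)) / 2
       - (\<Sum>j\<in>A'. \<Sum>k\<in>B'. W (v j) (u k))"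
    using Suc.prems Suc.hyps(2) A B by (intro Suc.hyps(1)) auto
  then obtain \<pi> where \<pi>: "bij_betw \<pi> A' B'" and le: "- (\<Sum>j\<in>A'. W (v j) (u (\<pi> j))) \<le>
     (\<Sum>j\<in>A'. \<Sum>k\<in>A'. W (v j) (v k)) / 2 + (\<Sum>j\<in>B'. \<Sum>k\<in>B'. W (u j) (u k)) / 2
       - (\<Sum>j\<in>A'. \<Sum>k\<in>B'. W (v j) (u k))"
    by blast
  define \<rho> where "\<rho> = \<pi>(a := b)"
  have "bij_betw \<rho> A' B'"
    using \<pi> A(2) unfolding \<rho>_def by (subst bij_betw_cong[of _ _ \<pi>]) auto
  then have \<rho>: "bij_betw \<rho> A B"
    using notIn_Un_bij_betw[of a A' \<rho> B'] A B by (simp add: \<rho>_def)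
  have s: "(\<Sum>j\<in>A. W (v j) (u (\<rho> j))) = W (v a) (u b) + (\<Sum>j\<in>A'. W (v j) (u (\<pi> j)))"
    using A(2,3) by (auto simp: A(1) \<rho>_def intro!: sum.cong)
  \<comment> \<open>Since \<open>W (v a) (u b)\<close> is largest among the cross pairs, the minimum
    in the ultrametric inequality is the other term. So cross terms of \<open>u b\<close> are
    covered by inner terms of \<open>v a\<close>, and vice versa.\<close>
  have 1: "(\<Sum>k\<in>A'. W (v k) (u b)) \<le> (\<Sum>k\<in>A'. W (v a) (v k))"
  proof (rule sum_mono)
    fix k assume k: "k \<in> A'"
    show "W (v k) (u b) \<le> W (v a) (v k)"
      using Suc.prems(4)[of a k b] max[of k b] a b k A(2) by (force simp: A'_def)
  qed
  have 2: "(\<Sum>k\<in>B'. W (v a) (u k)) \<le> (\<Sum>k\<in>B'. W (u b) (u k))"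
  proof (rule sum_mono)
    fix k assume k: "k \<in> B'"
    show "W (v a) (u k) \<le> W (u b) (u k)"
      using Suc.prems(5)[of b k a] max[of a k] a b k B(2) by (force simp: B'_def sym)
  qed
  have 3: "(\<Sum>j\<in>A. \<Sum>k\<in>A. W (v j) (v k)) =
      2 * (\<Sum>k\<in>A'. W (v a) (v k)) + (\<Sum>j\<in>A'. \<Sum>k\<in>A'. W (v j) (v k))"
    using A(2,3) by (simp add: A(1) sum.distrib refl sym[of _ "v a"])
  have 4: "(\<Sum>j\<in>B. \<Sum>k\<in>B. W (u j) (u k)) =
      2 * (\<Sum>k\<in>B'. W (u b) (u k)) + (\<Sum>j\<in>B'. \<Sum>k\<in>B'. W (u j) (u k))"
    using B(2,3) by (simp add: B(1) sum.distrib refl sym[of _ "u b"])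
  have 5: "(\<Sum>j\<in>A. \<Sum>k\<in>B. W (v j) (u k)) = W (v a) (u b) + (\<Sum>k\<in>B'. W (v a) (u k))
      + (\<Sum>k\<in>A'. W (v k) (u b)) + (\<Sum>j\<in>A'. \<Sum>k\<in>B'. W (v j) (u k))"
    using A(2,3) B(2,3) by (simp add: A(1) B(1) sum.distrib)
  have "- (\<Sum>j\<in>A. W (v j) (u (\<rho> j))) \<le>
     (\<Sum>j\<in>A. \<Sum>k\<in>A. W (v j) (v k)) / 2 + (\<Sum>j\<in>B. \<Sum>k\<in>B. W (u j) (u k)) / 2
       - (\<Sum>j\<in>A. \<Sum>k\<in>B. W (v j) (u k))"
    unfolding s 3 4 5 using le 1 2 by (simp add: add_divide_distrib)
  with \<rho> show ?case by blast
qed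

section \<open>Optimal transversals\<close>

text \<open>With \<open>q\<close> arbitrary, \<open>part_two\<close> says that each part has at
  least two elements. A part thus always offers an alternative to its chosen element, and the minima
  over \<open>cand\<close> are over nonempty sets.\<close>

locale transversal_problem =
  fixes n r :: nat and P :: "nat \<Rightarrow> nat" and w :: "nat \<Rightarrow> real" and W :: "nat \<Rightarrow> nat \<Rightarrow> real"
  assumes W_sym: "W p q = W q p"
    and W_refl: "W p p = 0"
    and W_ultra: "p \<in> {1..n} \<Longrightarrow> q \<in> {1..n} \<Longrightarrow> z \<in> {1..n} \<Longrightarrow> p \<noteq> q \<Longrightarrow> p \<noteq> z \<Longrightarrow> q \<noteq> z \<Longrightarrow>
      min (W p z) (W q z) \<le> W p q"
    and part_two: "j \<in> {1..r} \<Longrightarrow> \<exists>p\<in>{1..n}. P p = j \<and> p \<noteq> q"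
begin

section \<open>Exchange costs and the exchange digraph\<close>

definition transversal :: "(nat \<Rightarrow> nat) \<Rightarrow> bool" where
  "transversal S \<longleftrightarrow> (\<forall>j\<in>{1..r}. S j \<in> {1..n} \<and> P (S j) = j)"

definition F :: "(nat \<Rightarrow> nat) \<Rightarrow> real" where
  "F S = (\<Sum>j\<in>{1..r}. w (S j)) + (\<Sum>j\<in>{1..r}. \<Sum>k\<in>{1..r}. W (S j) (S k)) / 2"

text \<open>The gradient of \<open>F\<close>, read as a quadratic function of the indicator vector
  of the chosen set. Once it is tabulated, every swap cost is available in constant time.\<close>

definition H :: "(nat \<Rightarrow> nat) \<Rightarrow> nat \<Rightarrow> real" where
  "H S p = w p + (\<Sum>k\<in>{1..r}. W p (S k))"

text \<open>The increase of \<open>F\<close>, extended to arbitrary sets, when \<open>p\<close> replaces \<open>S l\<close>.\<close>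

definition swap_cost :: "(nat \<Rightarrow> nat) \<Rightarrow> nat \<Rightarrow> nat \<Rightarrow> real" where
  "swap_cost S p l = H S p - W p (S l) - H S (S l)"

definition cand :: "(nat \<Rightarrow> nat) \<Rightarrow> nat \<Rightarrow> nat set" where
  "cand S j = {p \<in> {1..n}. P p = j \<and> p \<noteq> S j}"

definition arc :: "(nat \<Rightarrow> nat) \<Rightarrow> nat \<Rightarrow> nat \<Rightarrow> real" where
  "arc S j l = Min ((\<lambda>p. swap_cost S p l) ` cand S j)"

text \<open>The parts beyond \<open>i\<close> are frozen.\<close>

definition optimal_upto :: "nat \<Rightarrow> (nat \<Rightarrow> nat) \<Rightarrow> bool" where
  "optimal_upto i S \<longleftrightarrow> transversal S \<and>
     (\<forall>Y. transversal Y \<and> (\<forall>k\<in>{1..r}. i < k \<longrightarrow> Y k = S k) \<longrightarrow> F S \<le> F Y)"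

text \<open>Ties are left open: the results hold for any \<open>g\<close> that attains the arc
  weights, in particular for the one that the program happens to record.\<close>

definition realizes_arcs :: "(nat \<Rightarrow> nat) \<Rightarrow> (nat \<Rightarrow> nat \<Rightarrow> nat) \<Rightarrow> bool" where
  "realizes_arcs S g \<longleftrightarrow>
     (\<forall>j\<in>{1..r}. \<forall>l\<in>{1..r}. g j l \<in> cand S j \<and> swap_cost S (g j l) l = arc S j l)"

lemma finite_cand [simp]: "finite (cand S j)"
  by (auto simp: cand_def)

lemma cand_nonempty: "j \<in> {1..r} \<Longrightarrow> cand S j \<noteq> {}"
  using part_two[of j "S j"] by (auto simp: cand_def)

lemma arc_le: "p \<in> cand S j \<Longrightarrow> arc S j l \<le> swap_cost S p l"
  by (simp add: arc_def)

lemma realizes_arcs_exists: "\<exists>g. realizes_arcs S g"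
proof -
  have "\<exists>p\<in>cand S j. swap_cost S p l = arc S j l" if "j \<in> {1..r}" for j l
  proof -
    have "arc S j l \<in> (\<lambda>p. swap_cost S p l) ` cand S j"
      unfolding arc_def using cand_nonempty[OF that] by (intro Min_in) auto
    then show ?thesis by auto
  qed
  then show ?thesis unfolding realizes_arcs_def by metis
qed

section \<open>Exchange inequalities: expansion of \<open>F\<close>, permutation bound, four-point
  condition\<close>

lemma transversal_inj: "transversal S \<Longrightarrow> inj_on S {1..r}"
  by (metis inj_onI transversal_def)

text \<open>Exact second-order expansion of the quadratic \<open>F\<close> at \<open>S\<close>. Its
  summands vanish where \<open>Y\<close> and \<open>S\<close> agree, which confines the sums to
  \<open>J\<close>.\<close>

lemma F_diff:
  assumes J: "J \<subseteq> {1..r}" and eq: "\<And>j. j \<in> {1..r} - J \<Longrightarrow> Y j = S j"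
  shows "F Y - F S = (\<Sum>j\<in>J. H S (Y j) - H S (S j)) +
    (\<Sum>j\<in>J. \<Sum>k\<in>J. W (Y j) (Y k) + W (S j) (S k) - W (Y j) (S k) - W (S j) (Y k)) / 2"
proof -
  let ?R = "{1..r}"
  let ?B = "\<lambda>j k. W (Y j) (Y k) + W (S j) (S k) - W (Y j) (S k) - W (S j) (Y k)"
  have sw: "(\<Sum>j\<in>?R. \<Sum>k\<in>?R. W (S j) (Y k)) = (\<Sum>j\<in>?R. \<Sum>k\<in>?R. W (Y j) (S k))"
    by (subst sum.swap) (intro sum.cong[OF refl], rule W_sym)
  have "F Y - F S = (\<Sum>j\<in>?R. H S (Y j) - H S (S j)) + (\<Sum>j\<in>?R. \<Sum>k\<in>?R. ?B j k) / 2"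
    by (simp add: F_def H_def sum_subtractf sum.distrib sw[simplified] field_simps)
  also have "(\<Sum>j\<in>?R. H S (Y j) - H S (S j)) = (\<Sum>j\<in>J. H S (Y j) - H S (S j))"
    using J eq by (intro sum.mono_neutral_right) auto
  also have "(\<Sum>j\<in>?R. \<Sum>k\<in>?R. ?B j k) = (\<Sum>j\<in>?R. \<Sum>k\<in>J. ?B j k)"
    using J eq by (intro sum.cong sum.mono_neutral_right) auto
  also have "\<dots> = (\<Sum>j\<in>J. \<Sum>k\<in>J. ?B j k)"
    using J eq by (intro sum.mono_neutral_right) auto
  finally show ?thesis .
qed

text \<open>A greedy matching between new and old elements bounds the interaction term of
  \<open>F_diff\<close> from below by the corrections \<open>- W (Y j) (S (\<pi> j))\<close> of
  single swaps. As \<open>\<pi>\<close> permutes \<open>J\<close>, the gradients at the removed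
  elements can be regrouped along it, and swap costs appear.\<close>

lemma exchange_lower_bound:
  assumes S: "transversal S" and Y: "transversal Y"
  defines "J \<equiv> {j \<in> {1..r}. Y j \<noteq> S j}"
  shows "\<exists>\<pi>. bij_betw \<pi> J J \<and> (\<Sum>j\<in>J. arc S j (\<pi> j)) \<le> F Y - F S"
proof -
  have fin: "finite J" by (simp add: J_def)
  have neq: "Y x \<noteq> Y y" "S x \<noteq> S y" if "x \<in> J" "y \<in> J" "x \<noteq> y" for x y
    using that inj_on_contraD[OF transversal_inj[OF Y], of x y]
      inj_on_contraD[OF transversal_inj[OF S], of x y] by (simp_all add: J_def)
  \<comment> \<open>A new element that had been chosen before would be the old choice of its own
    part, which changes on \<open>J\<close>.\<close>
  have neq': "Y x \<noteq> S y" if "x \<in> J" "y \<in> J" for x y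
  proof
    assume eq: "Y x = S y"
    have "P (Y x) = x" "P (S y) = y" using that S Y by (auto simp: J_def transversal_def)
    then have "x = y" using eq by simp
    then show False using eq that by (simp add: J_def)
  qed
  have n: "Y x \<in> {1..n}" "S x \<in> {1..n}" if "x \<in> J" for x
    using that S Y by (auto simp: J_def transversal_def)
  have "\<exists>\<pi>. bij_betw \<pi> J J \<and>
     - (\<Sum>j\<in>J. W (Y j) (S (\<pi> j))) \<le>
     (\<Sum>j\<in>J. \<Sum>k\<in>J. W (Y j) (Y k)) / 2 + (\<Sum>j\<in>J. \<Sum>k\<in>J. W (S j) (S k)) / 2
       - (\<Sum>j\<in>J. \<Sum>k\<in>J. W (Y j) (S k))"
  proof (rule greedy_matching[OF fin fin refl W_sym W_refl])
    fix x y z assume a: "x \<in> J" "y \<in> J" "x \<noteq> y" "z \<in> J"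
    show "min (W (Y x) (S z)) (W (Y y) (S z)) \<le> W (Y x) (Y y)"
      by (intro W_ultra n a neq neq')
    show "min (W (S x) (Y z)) (W (S y) (Y z)) \<le> W (S x) (S y)"
      by (intro W_ultra n a neq neq'[symmetric])
  qed
  then obtain \<pi> where \<pi>: "bij_betw \<pi> J J" and le: "- (\<Sum>j\<in>J. W (Y j) (S (\<pi> j))) \<le>
     (\<Sum>j\<in>J. \<Sum>k\<in>J. W (Y j) (Y k)) / 2 + (\<Sum>j\<in>J. \<Sum>k\<in>J. W (S j) (S k)) / 2
       - (\<Sum>j\<in>J. \<Sum>k\<in>J. W (Y j) (S k))" by blast
  have sw: "(\<Sum>j\<in>J. \<Sum>k\<in>J. W (S j) (Y k)) = (\<Sum>j\<in>J. \<Sum>k\<in>J. W (Y j) (S k))"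
    by (subst sum.swap) (intro sum.cong[OF refl], rule W_sym)
  have "(\<Sum>j\<in>J. arc S j (\<pi> j)) \<le> (\<Sum>j\<in>J. swap_cost S (Y j) (\<pi> j))"
    using Y by (intro sum_mono arc_le) (auto simp: J_def cand_def transversal_def)
  also have "\<dots> = (\<Sum>j\<in>J. H S (Y j)) - (\<Sum>j\<in>J. W (Y j) (S (\<pi> j))) - (\<Sum>j\<in>J. H S (S (\<pi> j)))"
    by (simp add: swap_cost_def sum_subtractf)
  also have "(\<Sum>j\<in>J. H S (S (\<pi> j))) = (\<Sum>j\<in>J. H S (S j))"
    by (rule sum.reindex_bij_betw[OF \<pi>])
  also have "(\<Sum>j\<in>J. H S (Y j)) - (\<Sum>j\<in>J. W (Y j) (S (\<pi> j))) - (\<Sum>j\<in>J. H S (S j)) \<le> F Y - F S"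
  proof -
    have "F Y - F S = (\<Sum>j\<in>J. H S (Y j) - H S (S j)) +
      (\<Sum>j\<in>J. \<Sum>k\<in>J. W (Y j) (Y k) + W (S j) (S k) - W (Y j) (S k) - W (S j) (Y k)) / 2"
      by (rule F_diff) (auto simp: J_def)
    then show ?thesis using le by (simp add: sum_subtractf sum.distrib sw field_simps)
  qed
  finally show ?thesis using \<pi> by blast
qed

text \<open>For an ultrametric similarity the two smallest of the three pair sums on four points
  coincide. If two of the sums differ, the third therefore equals the smaller of them.\<close>

lemma four_point:
  assumes "{p, q, u, v} \<subseteq> {1..n}" "distinct [p, q, u, v]"
    and "W p u + W q v \<noteq> W p v + W q u"
  shows "W p q + W u v \<le> W p v + W q u"
  using assms(3) W_ultra[of p q u] W_ultra[of p q v] W_ultra[of u v p] W_ultra[of u v q]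
    W_ultra[of p u q] W_ultra[of p u v] W_ultra[of p v q] W_ultra[of p v u]
    W_ultra[of q u p] W_ultra[of q u v] W_ultra[of q v p] W_ultra[of q v u] assms(1,2)
  by (simp add: W_sym[of q p] W_sym[of u p] W_sym[of v p] W_sym[of u q] W_sym[of v q] W_sym[of v u])
     (smt (verit))

section \<open>Carrying out the exchanges of a closed walk\<close>

fun apply_walk :: "(nat \<Rightarrow> nat \<Rightarrow> nat) \<Rightarrow> nat list \<Rightarrow> (nat \<Rightarrow> nat) \<Rightarrow> nat \<Rightarrow> nat" where
  "apply_walk g (x # y # zs) S = (apply_walk g (y # zs) S)(x := g x y)"
| "apply_walk g _ S = S"

lemma apply_walk_notin: "j \<notin> set (butlast zs) \<Longrightarrow> apply_walk g zs S j = S j"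
  by (induction zs rule: induct_list012) auto

lemma apply_walk_nth:
  "distinct (butlast zs) \<Longrightarrow> Suc t < length zs \<Longrightarrow> apply_walk g zs S (zs ! t) = g (zs ! t) (zs ! Suc t)"
proof (induction zs arbitrary: t rule: induct_list012)
  case (3 x y zs)
  show ?case
  proof (cases t)
    case (Suc t')
    have "(y # zs) ! t' \<in> set (butlast (y # zs))"
      using 3(4) Suc by (metis Suc_less_SucD length_Cons length_butlast less_diff_conv nth_butlast
        nth_mem Suc_eq_plus1)
    then have "(y # zs) ! t' \<noteq> x" using 3(3) by auto
    then show ?thesis using 3(2)[of t'] 3(3,4) Suc by auto
  qed auto
qed auto

lemma apply_walk_transversal:
  assumes "transversal S" "realizes_arcs S g" "set zs \<subseteq> {1..r}"
  shows "transversal (apply_walk g zs S)"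
  using assms(3)
proof (induction zs rule: induct_list012)
  case (3 x y zs)
  then have "g x y \<in> cand S x" using assms(2) by (auto simp: realizes_arcs_def)
  then show ?case using 3 by (auto simp: transversal_def cand_def)
qed (use assms(1) in auto)

lemma sum_shift_closed:
  fixes z :: "nat \<Rightarrow> 'b" and h :: "'b \<Rightarrow> 'c::comm_monoid_add"
  assumes "z m = z 0"
  shows "(\<Sum>t<m. h (z (Suc t))) = (\<Sum>t<m. h (z t))"
proof (cases m)
  case (Suc k)
  have "(\<Sum>t<m. h (z (Suc t))) = (\<Sum>t<k. h (z (Suc t))) + h (z 0)"
    using assms Suc by simp
  also have "\<dots> = (\<Sum>t<m. h (z t))"
    unfolding Suc by (subst sum.lessThan_Suc_shift) (simp add: add.commute)
  finally show ?thesis .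
qed simp

text \<open>In the expansion of \<open>F_diff\<close>, the terms of single exchanges add up to the
  cost of the walk. What remains is the interaction of distinct exchanges, which
  \<open>four_point\<close> shows to be at most 0 when swapping their targets alters the
  cost.\<close>

lemma apply_walk_cost_le:
  assumes S: "transversal S" and g: "realizes_arcs S g"
    and xs: "distinct xs" "xs \<noteq> []" "set xs \<subseteq> {1..r}"
  defines "zs \<equiv> xs @ [hd xs]"
  assumes noswap: "\<And>s t. s < t \<Longrightarrow> t < length xs \<Longrightarrow>
     swap_cost S (g (zs ! s) (zs ! Suc s)) (zs ! Suc s) + swap_cost S (g (zs ! t) (zs ! Suc t)) (zs ! Suc t) \<noteq>
     swap_cost S (g (zs ! s) (zs ! Suc s)) (zs ! Suc t) + swap_cost S (g (zs ! t) (zs ! Suc t)) (zs ! Suc s)"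
  shows "F (apply_walk g zs S) - F S \<le> walk_cost (arc S) zs"
proof -
  let ?Y = "apply_walk g zs S"
  let ?z = "\<lambda>t. zs ! t"
  define m where "m = length xs"
  have len: "length zs = Suc m" by (simp add: zs_def m_def)
  have closed: "?z m = ?z 0" using xs by (simp add: zs_def m_def nth_append hd_conv_nth)
  have zx: "?z t = xs ! t" if "t < m" for t using that by (simp add: zs_def m_def nth_append)
  have zs_set: "set zs \<subseteq> {1..r}" using xs hd_in_set[of xs] by (auto simp: zs_def simp del: hd_in_set)
  have zr: "?z t \<in> {1..r}" if "t \<le> m" for t using zs_set len that by (metis less_Suc_eq_le nth_mem subsetD)
  have inj: "inj_on ?z {..<m}"
    using xs(1) by (auto simp: inj_on_def zx m_def nth_eq_iff_index_eq)
  have img: "?z ` {..<m} = set xs"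
    using zx by (force simp: m_def set_conv_nth image_iff)
  have Yz: "?Y (?z t) = g (?z t) (?z (Suc t))" if "t < m" for t
    using that xs len by (intro apply_walk_nth) (auto simp: zs_def)
  have Yt: "transversal ?Y" by (rule apply_walk_transversal[OF S g zs_set])
  have out: "?Y j = S j" if "j \<notin> set xs" for j
    using that by (simp add: apply_walk_notin zs_def)
  have gc: "g (?z t) (?z (Suc t)) \<in> cand S (?z t)" and gv: "swap_cost S (g (?z t) (?z (Suc t))) (?z (Suc t)) = arc S (?z t) (?z (Suc t))"
    if "t < m" for t using g zr[of t] zr[of "Suc t"] that by (auto simp: realizes_arcs_def)
  \<comment> \<open>Exchange \<open>t\<close> brings in \<open>v t\<close> and drops
    \<open>u t\<close>, the old element of its target rather than of its source. On a closed walk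
    this merely relabels the dropped elements, and it makes the exchanged pairs those of the
    arcs.\<close>
  define v where "v t = ?Y (?z t)" for t
  define u where "u t = S (?z (Suc t))" for t
  have vneq: "v s \<noteq> v t" if "s < m" "t < m" "s \<noteq> t" for s t
  proof -
    have "?z s \<noteq> ?z t" using inj that by (auto simp: inj_on_def)
    then show ?thesis using Yt zr that unfolding v_def transversal_def by (metis less_imp_le)
  qed
  have sneq: "?z (Suc s) \<noteq> ?z (Suc t)" if "s < m" "t < m" "s \<noteq> t" for s t
  proof -
    have "?z (Suc s) = ?z (if Suc s = m then 0 else Suc s)" "?z (Suc t) = ?z (if Suc t = m then 0 else Suc t)"
      using closed by auto
    moreover have "?z (if Suc s = m then 0 else Suc s) \<noteq> ?z (if Suc t = m then 0 else Suc t)"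
      using inj_onD[OF inj, of "if Suc s = m then 0 else Suc s" "if Suc t = m then 0 else Suc t"] that
      by (auto split: if_splits)
    ultimately show ?thesis by simp
  qed
  have uneq: "u s \<noteq> u t" if "s < m" "t < m" "s \<noteq> t" for s t
    using sneq[OF that] S zr that unfolding u_def transversal_def by (metis Suc_le_eq)
  have vu: "v s \<noteq> u t" if "s < m" "t < m" for s t
  proof
    assume eq: "v s = u t"
    have "P (v s) = ?z s" using Yt zr that by (simp add: v_def transversal_def)
    moreover have "P (u t) = ?z (Suc t)" using S zr that by (simp add: u_def transversal_def)
    ultimately have "u t = S (?z s)" using eq by (simp add: u_def)
    then show False using gc[of s] eq that by (simp add: v_def Yz cand_def)
  qed
  have vn: "v t \<in> {1..n}" and un: "u t \<in> {1..n}" if "t < m" for t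
    using Yt S zr that by (auto simp: v_def u_def transversal_def)
  \<comment> \<open>The gradients cancel in \<open>noswap\<close>; what is left is the hypothesis of
    \<open>four_point\<close>.\<close>
  have ns: "W (v s) (u s) + W (v t) (u t) \<noteq> W (v s) (u t) + W (v t) (u s)" if "s < m" "t < m" "s \<noteq> t" for s t
  proof -
    have *: "W (v s) (u s) + W (v t) (u t) \<noteq> W (v s) (u t) + W (v t) (u s)" if "s < t" "t < m" for s t
      using noswap[of s t] that unfolding swap_cost_def
      by (simp add: m_def v_def u_def Yz)
    show ?thesis using *[of s t] *[of t s] that by (cases "s < t") auto
  qed
  \<comment> \<open>Off the diagonal the interaction is at most 0. On the diagonal it is twice the
    correction term of the swap cost, and the double sum is halved.\<close>
  have B: "W (v s) (v t) + W (u s) (u t) - W (v s) (u t) - W (u s) (v t) \<le> (if s = t then - 2 * W (v s) (u s) else 0)"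
    if "s < m" "t < m" for s t
  proof (cases "s = t")
    case True
    then show ?thesis by (simp add: W_refl W_sym)
  next
    case False
    have "W (v s) (v t) + W (u s) (u t) \<le> W (v s) (u t) + W (v t) (u s)"
      using that False vn un vneq[of s t] uneq[of s t] vu vu ns[of s t] by (intro four_point) auto
    then show ?thesis using False by (simp add: W_sym)
  qed
  have "F ?Y - F S = (\<Sum>j\<in>set xs. H S (?Y j) - H S (S j)) +
    (\<Sum>j\<in>set xs. \<Sum>k\<in>set xs. W (?Y j) (?Y k) + W (S j) (S k) - W (?Y j) (S k) - W (S j) (?Y k)) / 2"
    using xs out by (intro F_diff) auto
  also have "\<dots> = (\<Sum>t<m. H S (?Y (?z t)) - H S (S (?z t))) +
    (\<Sum>s<m. \<Sum>t<m. W (?Y (?z s)) (?Y (?z t)) + W (S (?z s)) (S (?z t)) - W (?Y (?z s)) (S (?z t)) - W (S (?z s)) (?Y (?z t))) / 2"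
    unfolding img[symmetric] sum.reindex[OF inj] by simp
  also have "(\<Sum>t<m. H S (?Y (?z t)) - H S (S (?z t))) = (\<Sum>t<m. H S (v t) - H S (u t))"
    unfolding v_def u_def sum_subtractf using sum_shift_closed[of ?z m "\<lambda>j. H S (S j)"] closed by simp
  also have "(\<Sum>s<m. \<Sum>t<m. W (?Y (?z s)) (?Y (?z t)) + W (S (?z s)) (S (?z t)) - W (?Y (?z s)) (S (?z t)) - W (S (?z s)) (?Y (?z t)))
     = (\<Sum>s<m. \<Sum>t<m. W (v s) (v t) + W (u s) (u t) - W (v s) (u t) - W (u s) (v t))"
  proof -
    note sh = sum_shift_closed[of ?z m, OF closed]
    have "(\<Sum>s<m. \<Sum>t<m. W (S (?z s)) (S (?z t))) = (\<Sum>s<m. \<Sum>t<m. W (u s) (u t))"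
      unfolding u_def
      by (subst sh[of "\<lambda>j. \<Sum>t<m. W (S j) (S (?z (Suc t)))"], subst sh[of "\<lambda>k. W (S _) (S k)"]) simp
    moreover have "(\<Sum>s<m. \<Sum>t<m. W (?Y (?z s)) (S (?z t))) = (\<Sum>s<m. \<Sum>t<m. W (v s) (u t))"
      unfolding u_def v_def by (subst sh[of "\<lambda>k. W (?Y _) (S k)"]) simp
    moreover have "(\<Sum>s<m. \<Sum>t<m. W (S (?z s)) (?Y (?z t))) = (\<Sum>s<m. \<Sum>t<m. W (u s) (v t))"
      unfolding u_def v_def by (subst sh[of "\<lambda>k. \<Sum>t<m. W (S k) (?Y (?z t))"]) simp
    ultimately show ?thesis by (simp add: sum_subtractf sum.distrib v_def)
  qed
  also have "(\<Sum>t<m. H S (v t) - H S (u t)) + (\<Sum>s<m. \<Sum>t<m. W (v s) (v t) + W (u s) (u t) - W (v s) (u t) - W (u s) (v t)) / 2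
     \<le> (\<Sum>t<m. H S (v t) - H S (u t)) + (\<Sum>s<m. \<Sum>t<m. if s = t then - 2 * W (v s) (u s) else 0) / 2"
    using B by (intro add_left_mono divide_right_mono sum_mono) auto
  also have "\<dots> = (\<Sum>t<m. H S (v t) - H S (u t) - W (v t) (u t))"
    by (simp add: sum_subtractf sum_negf sum_distrib_left[symmetric])
  also have "\<dots> = (\<Sum>t<m. arc S (?z t) (?z (Suc t)))"
    by (intro sum.cong) (auto simp: gv[symmetric] swap_cost_def v_def u_def Yz)
  also have "\<dots> = walk_cost (arc S) zs"
    by (simp add: walk_cost_conv_sum len)
  finally show ?thesis .
qed

text \<open>
  If the targets of two arcs of a closed walk can be swapped at equal cost, then the swap splits
  \<open>A @ B @ C\<close> into the closed walks \<open>A @ C\<close> and \<open>B @ [hd B]\<close>.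
\<close>

lemma apply_walk_or_split:
  assumes S: "transversal S" and g: "realizes_arcs S g"
    and xs: "distinct xs" "xs \<noteq> []" "set xs \<subseteq> {1..r}"
  shows "F (apply_walk g (xs @ [hd xs]) S) - F S \<le> walk_cost (arc S) (xs @ [hd xs]) \<or>
    (\<exists>A B C. A \<noteq> [] \<and> B \<noteq> [] \<and> C \<noteq> [] \<and> xs @ [hd xs] = A @ B @ C \<and>
       walk_cost (arc S) (A @ C) + walk_cost (arc S) (B @ [hd B]) \<le> walk_cost (arc S) (xs @ [hd xs]))"
proof (rule disjCI)
  define zs where "zs = xs @ [hd xs]"
  assume no: "\<not> (\<exists>A B C. A \<noteq> [] \<and> B \<noteq> [] \<and> C \<noteq> [] \<and> xs @ [hd xs] = A @ B @ C \<and>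
       walk_cost (arc S) (A @ C) + walk_cost (arc S) (B @ [hd B]) \<le> walk_cost (arc S) (xs @ [hd xs]))"
  show "F (apply_walk g (xs @ [hd xs]) S) - F S \<le> walk_cost (arc S) (xs @ [hd xs])"
  proof (rule apply_walk_cost_le[OF S g xs], fold zs_def, rule notI)
    fix s t
    assume st: "s < t" "t < length xs"
    and eq: "swap_cost S (g (zs ! s) (zs ! Suc s)) (zs ! Suc s) + swap_cost S (g (zs ! t) (zs ! Suc t)) (zs ! Suc t) =
     swap_cost S (g (zs ! s) (zs ! Suc s)) (zs ! Suc t) + swap_cost S (g (zs ! t) (zs ! Suc t)) (zs ! Suc s)"
    \<comment> \<open>\<open>A\<close> ends at the source of step \<open>s\<close>, \<open>B\<close>
      runs from its target to the source of step \<open>t\<close>, and \<open>C\<close> starts at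
      the target of step \<open>t\<close>.\<close>
    define A B C where "A = take (Suc s) zs" and "B = take (t - s) (drop (Suc s) zs)" and "C = drop (Suc t) zs"
    have len: "length zs = Suc (length xs)" by (simp add: zs_def)
    have zr: "zs ! k \<in> {1..r}" if "k < length zs" for k
      using nth_mem[OF that] xs hd_in_set[of xs] by (auto simp: zs_def simp del: hd_in_set)
    have ne: "A \<noteq> []" "B \<noteq> []" "C \<noteq> []" using st len by (auto simp: A_def B_def C_def)
    have "drop (Suc s) zs = B @ C"
      using append_take_drop_id[of "t - s" "drop (Suc s) zs"] st by (simp add: B_def C_def)
    then have ABC: "zs = A @ B @ C" by (metis A_def append_take_drop_id)
    have l: "last A = zs ! s" "hd B = zs ! Suc s" "last B = zs ! t" "hd C = zs ! Suc t"
      using st len ne by (auto simp: A_def B_def C_def last_conv_nth hd_conv_nth)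
    \<comment> \<open>An element brought in by a step is a candidate of the source whatever the
      target, so its swap cost also bounds the arc to the other target.\<close>
    have 1: "arc S (zs ! s) (zs ! Suc t) + arc S (zs ! t) (zs ! Suc s) \<le> arc S (zs ! s) (zs ! Suc s) + arc S (zs ! t) (zs ! Suc t)"
    proof -
      have "g (zs ! k) (zs ! Suc k) \<in> cand S (zs ! k) \<and> swap_cost S (g (zs ! k) (zs ! Suc k)) (zs ! Suc k) = arc S (zs ! k) (zs ! Suc k)"
        if "k < length xs" for k
        using g zr[of k] zr[of "Suc k"] that len by (auto simp: realizes_arcs_def)
      from this[of s] this[of t] show ?thesis
        using eq st arc_le[of "g (zs ! s) (zs ! Suc s)" S "zs ! s" "zs ! Suc t"]
          arc_le[of "g (zs ! t) (zs ! Suc t)" S "zs ! t" "zs ! Suc s"] by auto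
    qed
    have "walk_cost (arc S) (A @ C) + walk_cost (arc S) (B @ [hd B]) \<le> walk_cost (arc S) zs"
      using 1[folded l] ne by (simp add: ABC walk_cost_append)
    then show False using no ne ABC by (auto simp: zs_def)
  qed
qed

text \<open>Induction on the number of nodes. A repeated node cuts the walk into two shorter closed
  walks. A simple walk either can be carried out, so that a negative cost would improve the optimal
  \<open>S\<close>, or splits into two closed walks with fewer nodes and no greater total
  cost.\<close>

lemma closed_walk_nonneg:
  assumes opt: "optimal_upto m S" and m: "m \<le> r"
  shows "xs \<noteq> [] \<Longrightarrow> set xs \<subseteq> {1..m} \<Longrightarrow> 0 \<le> walk_cost (arc S) (xs @ [hd xs])"
proof (induction "length xs" arbitrary: xs rule: less_induct)
  case (less xs)
  have S: "transversal S" using opt by (simp add: optimal_upto_def)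
  obtain g where g: "realizes_arcs S g" using realizes_arcs_exists by blast
  show ?case
  proof (cases "distinct xs")
    case False
    then obtain as bs cs y where xs: "xs = as @ [y] @ bs @ [y] @ cs"
      using not_distinct_decomp by blast
    have hd: "hd xs = hd (as @ [y] @ cs)" unfolding xs by (cases as) auto
    have "walk_cost (arc S) (xs @ [hd xs]) = walk_cost (arc S) ((as @ [y] @ cs) @ [hd (as @ [y] @ cs)])
        + walk_cost (arc S) ((y # bs) @ [hd (y # bs)])"
      unfolding hd unfolding xs
      using walk_cost_join[of "arc S" as y "bs @ y # cs @ [hd (as @ [y] @ cs)]"]
        walk_cost_join[of "arc S" "y # bs" y "cs @ [hd (as @ [y] @ cs)]"]
        walk_cost_join[of "arc S" as y "cs @ [hd (as @ [y] @ cs)]"] by simp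
    moreover have "0 \<le> walk_cost (arc S) ((as @ [y] @ cs) @ [hd (as @ [y] @ cs)])"
      using less.prems by (intro less.hyps) (auto simp: xs)
    moreover have "0 \<le> walk_cost (arc S) ((y # bs) @ [hd (y # bs)])"
      using less.prems by (intro less.hyps) (auto simp: xs)
    ultimately show ?thesis by linarith
  next
    case True
    have xr: "set xs \<subseteq> {1..r}" using less.prems m by auto
    from apply_walk_or_split[OF S g True less.prems(1) xr] show ?thesis
    proof (elim disjE exE conjE)
      assume *: "F (apply_walk g (xs @ [hd xs]) S) - F S \<le> walk_cost (arc S) (xs @ [hd xs])"
      have "transversal (apply_walk g (xs @ [hd xs]) S)"
        using xr less.prems hd_in_set[of xs] by (intro apply_walk_transversal[OF S g]) (auto simp del: hd_in_set)
      moreover have "apply_walk g (xs @ [hd xs]) S k = S k" if "m < k" for k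
        using that less.prems by (intro apply_walk_notin) auto
      ultimately have "F S \<le> F (apply_walk g (xs @ [hd xs]) S)"
        using opt by (auto simp: optimal_upto_def)
      then show ?thesis using * by linarith
    next
      fix A B C
      assume ne: "A \<noteq> []" "B \<noteq> []" "C \<noteq> []" and eq: "xs @ [hd xs] = A @ B @ C"
        and le: "walk_cost (arc S) (A @ C) + walk_cost (arc S) (B @ [hd B]) \<le> walk_cost (arc S) (xs @ [hd xs])"
      \<comment> \<open>The walk ends where it starts, and its end is the end of \<open>C\<close>;
        hence \<open>A @ C\<close> is closed as well.\<close>
      have C: "C = butlast C @ [hd xs]" using arg_cong[OF eq, of last] ne by simp
      have xs: "xs = A @ B @ butlast C" using arg_cong[OF eq, of butlast] ne
        by (simp add: butlast_append)
      have hd: "hd xs = hd (A @ butlast C)" using ne by (simp add: xs)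
      have "0 \<le> walk_cost (arc S) ((A @ butlast C) @ [hd (A @ butlast C)])"
        using less.prems ne by (intro less.hyps) (auto simp: xs)
      then have "0 \<le> walk_cost (arc S) (A @ C)" using C hd by simp
      moreover have "0 \<le> walk_cost (arc S) (B @ [hd B])"
        using less.prems ne by (intro less.hyps) (auto simp: xs)
      ultimately show ?thesis using le by linarith
    qed
  qed
qed

section \<open>Shortest walks through the newly released part\<close>

text \<open>
  Walks from \<open>Suc m\<close> to \<open>j\<close> with \<open>k\<close> intermediate nodes, all in \<open>{1..m}\<close>.  Closed walks may thus
  pass through the newly released part only once.
\<close>

fun walk_dist :: "(nat \<Rightarrow> nat) \<Rightarrow> nat \<Rightarrow> nat \<Rightarrow> nat \<Rightarrow> real" where
  "walk_dist S m 0 j = arc S (Suc m) j"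
| "walk_dist S m (Suc k) j = Min ((\<lambda>l. walk_dist S m k l + arc S l j) ` {1..m})"

text \<open>More than \<open>m\<close> intermediate nodes never help, see
  \<open>min_dist_le_walk\<close>. The range also keeps clear of the recursive clause of
  \<open>walk_dist\<close> at \<open>m = 0\<close>, where \<open>Min\<close> is applied to the empty
  set.\<close>

definition min_dist :: "(nat \<Rightarrow> nat) \<Rightarrow> nat \<Rightarrow> nat \<Rightarrow> real" where
  "min_dist S m j = Min ((\<lambda>k. walk_dist S m k j) ` {0..m})"

lemma walk_dist_le_walk:
  "set ys \<subseteq> {1..m} \<Longrightarrow> walk_dist S m (length ys) j \<le> walk_cost (arc S) (Suc m # ys @ [j])"
proof (induction ys arbitrary: j rule: rev_induct)
  case (snoc l ys)
  have "walk_dist S m (length (ys @ [l])) j \<le> walk_dist S m (length ys) l + arc S l j"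
    using snoc.prems by (auto intro!: Min_le)
  also have "\<dots> \<le> walk_cost (arc S) (Suc m # ys @ [l]) + arc S l j"
    using snoc by simp
  also have "\<dots> = walk_cost (arc S) (Suc m # (ys @ [l]) @ [j])"
    using walk_cost_append[of "Suc m # ys @ [l]" "[j]" "arc S"] by simp
  finally show ?case .
qed simp

lemma walk_dist_step_attained: "m \<noteq> 0 \<Longrightarrow> \<exists>l\<in>{1..m}. walk_dist S m (Suc k) j = walk_dist S m k l + arc S l j"
proof -
  assume "m \<noteq> 0"
  then have "walk_dist S m (Suc k) j \<in> (\<lambda>l. walk_dist S m k l + arc S l j) ` {1..m}"
    unfolding walk_dist.simps by (intro Min_in) auto
  then show ?thesis by auto
qed

lemma walk_dist_exists:
  "k \<le> m \<Longrightarrow> \<exists>ys. length ys = k \<and> set ys \<subseteq> {1..m} \<and> walk_dist S m k j = walk_cost (arc S) (Suc m # ys @ [j])"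
proof (induction k arbitrary: j)
  case (Suc k)
  then obtain l where l: "l \<in> {1..m}" "walk_dist S m (Suc k) j = walk_dist S m k l + arc S l j"
    using walk_dist_step_attained[of m S k j] by auto
  from Suc obtain ys where "length ys = k" "set ys \<subseteq> {1..m}" "walk_dist S m k l = walk_cost (arc S) (Suc m # ys @ [l])"
    by (meson Suc_leD)
  then show ?case using l walk_cost_append[of "Suc m # ys @ [l]" "[j]" "arc S"]
    by (intro exI[of _ "ys @ [l]"]) auto
qed auto

lemma min_dist_le: "k \<le> m \<Longrightarrow> min_dist S m j \<le> walk_dist S m k j"
  by (auto simp: min_dist_def intro!: Min_le)

lemma min_dist_attained: "\<exists>k\<le>m. min_dist S m j = walk_dist S m k j"
proof -
  have "min_dist S m j \<in> (\<lambda>k. walk_dist S m k j) ` {0..m}"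
    unfolding min_dist_def by (intro Min_in) auto
  then show ?thesis by auto
qed

text \<open>The excised cycle lies in \<open>{1..m}\<close>, where closed walks cost at least 0.
  This is why the endpoints \<open>x\<close> and \<open>j\<close> may be arbitrary.\<close>

lemma remove_cycle:
  assumes opt: "optimal_upto m S" and m: "m \<le> r" and ys: "set ys \<subseteq> {1..m}" "\<not> distinct ys"
  shows "\<exists>ys'. set ys' \<subseteq> {1..m} \<and> length ys' < length ys \<and>
    walk_cost (arc S) (x # ys' @ [j]) \<le> walk_cost (arc S) (x # ys @ [j])"
proof -
  obtain as bs cs y where d: "ys = as @ [y] @ bs @ [y] @ cs"
    using not_distinct_decomp[OF ys(2)] by blast
  have "0 \<le> walk_cost (arc S) ((y # bs) @ [hd (y # bs)])"
    using ys by (intro closed_walk_nonneg[OF opt m]) (auto simp: d)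
  moreover have "walk_cost (arc S) (x # ys @ [j]) = walk_cost (arc S) (x # (as @ [y] @ cs) @ [j])
        + walk_cost (arc S) ((y # bs) @ [hd (y # bs)])"
    unfolding d
    using walk_cost_join[of "arc S" "x # as" y "bs @ y # cs @ [j]"]
      walk_cost_join[of "arc S" "y # bs" y "cs @ [j]"]
      walk_cost_join[of "arc S" "x # as" y "cs @ [j]"] by simp
  ultimately show ?thesis using ys by (intro exI[of _ "as @ [y] @ cs"]) (auto simp: d)
qed

text \<open>A walk with more than \<open>m\<close> intermediate nodes repeats one by the pigeonhole
  principle, and can be shortened.\<close>

lemma min_dist_le_walk:
  assumes opt: "optimal_upto m S" and m: "m \<le> r"
  shows "set ys \<subseteq> {1..m} \<Longrightarrow> min_dist S m j \<le> walk_cost (arc S) (Suc m # ys @ [j])"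
proof (induction "length ys" arbitrary: ys rule: less_induct)
  case (less ys)
  show ?case
  proof (cases "length ys \<le> m")
    case True
    then show ?thesis using min_dist_le[OF True, of S j] walk_dist_le_walk[OF less.prems, of S j] by linarith
  next
    case False
    have "\<not> distinct ys"
    proof
      assume "distinct ys"
      then have "length ys = card (set ys)" by (simp add: distinct_card)
      also have "\<dots> \<le> card {1..m}" using less.prems by (intro card_mono) auto
      finally show False using False by simp
    qed
    from remove_cycle[OF opt m less.prems this, of "Suc m" j]
    obtain ys' where "set ys' \<subseteq> {1..m}" "length ys' < length ys"
      and le: "walk_cost (arc S) (Suc m # ys' @ [j]) \<le> walk_cost (arc S) (Suc m # ys @ [j])" by blast
    then have "min_dist S m j \<le> walk_cost (arc S) (Suc m # ys' @ [j])" by (intro less.hyps)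
    then show ?thesis using le by (rule order_trans)
  qed
qed

section \<open>Optimality of one phase\<close>

text \<open>
  The distances serve as potentials, so that the permutation of \<open>exchange_lower_bound\<close> need not be
  decomposed into cycles.
\<close>

lemma phase_lower_bound:
  assumes opt: "optimal_upto m S" and m: "Suc m \<le> r"
    and Y: "transversal Y" and eq: "\<And>k. k \<in> {1..r} \<Longrightarrow> Suc m < k \<Longrightarrow> Y k = S k"
  shows "min 0 (min_dist S m (Suc m)) \<le> F Y - F S"
proof -
  have S: "transversal S" using opt by (simp add: optimal_upto_def)
  define J where "J = {j \<in> {1..r}. Y j \<noteq> S j}"
  have J: "J \<subseteq> {1..Suc m}" using eq by (force simp: J_def)
  obtain \<pi> where \<pi>: "bij_betw \<pi> J J" and le: "(\<Sum>j\<in>J. arc S j (\<pi> j)) \<le> F Y - F S"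
    using exchange_lower_bound[OF S Y] unfolding J_def by blast
  \<comment> \<open>\<open>Suc m\<close> has two roles: as the start of walks its potential is 0, as
    their end its distance is the cost of a cheapest closed walk through it.\<close>
  define d where "d j = (if j = Suc m then 0 else min_dist S m j)" for j
  have pot: "min_dist S m l \<le> d j + arc S j l" if "j \<in> {1..Suc m}" for j l
  proof (cases "j = Suc m")
    case True
    then show ?thesis using min_dist_le[of 0 m S l] by (simp add: d_def)
  next
    case False
    obtain k where k: "k \<le> m" "min_dist S m j = walk_dist S m k j" using min_dist_attained by blast
    obtain ys where ys: "set ys \<subseteq> {1..m}" "walk_dist S m k j = walk_cost (arc S) (Suc m # ys @ [j])"
      using walk_dist_exists[OF k(1)] by blast
    have "min_dist S m l \<le> walk_cost (arc S) (Suc m # (ys @ [j]) @ [l])"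
      using ys that False m by (intro min_dist_le_walk[OF opt]) auto
    also have "\<dots> = d j + arc S j l"
      using walk_cost_append[of "Suc m # ys @ [j]" "[l]" "arc S"] False k ys by (simp add: d_def)
    finally show ?thesis .
  qed
  \<comment> \<open>Along a permutation the potentials cancel except at \<open>Suc m\<close>. The
    \<open>min 0\<close> covers the case that the choice in part \<open>Suc m\<close> is
    unchanged.\<close>
  have "min 0 (min_dist S m (Suc m)) \<le> (\<Sum>j\<in>J. if j = Suc m then min_dist S m (Suc m) else 0)"
    by (simp add: sum.delta J_def)
  also have "\<dots> = (\<Sum>j\<in>J. min_dist S m j) - (\<Sum>j\<in>J. d j)"
    unfolding sum_subtractf[symmetric] by (intro sum.cong) (auto simp: d_def)
  also have "(\<Sum>j\<in>J. min_dist S m j) = (\<Sum>j\<in>J. min_dist S m (\<pi> j))"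
    by (rule sum.reindex_bij_betw[OF \<pi>, symmetric])
  also have "(\<Sum>j\<in>J. min_dist S m (\<pi> j)) - (\<Sum>j\<in>J. d j) = (\<Sum>j\<in>J. min_dist S m (\<pi> j) - d j)"
    by (simp add: sum_subtractf)
  also have "\<dots> \<le> (\<Sum>j\<in>J. arc S j (\<pi> j))"
  proof (rule sum_mono)
    fix j assume "j \<in> J"
    then show "min_dist S m (\<pi> j) - d j \<le> arc S j (\<pi> j)" using pot[of j "\<pi> j"] J by auto
  qed
  finally show ?thesis using le by linarith
qed

text \<open>If the walk split, \<open>A @ C\<close> would be a closed walk through
  \<open>Suc m\<close> with fewer intermediate nodes, hence strictly dearer by \<open>first\<close>,
  while the closed walk on \<open>B\<close> avoids \<open>Suc m\<close> and costs at least 0.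
  Together they would exceed the bound on their sum.\<close>

lemma phase_upper_bound:
  assumes opt: "optimal_upto m S" and m: "Suc m \<le> r" and g: "realizes_arcs S g"
    and ys: "set ys \<subseteq> {1..m}"
    and cost: "walk_cost (arc S) (Suc m # ys @ [Suc m]) = min_dist S m (Suc m)"
    and first: "\<And>k. k < length ys \<Longrightarrow> min_dist S m (Suc m) < walk_dist S m k (Suc m)"
  shows "F (apply_walk g (Suc m # ys @ [Suc m]) S) - F S \<le> min_dist S m (Suc m)"
proof -
  have S: "transversal S" using opt by (simp add: optimal_upto_def)
  have m': "m \<le> r" using m by simp
  have shorter: "walk_cost (arc S) (Suc m # ys @ [Suc m]) < walk_cost (arc S) (Suc m # ys' @ [Suc m])"
    if "set ys' \<subseteq> {1..m}" "length ys' < length ys" for ys'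
    using first[OF that(2)] walk_dist_le_walk[OF that(1), of S "Suc m"] cost by linarith
  have "distinct ys"
    using remove_cycle[OF opt m' ys, of "Suc m" "Suc m"] shorter by (meson leD)
  then have d: "distinct (Suc m # ys)" using ys by auto
  have r: "set (Suc m # ys) \<subseteq> {1..r}" using ys m by auto
  from apply_walk_or_split[OF S g d list.distinct(2) r] show ?thesis
  proof (elim disjE exE conjE)
    fix A B C
    assume ne: "A \<noteq> []" "B \<noteq> []" "C \<noteq> []" and eq: "(Suc m # ys) @ [hd (Suc m # ys)] = A @ B @ C"
      and le: "walk_cost (arc S) (A @ C) + walk_cost (arc S) (B @ [hd B])
        \<le> walk_cost (arc S) ((Suc m # ys) @ [hd (Suc m # ys)])"
    obtain A' where A: "A = Suc m # A'" using eq ne by (cases A) auto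
    have C: "C = butlast C @ [Suc m]" using arg_cong[OF eq, of last] ne by simp
    have "butlast (ys @ [Suc m]) = butlast (A' @ B @ C)" using eq A by simp
    then have y: "ys = A' @ B @ butlast C" using ne by (simp add: butlast_append)
    have "walk_cost (arc S) (Suc m # ys @ [Suc m]) < walk_cost (arc S) (Suc m # (A' @ butlast C) @ [Suc m])"
      using ys ne by (intro shorter) (auto simp: y)
    also have "Suc m # (A' @ butlast C) @ [Suc m] = A @ C" using C A by simp
    finally have "walk_cost (arc S) (Suc m # ys @ [Suc m]) < walk_cost (arc S) (A @ C)" .
    moreover have "0 \<le> walk_cost (arc S) (B @ [hd B])"
      using ys ne by (intro closed_walk_nonneg[OF opt m']) (auto simp: y)
    ultimately show ?thesis using le by simp
  qed (use cost in auto)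
qed

lemma optimal_upto_0: "transversal S \<Longrightarrow> optimal_upto 0 S"
  by (simp add: optimal_upto_def F_def)

lemma optimal_upto_keep:
  assumes "optimal_upto m S" "Suc m \<le> r" "0 \<le> min_dist S m (Suc m)"
  shows "optimal_upto (Suc m) S"
proof -
  have "F S \<le> F Y" if "transversal Y" "\<forall>k\<in>{1..r}. Suc m < k \<longrightarrow> Y k = S k" for Y
    using phase_lower_bound[OF assms(1,2) that(1)] that(2) assms(3) by simp
  then show ?thesis using assms(1) by (auto simp: optimal_upto_def)
qed

text \<open>For a negative distance, the lower bound for all competitors and the upper bound for the
  augmented transversal coincide; hence one augmentation per phase is enough.\<close>

lemma optimal_upto_augment:
  assumes opt: "optimal_upto m S" and m: "Suc m \<le> r" and g: "realizes_arcs S g"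
    and ys: "set ys \<subseteq> {1..m}"
    and cost: "walk_cost (arc S) (Suc m # ys @ [Suc m]) = min_dist S m (Suc m)"
    and first: "\<And>k. k < length ys \<Longrightarrow> min_dist S m (Suc m) < walk_dist S m k (Suc m)"
    and neg: "min_dist S m (Suc m) < 0"
  shows "optimal_upto (Suc m) (apply_walk g (Suc m # ys @ [Suc m]) S)"
  unfolding optimal_upto_def
proof (intro conjI allI impI)
  let ?S = "apply_walk g (Suc m # ys @ [Suc m]) S"
  have S: "transversal S" using opt by (simp add: optimal_upto_def)
  show "transversal ?S" using ys m by (intro apply_walk_transversal[OF S g]) auto
  fix Y assume Y: "transversal Y \<and> (\<forall>k\<in>{1..r}. Suc m < k \<longrightarrow> Y k = ?S k)"
  have "?S k = S k" if "Suc m < k" for k using that ys by (intro apply_walk_notin) (auto simp: butlast_append)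
  then have "min 0 (min_dist S m (Suc m)) \<le> F Y - F S"
    using Y by (intro phase_lower_bound[OF opt m]) auto
  then show "F ?S \<le> F Y"
    using phase_upper_bound[OF opt m g ys cost first] neg by linarith
qed

end

section \<open>From instances to transversals\<close>

text \<open>The numbering of the values is an arbitrary bijection, so that the arrays filled by the
  program can be substituted at the end.\<close>

locale flat_instance =
  fixes I :: inst and n :: nat and Pt Vl :: "nat \<Rightarrow> nat"
  assumes wf: "wf_inst I" and jw: "joint_winner I" and zf: "z_free I"
    and flat: "bij_betw (\<lambda>p. (Pt p, Vl p)) {1..n} (SIGMA j:{1..nvars I}. {1..dsize I j})"
begin

abbreviation r :: nat where "r \<equiv> nvars I"

section \<open>Costs of numbered values and their cap\<close>

definition un :: "nat \<Rightarrow> real" where "un p = un_table I (Pt p) (Vl p)"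

text \<open>Meaningful only for different parts: within a part, \<open>bcost\<close> reads an
  arbitrary table entry.\<close>

definition c :: "nat \<Rightarrow> nat \<Rightarrow> ereal" where "c p q = bcost I (Pt p) (Pt q) (Vl p) (Vl q)"

definition fin_c :: "nat \<Rightarrow> nat \<Rightarrow> real" where
  "fin_c p q = (if Pt p < Pt q \<and> c p q \<noteq> \<infinity> then real_of_ereal (c p q) else 0)"

text \<open>Larger than every finite objective value, so it can stand in for infinity.\<close>

definition cap :: real where
  "cap = 1 + (\<Sum>p\<in>{1..n}. un p + (\<Sum>q\<in>{1..n}. fin_c p q))"

definition capped :: "nat \<Rightarrow> nat \<Rightarrow> real" where
  "capped p q = real_of_ereal (min (c p q) (ereal cap))"

definition others :: "nat \<Rightarrow> nat set" where
  "others p = {z \<in> {1..n}. Pt z \<noteq> Pt p}"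

text \<open>Two elements of the same part never occur together; their similarity is the largest
  threshold at which they are connected through other parts.\<close>

definition W :: "nat \<Rightarrow> nat \<Rightarrow> real" where
  "W p q = (if p = q then 0 else if Pt p \<noteq> Pt q then capped p q
     else Max ((\<lambda>z. min (capped p z) (capped q z)) ` others p))"

lemma flat_mem:
  assumes "p \<in> {1..n}"
  shows "Pt p \<in> {1..r}" "Vl p \<in> dom_of I (Pt p)"
  using bij_betw_apply[OF flat assms] by (auto simp: dom_of_def)

lemma flat_inj: "p \<in> {1..n} \<Longrightarrow> q \<in> {1..n} \<Longrightarrow> Pt p = Pt q \<Longrightarrow> Vl p = Vl q \<Longrightarrow> p = q"
  by (rule inj_onD[OF bij_betw_imp_inj_on[OF flat]]) simp

lemma flat_surj:
  assumes "j \<in> {1..r}" "a \<in> dom_of I j"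
  shows "\<exists>p\<in>{1..n}. Pt p = j \<and> Vl p = a"
proof -
  have "(j, a) \<in> (\<lambda>p. (Pt p, Vl p)) ` {1..n}"
    using flat assms by (auto simp: bij_betw_def dom_of_def)
  then show ?thesis by auto
qed

lemma two_values:
  assumes "j \<in> {1..r}"
  shows "\<exists>p\<in>{1..n}. Pt p = j \<and> p \<noteq> q"
proof -
  have "2 \<le> dsize I j" using wf assms by (auto simp: wf_inst_def)
  then have "1 \<in> dom_of I j" "2 \<in> dom_of I j" by (auto simp: dom_of_def)
  then obtain p p' where "p \<in> {1..n}" "Pt p = j" "Vl p = 1" "p' \<in> {1..n}" "Pt p' = j" "Vl p' = 2"
    using flat_surj[OF assms] by metis
  then show ?thesis by (cases "p = q") auto
qed

lemma finite_others [simp]: "finite (others p)" by (simp add: others_def)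

text \<open>There are at least two variables, so the \<open>Max\<close> in \<open>W\<close> is taken
  over a nonempty set.\<close>

lemma others_nonempty: "others p \<noteq> {}"
proof -
  have "2 \<le> r" using wf by (simp add: wf_inst_def)
  then have "\<exists>j\<in>{1..r}. j \<noteq> Pt p"
    by (intro bexI[of _ "if Pt p = 1 then 2 else 1"]) auto
  then show ?thesis using two_values by (fastforce simp: others_def)
qed

lemma un_nonneg: "p \<in> {1..n} \<Longrightarrow> 0 \<le> un p"
  using wf flat_mem[of p] by (auto simp: un_def wf_inst_def)

lemma c_sym: "Pt p \<noteq> Pt q \<Longrightarrow> c p q = c q p"
  by (auto simp: c_def bcost_def)

lemma c_nonneg:
  assumes "p \<in> {1..n}" "q \<in> {1..n}" "Pt p \<noteq> Pt q"
  shows "0 \<le> c p q"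
proof (cases "Pt p < Pt q")
  case True
  then show ?thesis using wf flat_mem[of p] flat_mem[of q] assms
    by (auto simp: c_def bcost_def wf_inst_def)
next
  case False
  then have "Pt q < Pt p" using assms by simp
  then show ?thesis using wf flat_mem[of p] flat_mem[of q] assms
    by (auto simp: c_def bcost_def wf_inst_def)
qed

lemma c_joint:
  assumes "p \<in> {1..n}" "q \<in> {1..n}" "z \<in> {1..n}" "Pt p \<noteq> Pt q" "Pt p \<noteq> Pt z" "Pt q \<noteq> Pt z"
  shows "min (c p z) (c q z) \<le> c p q"
proof -
  have "min (bcost I (Pt q) (Pt z) (Vl q) (Vl z)) (bcost I (Pt p) (Pt z) (Vl p) (Vl z))
     \<le> bcost I (Pt p) (Pt q) (Vl p) (Vl q)"
    using jw flat_mem[of p] flat_mem[of q] flat_mem[of z] assms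
    unfolding joint_winner_def by blast
  then show ?thesis by (simp add: c_def min.commute)
qed

text \<open>A minimum attained twice means that no entry of the rectangle lies strictly below the
  other three.\<close>

lemma c_z_free:
  assumes "p \<in> {1..n}" "p' \<in> {1..n}" "q \<in> {1..n}" "q' \<in> {1..n}"
    and "Pt p = Pt p'" "Pt q = Pt q'" "Pt p \<noteq> Pt q" "p \<noteq> p'" "q \<noteq> q'"
  shows "min (c p q') (min (c p' q) (c p' q')) \<le> c p q"
proof (rule ccontr)
  assume less: "\<not> min (c p q') (min (c p' q) (c p' q')) \<le> c p q"
  let ?b = "\<lambda>x. bcost I (Pt p) (Pt q) (fst x) (snd x)"
  let ?A = "{Vl p, Vl p'} \<times> {Vl q, Vl q'}"
  have "Vl p \<noteq> Vl p'" "Vl q \<noteq> Vl q'" using flat_inj assms by blast+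
  moreover have "Vl p \<in> dom_of I (Pt p)" "Vl p' \<in> dom_of I (Pt p)" "Vl q \<in> dom_of I (Pt q)"
    "Vl q' \<in> dom_of I (Pt q)" "Pt p \<in> {1..r}" "Pt q \<in> {1..r}"
    using flat_mem assms by metis+
  ultimately have 2: "2 \<le> card {x \<in> ?A. ?b x = Min (?b ` ?A)}"
    using zf assms(7) unfolding z_free_def by blast
  have lt: "?b (Vl p, Vl q) < ?b x" if "x \<in> ?A" "x \<noteq> (Vl p, Vl q)" for x
    using that less assms by (auto simp: c_def not_le)
  have "?b x = ?b (Vl p, Vl q) \<Longrightarrow> x \<in> ?A \<Longrightarrow> x = (Vl p, Vl q)" for x
    using lt[of x] by (metis less_irrefl)
  moreover have "Min (?b ` ?A) = ?b (Vl p, Vl q)"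
  proof (rule Min_eqI)
    fix y assume "y \<in> ?b ` ?A"
    then obtain x where "x \<in> ?A" "y = ?b x" by blast
    then show "?b (Vl p, Vl q) \<le> y" using lt[of x] by (cases "x = (Vl p, Vl q)") auto
  qed auto
  ultimately have "{x \<in> ?A. ?b x = Min (?b ` ?A)} \<subseteq> {(Vl p, Vl q)}" by auto
  then have "card {x \<in> ?A. ?b x = Min (?b ` ?A)} \<le> 1"
    using card_mono[of "{(Vl p, Vl q)}"] by fastforce
  then show False using 2 by linarith
qed

lemma fin_c_nonneg: "p \<in> {1..n} \<Longrightarrow> q \<in> {1..n} \<Longrightarrow> 0 \<le> fin_c p q"
  using c_nonneg[of p q] by (auto simp: fin_c_def intro!: real_of_ereal_pos)

lemma cap_ge_one: "1 \<le> cap"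
  by (auto simp: cap_def intro!: sum_nonneg add_nonneg_nonneg un_nonneg fin_c_nonneg)

text \<open>The summand 1 in \<open>cap\<close> makes the inequality strict.\<close>

lemma fin_c_less_cap:
  assumes "p \<in> {1..n}" "q \<in> {1..n}"
  shows "fin_c p q < cap"
proof -
  have "fin_c p q \<le> (\<Sum>q\<in>{1..n}. fin_c p q)"
    using assms by (intro member_le_sum) (auto intro: fin_c_nonneg)
  also have "\<dots> \<le> un p + (\<Sum>q\<in>{1..n}. fin_c p q)" using un_nonneg assms by simp
  also have "\<dots> \<le> (\<Sum>p\<in>{1..n}. un p + (\<Sum>q\<in>{1..n}. fin_c p q))"
    using assms by (intro member_le_sum[of p "{1..n}" "\<lambda>p. un p + (\<Sum>q\<in>{1..n}. fin_c p q)"])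
      (auto intro!: add_nonneg_nonneg sum_nonneg fin_c_nonneg un_nonneg)
  finally show ?thesis by (simp add: cap_def)
qed

lemma ereal_capped:
  assumes "p \<in> {1..n}" "q \<in> {1..n}" "Pt p \<noteq> Pt q"
  shows "ereal (capped p q) = min (c p q) (ereal cap)"
  using c_nonneg[OF assms] cap_ge_one unfolding capped_def
  by (cases "c p q") (auto simp: min_def)

lemma capped_nonneg: "p \<in> {1..n} \<Longrightarrow> q \<in> {1..n} \<Longrightarrow> Pt p \<noteq> Pt q \<Longrightarrow> 0 \<le> capped p q"
  using ereal_capped[of p q] c_nonneg[of p q] cap_ge_one
  by (metis ereal_less_eq(5) min_def order_trans zero_le_one)

lemma capped_sym: "Pt p \<noteq> Pt q \<Longrightarrow> capped p q = capped q p"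
  by (simp add: capped_def c_sym)

text \<open>The joint winner property and Z-freeness bound a minimum of entries by another entry.
  Such inequalities survive monotone maps, in particular capping.\<close>

lemma capped_mono:
  assumes "p \<in> {1..n}" "q \<in> {1..n}" "Pt p \<noteq> Pt q" "p' \<in> {1..n}" "q' \<in> {1..n}" "Pt p' \<noteq> Pt q'"
    and "c p q \<le> c p' q'"
  shows "capped p q \<le> capped p' q'"
proof -
  have "ereal (capped p q) \<le> ereal (capped p' q')"
    unfolding ereal_capped[OF assms(1-3)] ereal_capped[OF assms(4-6)] using assms(7)
    by (intro min.mono) auto
  then show ?thesis by simp
qed

lemma capped_joint:
  assumes "p \<in> {1..n}" "q \<in> {1..n}" "z \<in> {1..n}" "Pt p \<noteq> Pt q" "Pt p \<noteq> Pt z" "Pt q \<noteq> Pt z"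
  shows "min (capped p z) (capped q z) \<le> capped p q"
  using c_joint[OF assms] assms unfolding min_le_iff_disj by (blast intro: capped_mono)

lemma capped_z_free:
  assumes "p \<in> {1..n}" "p' \<in> {1..n}" "q \<in> {1..n}" "q' \<in> {1..n}"
    and "Pt p = Pt p'" "Pt q = Pt q'" "Pt p \<noteq> Pt q" "p \<noteq> p'" "q \<noteq> q'"
  shows "min (capped p q') (min (capped p' q) (capped p' q')) \<le> capped p q"
proof -
  have "Pt p \<noteq> Pt q'" "Pt p' \<noteq> Pt q" "Pt p' \<noteq> Pt q'" using assms by simp_all
  then show ?thesis
    using c_z_free[OF assms] assms(1-4,7) unfolding min_le_iff_disj by (blast intro: capped_mono)
qed

section \<open>The extension \<open>W\<close> is ultrametric\<close>

lemma W_same_ge: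
  "z \<in> others p \<Longrightarrow> p \<noteq> q \<Longrightarrow> Pt p = Pt q \<Longrightarrow> min (capped p z) (capped q z) \<le> W p q"
  by (auto simp: W_def)

lemma W_same_attained:
  assumes "p \<noteq> q" "Pt p = Pt q"
  shows "\<exists>z\<in>others p. W p q = min (capped p z) (capped q z)"
proof -
  have "W p q \<in> (\<lambda>z. min (capped p z) (capped q z)) ` others p"
    using assms others_nonempty Max_in[of "(\<lambda>z. min (capped p z) (capped q z)) ` others p"] by (simp add: W_def)
  then show ?thesis by auto
qed

lemma W_cross: "Pt p \<noteq> Pt q \<Longrightarrow> W p q = capped p q"
  by (auto simp: W_def)

lemma W_sym: "W p q = W q p"
  using capped_sym[of p q] by (auto simp: W_def min.commute others_def)

text \<open>Take a \<open>y\<close> through which \<open>p\<close> and \<open>z\<close> are most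
  similar. If it lies in the part of \<open>q\<close>, Z-freeness applies to the rectangle spanned
  by \<open>p\<close>, \<open>z\<close> and \<open>q\<close>, \<open>y\<close>. If it lies in a
  third part, the joint winner property carries the similarity from \<open>z\<close> to
  \<open>y\<close>, and from there to \<open>p\<close>.\<close>

lemma W_ultra_mixed:
  assumes "p \<in> {1..n}" "q \<in> {1..n}" "z \<in> {1..n}" "Pt p = Pt z" "Pt p \<noteq> Pt q" "p \<noteq> z"
  shows "min (W p z) (capped z q) \<le> capped p q"
proof -
  obtain y where y: "y \<in> others p" and eq: "W p z = min (capped p y) (capped z y)"
    using W_same_attained[OF assms(6,4)] by blast
  have y': "y \<in> {1..n}" "Pt y \<noteq> Pt p" using y by (auto simp: others_def)
  consider "y = q" | "y \<noteq> q" "Pt y = Pt q" | "Pt y \<noteq> Pt q" by blast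
  then show ?thesis
  proof cases
    case 1
    then show ?thesis unfolding eq by auto
  next
    case 2
    then have "min (capped p y) (min (capped z q) (capped z y)) \<le> capped p q"
      using assms y' by (intro capped_z_free) auto
    then show ?thesis unfolding eq by (auto simp: min_le_iff_disj)
  next
    case 3
    have "min (capped y z) (capped q z) \<le> capped y q"
      using assms y' 3 by (intro capped_joint) auto
    moreover have "min (capped p y) (capped q y) \<le> capped p q"
      using assms y' 3 by (intro capped_joint) auto
    moreover have "capped y z = capped z y" "capped q z = capped z q" "capped q y = capped y q"
      using capped_sym assms y' 3 by metis+
    ultimately show ?thesis unfolding eq by (auto simp: min_le_iff_disj)
  qed
qed

lemma W_ultra:
  assumes n: "p \<in> {1..n}" "q \<in> {1..n}" "z \<in> {1..n}" and ne: "p \<noteq> q" "p \<noteq> z" "q \<noteq> z"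
  shows "min (W p z) (W q z) \<le> W p q"
proof -
  consider "Pt p \<noteq> Pt q" "Pt p \<noteq> Pt z" "Pt q \<noteq> Pt z" | "Pt p = Pt q" "Pt p \<noteq> Pt z"
    | "Pt p = Pt z" "Pt p \<noteq> Pt q" | "Pt q = Pt z" "Pt p \<noteq> Pt q" | "Pt p = Pt q" "Pt p = Pt z" by metis
  then show ?thesis
  proof cases
    case 1
    then show ?thesis using capped_joint[OF n] by (simp add: W_cross)
  next
    case 2
    then show ?thesis using W_same_ge[of z p q] n ne by (auto simp: W_cross others_def)
  next
    case 3
    then show ?thesis using W_ultra_mixed[of p q z] n ne
      by (simp add: W_cross capped_sym[of q z])
  next
    case 4
    then show ?thesis using W_ultra_mixed[of q p z] n ne
      by (simp add: W_cross capped_sym[of z p] capped_sym[of q p] min.commute)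
  next
    case 5
    obtain x where x: "x \<in> others p" "W p z = min (capped p x) (capped z x)"
      using W_same_attained[of p z] ne 5 by blast
    \<comment> \<open>The witness \<open>y\<close> for \<open>q\<close> and \<open>z\<close> serves
      for \<open>p\<close> as well: by the mixed case \<open>p\<close> is similar to
      \<open>y\<close> through \<open>z\<close>. So \<open>y\<close> links \<open>p\<close> with
      \<open>q\<close>.\<close>
    obtain y where y: "y \<in> others q" "W q z = min (capped q y) (capped z y)"
      using W_same_attained[of q z] ne 5 by metis
    have "min (W p z) (capped z y) \<le> capped p y"
      using W_ultra_mixed[of p y z] n ne 5 y by (auto simp: others_def)
    moreover have "min (capped p y) (capped q y) \<le> W p q"
      using W_same_ge[of y p q] ne 5 y by (auto simp: others_def)
    ultimately show ?thesis unfolding y(2) by (auto simp: min_le_iff_disj)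
  qed
qed

text \<open>This makes each value of \<open>W\<close> within a part computable in constant time.\<close>

lemma W_same_eq:
  assumes n: "p \<in> {1..n}" "q \<in> {1..n}" and ne: "p \<noteq> q" "Pt p = Pt q"
    and z: "z \<in> others p" and max: "\<And>y. y \<in> others p \<Longrightarrow> capped p y \<le> capped p z"
  shows "W p q = min (capped p z) (capped q z)"
proof (rule antisym)
  obtain y where y: "y \<in> others p" "W p q = min (capped p y) (capped q y)"
    using W_same_attained[OF ne] by blast
  \<comment> \<open>As \<open>W p q\<close> is at most \<open>capped p z\<close>, the minimum on the
    left is \<open>W p q\<close> itself.\<close>
  have "min (W q p) (capped p z) \<le> capped q z"
    using W_ultra_mixed[of q z p] n ne z by (auto simp: others_def)
  moreover have "W p q \<le> capped p z" using max[OF y(1)] y(2) by auto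
  ultimately show "W p q \<le> min (capped p z) (capped q z)"
    by (auto simp: W_sym[of q p] min_def split: if_splits)
qed (rule W_same_ge[OF z ne])

sublocale transversal_problem n r Pt un W
  by unfold_locales (use W_sym W_ultra two_values in \<open>auto simp: W_def\<close>)

section \<open>Transversals versus assignments, \<open>F\<close> versus the objective\<close>

definition assign :: "(nat \<Rightarrow> nat) \<Rightarrow> nat \<Rightarrow> nat" where
  "assign S = restrict (\<lambda>i. Vl (S i)) {1..r}"

definition pairs :: "(nat \<times> nat) set" where
  "pairs = {(i, j). 1 \<le> i \<and> i < j \<and> j \<le> r}"

lemma finite_pairs [simp]: "finite pairs"
  by (rule finite_subset[of _ "{1..r} \<times> {1..r}"]) (auto simp: pairs_def)

lemma assign_mem: "transversal S \<Longrightarrow> assign S \<in> assignments I"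
  using flat_mem by (fastforce simp: assign_def assignments_def transversal_def)

lemma assign_surj:
  assumes "x \<in> assignments I"
  shows "\<exists>S. transversal S \<and> assign S = x"
proof -
  have "\<exists>p\<in>{1..n}. Pt p = i \<and> Vl p = x i" if "i \<in> {1..r}" for i
    using assms that by (intro flat_surj) (auto simp: assignments_def PiE_def Pi_def)
  then obtain S where S: "\<And>i. i \<in> {1..r} \<Longrightarrow> S i \<in> {1..n} \<and> Pt (S i) = i \<and> Vl (S i) = x i"
    by metis
  then have "assign S = x" using assms
    by (auto simp: assign_def assignments_def fun_eq_iff PiE_def extensional_def)
  moreover have "transversal S" using S by (simp add: transversal_def)
  ultimately show ?thesis by blast
qed

lemma objective_assign:
  assumes "transversal S"
  shows "objective I (assign S) =
    ereal (\<Sum>i\<in>{1..r}. un (S i)) + (\<Sum>(i, j)\<in>pairs. c (S i) (S j))"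
proof -
  have "(\<Sum>i\<in>{1..r}. ereal (un_table I i (assign S i))) = (\<Sum>i\<in>{1..r}. ereal (un (S i)))"
    using assms by (intro sum.cong) (auto simp: assign_def un_def transversal_def)
  moreover have "(\<Sum>(i, j)\<in>pairs. bcost I i j (assign S i) (assign S j)) = (\<Sum>(i, j)\<in>pairs. c (S i) (S j))"
    using assms by (intro sum.cong) (auto simp: assign_def c_def transversal_def pairs_def)
  ultimately show ?thesis by (simp add: objective_def pairs_def)
qed

lemma F_pairs:
  assumes "transversal S"
  shows "F S = (\<Sum>i\<in>{1..r}. un (S i)) + (\<Sum>(i, j)\<in>pairs. capped (S i) (S j))"
proof -
  let ?g = "\<lambda>(i, j). W (S i) (S j)"
  have U: "{1..r} \<times> {1..r} = (pairs \<union> prod.swap ` pairs) \<union> (\<lambda>i. (i, i)) ` {1..r}"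
    by (auto simp: image_iff pairs_def)
  have "(\<Sum>i\<in>{1..r}. \<Sum>j\<in>{1..r}. W (S i) (S j)) = sum ?g ({1..r} \<times> {1..r})"
    by (rule sum.cartesian_product)
  also have "\<dots> = sum ?g (pairs \<union> prod.swap ` pairs) + sum ?g ((\<lambda>i. (i, i)) ` {1..r})"
    unfolding U by (rule sum.union_disjoint) (simp_all, auto simp: pairs_def)
  also have "sum ?g ((\<lambda>i. (i, i)) ` {1..r}) = 0"
    by (intro sum.neutral) (auto simp: W_def)
  also have "sum ?g (pairs \<union> prod.swap ` pairs) = sum ?g pairs + sum ?g (prod.swap ` pairs)"
    by (rule sum.union_disjoint) (simp_all, auto simp: pairs_def)
  also have "sum ?g (prod.swap ` pairs) = sum ?g pairs"
    by (subst sum.reindex) (auto simp: W_sym intro!: sum.cong)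
  also have "sum ?g pairs = (\<Sum>(i, j)\<in>pairs. capped (S i) (S j))"
  proof (intro sum.cong refl)
    fix x assume "x \<in> pairs"
    then show "?g x = (case x of (i, j) \<Rightarrow> capped (S i) (S j))"
      using assms by (auto simp: transversal_def pairs_def intro!: W_cross)
  qed
  finally show ?thesis by (simp add: F_def)
qed

lemma objective_eq_F:
  assumes S: "transversal S" and fin: "\<And>i j. (i, j) \<in> pairs \<Longrightarrow> c (S i) (S j) = ereal (capped (S i) (S j))"
  shows "objective I (assign S) = ereal (F S)"
proof -
  have "(\<Sum>(i, j)\<in>pairs. c (S i) (S j)) = (\<Sum>(i, j)\<in>pairs. ereal (capped (S i) (S j)))"
    using fin by (intro sum.cong) auto
  also have "\<dots> = ereal (\<Sum>(i, j)\<in>pairs. capped (S i) (S j))"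
    by (simp add: case_prod_unfold)
  finally show ?thesis by (simp add: objective_assign[OF S] F_pairs[OF S])
qed

lemma pair_transversal:
  assumes "transversal S" "(i, j) \<in> pairs"
  shows "S i \<in> {1..n}" "S j \<in> {1..n}" "Pt (S i) = i" "Pt (S j) = j" "i < j" 
  using assms by (auto simp: transversal_def pairs_def)

text \<open>All terms of \<open>F\<close> are nonnegative, so a total below \<open>cap\<close> shows
  that no pair was cut off at the cap.\<close>

lemma objective_small:
  assumes S: "transversal S" and less: "F S < cap"
  shows "objective I (assign S) = ereal (F S)"
proof (rule objective_eq_F[OF S])
  fix i j assume ij: "(i, j) \<in> pairs"
  note p = pair_transversal[OF S ij]
  have "(case (i, j) of (i, j) \<Rightarrow> capped (S i) (S j)) \<le> (\<Sum>(i, j)\<in>pairs. capped (S i) (S j))"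
  proof (rule member_le_sum)
    fix x assume x: "x \<in> pairs - {(i, j)}"
    obtain a b where ab: "x = (a, b)" by (cases x)
    then have "(a, b) \<in> pairs" using x by simp
    from pair_transversal[OF S this] show "0 \<le> (case x of (i, j) \<Rightarrow> capped (S i) (S j))"
      unfolding ab by (auto intro!: capped_nonneg)
  qed (use ij in auto)
  moreover have "0 \<le> (\<Sum>i\<in>{1..r}. un (S i))"
    using S by (intro sum_nonneg un_nonneg) (auto simp: transversal_def)
  ultimately have "capped (S i) (S j) < cap" using less F_pairs[OF S] by simp
  then show "c (S i) (S j) = ereal (capped (S i) (S j))"
    using ereal_capped[of "S i" "S j"] p by (auto simp: min_def split: if_splits)
qed

text \<open>\<open>cap\<close> exceeds the sum of all unary and all finite binary costs. A finite
  objective value adds up some of these terms, each at most once because a transversal is injective,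
  and none of them is cut off.\<close>

lemma objective_finite:
  assumes S: "transversal S" and less: "objective I (assign S) < \<infinity>"
  shows "objective I (assign S) = ereal (F S)" "F S < cap"
proof -
  have fin: "c (S i) (S j) \<noteq> \<infinity>" if "(i, j) \<in> pairs" for i j
  proof
    assume "c (S i) (S j) = \<infinity>"
    then have "\<exists>x\<in>pairs. (case x of (i, j) \<Rightarrow> c (S i) (S j)) = \<infinity>"
      by (intro bexI[of _ "(i, j)"] that) simp
    then have "(\<Sum>(i, j)\<in>pairs. c (S i) (S j)) = \<infinity>"
      by (simp add: sum_Pinfty)
    then show False using less by (simp add: objective_assign[OF S])
  qed
  have eq: "c (S i) (S j) = ereal (capped (S i) (S j)) \<and> fin_c (S i) (S j) = capped (S i) (S j)" if ij: "(i, j) \<in> pairs" for i j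
  proof -
    note p = pair_transversal[OF S ij]
    have lt: "Pt (S i) < Pt (S j)" using p(3-5) by simp
    obtain x where x: "c (S i) (S j) = ereal x"
      using fin[OF ij] c_nonneg[OF p(1,2)] lt by (cases "c (S i) (S j)") auto
    then have f: "fin_c (S i) (S j) = x" using lt by (simp add: fin_c_def)
    have "ereal (capped (S i) (S j)) = min (ereal x) (ereal cap)"
      using ereal_capped[OF p(1,2)] lt x by simp
    then have "capped (S i) (S j) = x" using fin_c_less_cap[OF p(1,2)] f by (simp add: min_def)
    with x f show ?thesis by simp
  qed
  then show "objective I (assign S) = ereal (F S)" by (intro objective_eq_F[OF S]) (rule conjunct1)
  have inj: "inj_on S {1..r}" by (rule transversal_inj[OF S])
  have "(\<Sum>i\<in>{1..r}. un (S i)) = sum un (S ` {1..r})"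
    by (rule sum.reindex[OF inj, unfolded comp_def, symmetric])
  also have "\<dots> \<le> (\<Sum>p\<in>{1..n}. un p)"
    using S by (intro sum_mono2) (auto simp: transversal_def intro!: un_nonneg)
  finally have 1: "(\<Sum>i\<in>{1..r}. un (S i)) \<le> (\<Sum>p\<in>{1..n}. un p)" .
  have inj2: "inj_on (\<lambda>(i, j). (S i, S j)) pairs"
  proof (rule inj_onI, clarify)
    fix a b a' b' assume *: "(a, b) \<in> pairs" "(a', b') \<in> pairs" "S a = S a'" "S b = S b'"
    show "a = a' \<and> b = b'"
      using arg_cong[OF *(3), of Pt] arg_cong[OF *(4), of Pt]
      unfolding pair_transversal(3,4)[OF S *(1)] pair_transversal(3,4)[OF S *(2)] by (rule conjI)
  qed
  have "(\<Sum>(i, j)\<in>pairs. capped (S i) (S j)) = (\<Sum>(i, j)\<in>pairs. fin_c (S i) (S j))"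
    by (rule sum.cong) (auto simp: eq)
  also have "\<dots> = (\<Sum>(p, q)\<in>(\<lambda>(i, j). (S i, S j)) ` pairs. fin_c p q)"
    by (subst sum.reindex[OF inj2]) (simp add: case_prod_unfold comp_def)
  also have "\<dots> \<le> (\<Sum>(p, q)\<in>{1..n} \<times> {1..n}. fin_c p q)"
  proof (rule sum_mono2)
    show "(\<lambda>(i, j). (S i, S j)) ` pairs \<subseteq> {1..n} \<times> {1..n}"
    proof
      fix x assume "x \<in> (\<lambda>(i, j). (S i, S j)) ` pairs"
      then obtain i j where "(i, j) \<in> pairs" "x = (S i, S j)" by auto
      then show "x \<in> {1..n} \<times> {1..n}" using pair_transversal(1,2)[OF S, of i j] by simp
    qed
  qed (auto intro!: fin_c_nonneg)
  also have "\<dots> = (\<Sum>p\<in>{1..n}. \<Sum>q\<in>{1..n}. fin_c p q)"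
    by (rule sum.cartesian_product[symmetric])
  finally show "F S < cap" using 1 by (simp add: F_pairs[OF S] cap_def sum.distrib)
qed

text \<open>A strictly better assignment would have a finite value, hence \<open>F\<close> below
  \<open>cap\<close>. Then \<open>F\<close> is below \<open>cap\<close> at the optimal
  \<open>S\<close> too, and agrees with the objective at both. If all values are infinite, nothing
  is strictly better.\<close>

lemma optimal_is_arg_min:
  assumes "optimal_upto r S"
  shows "is_arg_min (objective I) (\<lambda>x. x \<in> assignments I) (assign S)"
  unfolding is_arg_min_def
proof (intro conjI notI)
  have min: "F S \<le> F Y" if "transversal Y" for Y
    using assms that by (auto simp: optimal_upto_def)
  have S: "transversal S" using assms by (simp add: optimal_upto_def)
  show "assign S \<in> assignments I" by (rule assign_mem[OF S])
  assume "\<exists>y. y \<in> assignments I \<and> objective I y < objective I (assign S)"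
  then obtain Y where Y: "transversal Y" and less: "objective I (assign Y) < objective I (assign S)"
    using assign_surj by metis
  then have "objective I (assign Y) < \<infinity>" by (cases "objective I (assign Y)") auto
  from objective_finite[OF Y this] have Y': "objective I (assign Y) = ereal (F Y)" "F Y < cap" by auto
  then have "objective I (assign S) = ereal (F S)"
    using min[OF Y] by (intro objective_small[OF S]) simp
  then show False using less Y' min[OF Y] by simp
qed

end

section \<open>Reasoning about programs\<close>

text \<open>Total correctness with a time budget. A budget, unlike an exact time, can be shared by
  both branches of a conditional and by all rounds of a loop.\<close>

definition runs :: "inst \<Rightarrow> com \<Rightarrow> state \<Rightarrow> nat \<Rightarrow> (state \<Rightarrow> bool) \<Rightarrow> bool" where
  "runs I c s T Q \<longleftrightarrow> (\<exists>t s'. exec I c s t s' \<and> t \<le> T \<and> Q s')"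

text \<open>Loops satisfy no postcondition here; they are left to \<open>runs_For\<close>.\<close>

fun wp :: "inst \<Rightarrow> com \<Rightarrow> state \<Rightarrow> (state \<Rightarrow> bool) \<Rightarrow> bool" where
  "wp I Skip s Q = Q s"
| "wp I (IAssign x e) s Q =
    (case ieval I s e of None \<Rightarrow> False | Some k \<Rightarrow> Q (s\<lparr>ivar := (ivar s)(x := k)\<rparr>))"
| "wp I (IStore x e1 e2) s Q =
    (case ieval I s e1 of None \<Rightarrow> False | Some i \<Rightarrow> (case ieval I s e2 of None \<Rightarrow> False
      | Some k \<Rightarrow> Q (s\<lparr>iarr := (iarr s)(x := (iarr s x)(i := k))\<rparr>)))"
| "wp I (VAssign x e) s Q =
    (case veval I s e of None \<Rightarrow> False | Some v \<Rightarrow> Q (s\<lparr>vvar := (vvar s)(x := v)\<rparr>))"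
| "wp I (VStore x e1 e2) s Q =
    (case ieval I s e1 of None \<Rightarrow> False | Some i \<Rightarrow> (case veval I s e2 of None \<Rightarrow> False
      | Some v \<Rightarrow> Q (s\<lparr>varr := (varr s)(x := (varr s x)(i := v))\<rparr>)))"
| "wp I (Seq p1 p2) s Q = wp I p1 s (\<lambda>s'. wp I p2 s' Q)"
| "wp I (If b p1 p2) s Q =
    (case beval I s b of None \<Rightarrow> False | Some v \<Rightarrow> if v then wp I p1 s Q else wp I p2 s Q)"
| "wp I (While b p) s Q = False"

text \<open>Adding both branches of a conditional overestimates, but makes the bound independent of
  the state. The value for loops is harmless, because \<open>wp\<close> fails on them.\<close>

fun loop_free_cost :: "com \<Rightarrow> nat" where
  "loop_free_cost Skip = 1"
| "loop_free_cost (IAssign x e) = 1 + icost e"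
| "loop_free_cost (IStore x e1 e2) = 1 + icost e1 + icost e2"
| "loop_free_cost (VAssign x e) = 1 + vcost e"
| "loop_free_cost (VStore x e1 e2) = 1 + icost e1 + vcost e2"
| "loop_free_cost (Seq p1 p2) = loop_free_cost p1 + loop_free_cost p2"
| "loop_free_cost (If b p1 p2) = 1 + bexp_cost b + loop_free_cost p1 + loop_free_cost p2"
| "loop_free_cost (While b p) = 0"

lemma runs_mono: "runs I c s T Q \<Longrightarrow> T \<le> T' \<Longrightarrow> (\<And>s'. Q s' \<Longrightarrow> Q' s') \<Longrightarrow> runs I c s T' Q'"
  unfolding runs_def by (meson order_trans)

lemma runs_Seq':
  assumes "runs I p1 s T1 (\<lambda>s'. runs I p2 s' T2 Q)" "T1 + T2 \<le> T"
  shows "runs I (Seq p1 p2) s T Q"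
proof -
  obtain t1 s1 t2 s2 where "exec I p1 s t1 s1" "t1 \<le> T1" "exec I p2 s1 t2 s2" "t2 \<le> T2" "Q s2"
    using assms(1) unfolding runs_def by blast
  then show ?thesis using assms(2) unfolding runs_def
    by (intro exI[of _ "t1 + t2"] exI[of _ s2]) (auto intro: exec.Seq)
qed

lemma runs_wp: "wp I c s Q \<Longrightarrow> loop_free_cost c \<le> T \<Longrightarrow> runs I c s T Q"
proof (induction c arbitrary: s T Q)
  case Skip
  then show ?case using exec.Skip[of I s] by (auto simp: runs_def)
next
  case (IAssign x e)
  then show ?case by (auto simp: runs_def split: option.splits intro!: exI exec.IAssign)
next
  case (IStore x e1 e2)
  then show ?case by (auto simp: runs_def split: option.splits intro!: exI exec.IStore)
next
  case (VAssign x e)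
  then show ?case by (auto simp: runs_def split: option.splits intro!: exI exec.VAssign)
next
  case (VStore x e1 e2)
  then show ?case by (auto simp: runs_def split: option.splits intro!: exI exec.VStore)
next
  case (Seq p1 p2)
  show ?case
  proof (rule runs_Seq')
    show "runs I p1 s (loop_free_cost p1) (\<lambda>s'. runs I p2 s' (loop_free_cost p2) Q)"
      using Seq.prems(1)
      by (auto intro!: runs_mono[OF Seq.IH(1)[OF _ order.refl]] Seq.IH(2))
  qed (use Seq.prems in auto)
next
  case (If b p1 p2)
  obtain v where v: "beval I s b = Some v" using If.prems by (auto split: option.splits)
  show ?case
  proof (cases v)
    case True
    have "runs I p1 s (loop_free_cost p1) Q" using If v True by auto
    then obtain t s' where "exec I p1 s t s'" "t \<le> loop_free_cost p1" "Q s'" by (auto simp: runs_def)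
    then show ?thesis using v True If.prems(2) unfolding runs_def
      by (intro exI[of _ "1 + bexp_cost b + t"] exI[of _ s']) (auto intro: exec.IfTrue[simplified])
  next
    case False
    have "runs I p2 s (loop_free_cost p2) Q" using If v False by auto
    then obtain t s' where "exec I p2 s t s'" "t \<le> loop_free_cost p2" "Q s'" by (auto simp: runs_def)
    then show ?thesis using v False If.prems(2) unfolding runs_def
      by (intro exI[of _ "1 + bexp_cost b + t"] exI[of _ s']) (auto intro: exec.IfFalse[simplified])
  qed
next
  case (While b p)
  then show ?case by simp
qed

lemma runs_If:
  assumes "beval I s b = Some v" and "v \<Longrightarrow> runs I p1 s T1 Q" and "\<not> v \<Longrightarrow> runs I p2 s T1 Q"
    and "1 + bexp_cost b + T1 \<le> T"
  shows "runs I (If b p1 p2) s T Q"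
proof (cases v)
  case True
  then obtain t s' where "exec I p1 s t s'" "t \<le> T1" "Q s'" using assms(2) by (auto simp: runs_def)
  then show ?thesis using True assms(1,4) unfolding runs_def
    by (intro exI[of _ "1 + bexp_cost b + t"] exI[of _ s']) (auto intro: exec.IfTrue[simplified])
next
  case False
  then obtain t s' where "exec I p2 s t s'" "t \<le> T1" "Q s'" using assms(3) by (auto simp: runs_def)
  then show ?thesis using False assms(1,4) unfolding runs_def
    by (intro exI[of _ "1 + bexp_cost b + t"] exI[of _ s']) (auto intro: exec.IfFalse[simplified])
qed

section \<open>Frames and counting loops\<close>

fun ivar_writes :: "com \<Rightarrow> vname set" where
  "ivar_writes (IAssign x e) = {x}"
| "ivar_writes (Seq p1 p2) = ivar_writes p1 \<union> ivar_writes p2"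
| "ivar_writes (If b p1 p2) = ivar_writes p1 \<union> ivar_writes p2"
| "ivar_writes (While b p) = ivar_writes p"
| "ivar_writes _ = {}"

fun iarr_writes :: "com \<Rightarrow> vname set" where
  "iarr_writes (IStore x e1 e2) = {x}"
| "iarr_writes (Seq p1 p2) = iarr_writes p1 \<union> iarr_writes p2"
| "iarr_writes (If b p1 p2) = iarr_writes p1 \<union> iarr_writes p2"
| "iarr_writes (While b p) = iarr_writes p"
| "iarr_writes _ = {}"

fun vvar_writes :: "com \<Rightarrow> vname set" where
  "vvar_writes (VAssign x e) = {x}"
| "vvar_writes (Seq p1 p2) = vvar_writes p1 \<union> vvar_writes p2"
| "vvar_writes (If b p1 p2) = vvar_writes p1 \<union> vvar_writes p2"
| "vvar_writes (While b p) = vvar_writes p"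
| "vvar_writes _ = {}"

fun varr_writes :: "com \<Rightarrow> vname set" where
  "varr_writes (VStore x e1 e2) = {x}"
| "varr_writes (Seq p1 p2) = varr_writes p1 \<union> varr_writes p2"
| "varr_writes (If b p1 p2) = varr_writes p1 \<union> varr_writes p2"
| "varr_writes (While b p) = varr_writes p"
| "varr_writes _ = {}"

text \<open>Write sets are read off the syntax, so a loop invariant has to mention only what the
  loop changes; all other facts are recovered from the frame.\<close>

definition frame :: "com \<Rightarrow> state \<Rightarrow> state \<Rightarrow> bool" where
  "frame c s s' \<longleftrightarrow>
    (\<forall>x. x \<notin> ivar_writes c \<longrightarrow> ivar s' x = ivar s x) \<and>
    (\<forall>x. x \<notin> iarr_writes c \<longrightarrow> iarr s' x = iarr s x) \<and>
    (\<forall>x. x \<notin> vvar_writes c \<longrightarrow> vvar s' x = vvar s x) \<and>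
    (\<forall>x. x \<notin> varr_writes c \<longrightarrow> varr s' x = varr s x)"

lemma exec_frame: "exec I c s t s' \<Longrightarrow> frame c s s'"
  by (induction rule: exec.induct) (auto simp: frame_def)

lemma runs_frame: "runs I c s T Q \<Longrightarrow> runs I c s T (\<lambda>s'. Q s' \<and> frame c s s')"
  unfolding runs_def using exec_frame by blast

lemma runs_Seq:
  assumes "runs I p1 s T1 R" and "\<And>s'. R s' \<Longrightarrow> frame p1 s s' \<Longrightarrow> runs I p2 s' T2 Q" and "T1 + T2 \<le> T"
  shows "runs I (Seq p1 p2) s T Q"
  by (rule runs_Seq'[OF runs_mono[OF runs_frame[OF assms(1)] order.refl] assms(3)])
     (use assms(2) in blast)

definition For :: "vname \<Rightarrow> iexp \<Rightarrow> iexp \<Rightarrow> com \<Rightarrow> com" where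
  "For x lo hi c =
    Seq (IAssign x lo) (While (ILess (IVar x) hi) (Seq c (IAssign x (IAdd (IVar x) (IConst 1)))))"

lemma For_writes [simp]:
  "ivar_writes (For x lo hi c) = insert x (ivar_writes c)"
  "iarr_writes (For x lo hi c) = iarr_writes c"
  "vvar_writes (For x lo hi c) = vvar_writes c"
  "varr_writes (For x lo hi c) = varr_writes c"
  by (auto simp: For_def)

text \<open>A round costs the body, \<open>3 + icost hi\<close> for the guard and 4 for the
  increment. \<open>Inv k\<close> is asserted once \<open>x\<close> holds \<open>k\<close>, hence
  the updated states in \<open>init\<close> and \<open>body\<close>. The bound \<open>hi\<close> is
  evaluated anew in each round, so it must keep the value \<open>b\<close>.\<close>

lemma runs_For:
  assumes lo: "ieval I s lo = Some a" and "a \<le> b" and x: "x \<notin> ivar_writes c"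
    and init: "Inv a (s\<lparr>ivar := (ivar s)(x := a)\<rparr>)"
    and hi: "\<And>k s'. Inv k s' \<Longrightarrow> ivar s' x = k \<Longrightarrow> frame (For x lo hi c) s s' \<Longrightarrow> ieval I s' hi = Some b"
    and body: "\<And>k s'. a \<le> k \<Longrightarrow> k < b \<Longrightarrow> Inv k s' \<Longrightarrow> ivar s' x = k \<Longrightarrow> frame (For x lo hi c) s s' \<Longrightarrow>
      runs I c s' Tb (\<lambda>s''. Inv (Suc k) (s''\<lparr>ivar := (ivar s'')(x := Suc k)\<rparr>))"
    and post: "\<And>s'. Inv b s' \<Longrightarrow> frame (For x lo hi c) s s' \<Longrightarrow> Q s'"
    and T: "5 + icost lo + icost hi + (b - a) * (Tb + 7 + icost hi) \<le> T"
  shows "runs I (For x lo hi c) s T Q"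
proof -
  let ?b = "ILess (IVar x) hi"
  let ?inc = "IAssign x (IAdd (IVar x) (IConst 1))"
  let ?W = "While ?b (Seq c ?inc)"
  have loop: "runs I ?W s' (3 + icost hi + 1 + (b - k) * (Tb + 7 + icost hi)) (\<lambda>s''. Inv b s'' \<and> frame (For x lo hi c) s s'')"
    if "a \<le> k" "k \<le> b" "Inv k s'" "ivar s' x = k" "frame (For x lo hi c) s s'" for k s'
    using that
  proof (induction "b - k" arbitrary: k s')
    case 0
    then have "k = b" by simp
    have "beval I s' ?b = Some False" using hi[OF 0(4,5,6)] 0 \<open>k = b\<close> by simp
    from exec.WhileFalse[OF this, of "Seq c ?inc"] show ?case
      using 0 \<open>k = b\<close> unfolding runs_def by (auto intro!: exI)
  next
    case (Suc d)
    have kb: "k < b" using Suc(2) by simp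
    have t: "beval I s' ?b = Some True" using hi[OF Suc(5,6,7)] Suc kb by simp
    obtain t1 s1 where 1: "exec I c s' t1 s1" "t1 \<le> Tb"
      and inv: "Inv (Suc k) (s1\<lparr>ivar := (ivar s1)(x := Suc k)\<rparr>)"
      using body[OF Suc(3) kb Suc(5,6,7)] unfolding runs_def by blast
    have k1: "ivar s1 x = k" using exec_frame[OF 1(1)] x Suc(6) by (simp add: frame_def)
    let ?s2 = "s1\<lparr>ivar := (ivar s1)(x := Suc k)\<rparr>"
    have 2: "exec I ?inc s1 4 ?s2"
      using exec.IAssign[of I s1 "IAdd (IVar x) (IConst 1)" "Suc k" x] k1 by (simp add: eval_nat_numeral)
    have body': "exec I (Seq c ?inc) s' (t1 + 4) ?s2" by (rule exec.Seq[OF 1(1) 2])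
    have fr: "frame (For x lo hi c) s ?s2"
      using Suc(7) exec_frame[OF 1(1)] by (auto simp: frame_def)
    have "runs I ?W ?s2 (3 + icost hi + 1 + (b - Suc k) * (Tb + 7 + icost hi)) (\<lambda>s''. Inv b s'' \<and> frame (For x lo hi c) s s'')"
      using Suc(2,3) kb inv fr by (intro Suc(1)) auto
    then obtain t3 s3 where 3: "exec I ?W ?s2 t3 s3" "t3 \<le> 3 + icost hi + 1 + (b - Suc k) * (Tb + 7 + icost hi)"
      and Q: "Inv b s3" "frame (For x lo hi c) s s3" unfolding runs_def by blast
    have e: "exec I ?W s' (1 + bexp_cost ?b + (t1 + 4) + t3) s3"
      by (rule exec.WhileTrue[OF t body' 3(1)])
    have "(b - k) * (Tb + 7 + icost hi) = (b - Suc k) * (Tb + 7 + icost hi) + (Tb + 7 + icost hi)"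
      using kb by (metis Suc_diff_Suc add.commute mult_Suc)
    then show ?case using e Q 3(2) 1(2) unfolding runs_def
      by (intro exI[of _ "1 + bexp_cost ?b + (t1 + 4) + t3"] exI[of _ s3]) auto
  qed
  let ?s1 = "s\<lparr>ivar := (ivar s)(x := a)\<rparr>"
  have 1: "runs I (IAssign x lo) s (1 + icost lo) (\<lambda>s'. s' = ?s1)"
    by (rule runs_wp) (use lo in auto)
  have 2: "runs I ?W ?s1 (3 + icost hi + 1 + (b - a) * (Tb + 7 + icost hi)) (\<lambda>s''. Inv b s'' \<and> frame (For x lo hi c) s s'')"
    using init \<open>a \<le> b\<close> by (intro loop) (auto simp: frame_def)
  have 3: "runs I ?W ?s1 (3 + icost hi + 1 + (b - a) * (Tb + 7 + icost hi)) Q"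
    by (rule runs_mono[OF 2 order.refl]) (use post in blast)
  show ?thesis unfolding For_def
  proof (rule runs_Seq[OF 1])
    show "1 + icost lo + (3 + icost hi + 1 + (b - a) * (Tb + 7 + icost hi)) \<le> T"
      using T by simp
  qed (use 3 in simp)
qed

section \<open>The program\<close>

text \<open>
  The values of all variables are numbered consecutively from 1 to \<open>n\<close>: number \<open>p\<close> is value \<open>A[p]\<close> of
  variable \<open>P[p]\<close>.  Since indices cannot be multiplied, row offsets of two-dimensional arrays are
  tabulated in \<open>R\<close>.  The array \<open>S\<close> holds the current transversal, \<open>H\<close> the sums \<open>H S p\<close>, \<open>c\<close> and \<open>g\<close> the
  arc weights and the values that attain them, \<open>D\<close> and \<open>e\<close> the walk distances and predecessors.
\<close>

abbreviation seq :: "com \<Rightarrow> com \<Rightarrow> com" (infixr \<open>;;\<close> 60) where "p ;; q \<equiv> Seq p q"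
abbreviation next_index :: "iexp \<Rightarrow> iexp" where "next_index e \<equiv> IAdd e (IConst 1)"
abbreviation ieq :: "iexp \<Rightarrow> iexp \<Rightarrow> bexp" where
  "ieq e1 e2 \<equiv> BAnd (BNot (ILess e1 e2)) (BNot (ILess e2 e1))"
abbreviation Part :: "iexp \<Rightarrow> iexp" where "Part e \<equiv> IArr ''P'' e"
abbreviation Val :: "iexp \<Rightarrow> iexp" where "Val e \<equiv> IArr ''A'' e"
abbreviation Sel :: "iexp \<Rightarrow> iexp" where "Sel e \<equiv> IArr ''S'' e"
abbreviation cell :: "iexp \<Rightarrow> iexp \<Rightarrow> iexp" where "cell e1 e2 \<equiv> IAdd (IArr ''R'' e1) e2"
abbreviation Bin :: "iexp \<Rightarrow> iexp \<Rightarrow> vexp" where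
  "Bin p q \<equiv> BinTable (Part p) (Part q) (Val p) (Val q)"

section \<open>Numbering the values\<close>

definition flatten_prog :: com where
  "flatten_prog =
    IAssign ''n'' (IConst 0) ;;
    For ''i'' (IConst 1) (next_index NumVars)
      (For ''a'' (IConst 1) (next_index (DomSize (IVar ''i'')))
        (IAssign ''n'' (next_index (IVar ''n'')) ;;
         IStore ''P'' (IVar ''n'') (IVar ''i'') ;;
         IStore ''A'' (IVar ''n'') (IVar ''a'')))"

lemma bij_betw_snoc:
  assumes "bij_betw f {1..m} B" "b \<notin> B"
  shows "bij_betw (f(Suc m := b)) {1..Suc m} (insert b B)"
proof -
  have "bij_betw (f(Suc m := b)) {1..m} B"
    using assms(1) by (subst bij_betw_cong[of _ _ f]) auto
  moreover have "bij_betw (f(Suc m := b)) {Suc m} {b}" by (simp add: bij_betw_def)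
  ultimately have "bij_betw (f(Suc m := b)) ({1..m} \<union> {Suc m}) (B \<union> {b})"
    using assms(2) by (intro bij_betw_combine) auto
  moreover have "{1..m} \<union> {Suc m} = {1..Suc m}" by auto
  ultimately show ?thesis by simp
qed

lemma dsize_le_total: "i \<in> {1..nvars I} \<Longrightarrow> dsize I i \<le> total_size I"
  unfolding total_size_def by (intro member_le_sum) auto

lemma nvars_le_total: "wf_inst I \<Longrightarrow> nvars I \<le> total_size I"
proof -
  assume wf: "wf_inst I"
  have "(\<Sum>i\<in>{1..nvars I}. 1) \<le> total_size I" unfolding total_size_def
  proof (rule sum_mono)
    fix i assume "i \<in> {1..nvars I}"
    then have "2 \<le> dsize I i" using wf unfolding wf_inst_def by blast
    then show "1 \<le> dsize I i" by simp
  qed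
  then show ?thesis by simp
qed

lemma runs_flatten:
  assumes wf: "wf_inst I"
  defines "n \<equiv> total_size I"
  shows "runs I flatten_prog s (20 + n * (30 + n * 30))
    (\<lambda>s'. ivar s' ''n'' = n \<and> bij_betw (\<lambda>p. (iarr s' ''P'' p, iarr s' ''A'' p)) {1..n}
       (SIGMA j:{1..nvars I}. {1..dsize I j}))"
proof -
  define Inv where "Inv B s \<longleftrightarrow> bij_betw (\<lambda>p. (iarr s ''P'' p, iarr s ''A'' p)) {1..ivar s ''n''} B"
    for B :: "(nat \<times> nat) set" and s :: state
  let ?B = "\<lambda>k. SIGMA j:{1..<k}. {1..dsize I j}"
  show ?thesis
    unfolding flatten_prog_def
  proof (rule runs_Seq)
    show "runs I (IAssign ''n'' (IConst 0)) s 2 (\<lambda>s'. ivar s' ''n'' = 0)"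
      by (rule runs_wp) auto
    fix s0 :: state assume s0: "ivar s0 ''n'' = 0"
    show "runs I (For ''i'' (IConst 1) (next_index NumVars)
      (For ''a'' (IConst 1) (next_index (DomSize (IVar ''i'')))
        (IAssign ''n'' (next_index (IVar ''n'')) ;;
         IStore ''P'' (IVar ''n'') (IVar ''i'') ;;
         IStore ''A'' (IVar ''n'') (IVar ''a'')))) s0 (18 + n * (30 + n * 30))
       (\<lambda>s'. ivar s' ''n'' = n \<and> bij_betw (\<lambda>p. (iarr s' ''P'' p, iarr s' ''A'' p)) {1..n}
       (SIGMA j:{1..nvars I}. {1..dsize I j}))"
    proof (rule runs_For[where a = 1 and b = "Suc (nvars I)" and Inv = "\<lambda>k. Inv (?B k)" and Tb = "20 + n * 30"])
      fix k s1
      assume k: "1 \<le> k" "k < Suc (nvars I)" and inv: "Inv (?B k) s1" and ks: "ivar s1 ''i'' = k"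
      show "runs I (For ''a'' (IConst 1) (next_index (DomSize (IVar ''i'')))
        (IAssign ''n'' (next_index (IVar ''n'')) ;;
         IStore ''P'' (IVar ''n'') (IVar ''i'') ;;
         IStore ''A'' (IVar ''n'') (IVar ''a''))) s1 (20 + n * 30)
        (\<lambda>s''. Inv (?B (Suc k)) (s''\<lparr>ivar := (ivar s'')(''i'' := Suc k)\<rparr>))"
      proof (rule runs_For[where a = 1 and b = "Suc (dsize I k)" and Tb = 10 and
            Inv = "\<lambda>a. Inv (?B k \<union> {k} \<times> {1..<a})"])
        fix a s2
        assume a: "1 \<le> a" "a < Suc (dsize I k)" and inv: "Inv (?B k \<union> {k} \<times> {1..<a}) s2"
          and as: "ivar s2 ''a'' = a"
          and fr: "frame (For ''a'' (IConst 1) (next_index (DomSize (IVar ''i'')))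
            (IAssign ''n'' (next_index (IVar ''n'')) ;;
             IStore ''P'' (IVar ''n'') (IVar ''i'') ;;
             IStore ''A'' (IVar ''n'') (IVar ''a''))) s1 s2"
        have i: "ivar s2 ''i'' = k" using fr ks by (simp add: frame_def)
        have "bij_betw ((\<lambda>p. (iarr s2 ''P'' p, iarr s2 ''A'' p))(Suc (ivar s2 ''n'') := (k, a))) {1..Suc (ivar s2 ''n'')}
          (insert (k, a) (?B k \<union> {k} \<times> {1..<a}))"
          using inv unfolding Inv_def by (rule bij_betw_snoc) auto
        also have "(\<lambda>p. (iarr s2 ''P'' p, iarr s2 ''A'' p))(Suc (ivar s2 ''n'') := (k, a)) =
          (\<lambda>p. (((iarr s2 ''P'')(Suc (ivar s2 ''n'') := k)) p, ((iarr s2 ''A'')(Suc (ivar s2 ''n'') := a)) p))"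
          by auto
        also have "insert (k, a) (?B k \<union> {k} \<times> {1..<a}) = ?B k \<union> {k} \<times> {1..<Suc a}" using a by auto
        finally show "runs I (IAssign ''n'' (next_index (IVar ''n'')) ;;
             IStore ''P'' (IVar ''n'') (IVar ''i'') ;;
             IStore ''A'' (IVar ''n'') (IVar ''a'')) s2 10
            (\<lambda>s''. Inv (?B k \<union> {k} \<times> {1..<Suc a}) (s''\<lparr>ivar := (ivar s'')(''a'' := Suc a)\<rparr>))"
          by (intro runs_wp)
             (simp_all add: i as Inv_def fun_upd_same fun_upd_other del: fun_upd_apply)
      next
        fix s' assume "Inv (?B k \<union> {k} \<times> {1..<Suc (dsize I k)}) s'"
        moreover have "?B k \<union> {k} \<times> {1..<Suc (dsize I k)} = ?B (Suc k)"
          using k by (auto simp: less_Suc_eq)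
        ultimately show "Inv (?B (Suc k)) (s'\<lparr>ivar := (ivar s')(''i'' := Suc k)\<rparr>)"
          by (simp add: Inv_def)
      qed (use k ks inv dsize_le_total[of k I] in \<open>auto simp: Inv_def frame_def n_def\<close>)
    next
      fix s' assume inv: "Inv (?B (Suc (nvars I))) s'"
      have B: "?B (Suc (nvars I)) = (SIGMA j:{1..nvars I}. {1..dsize I j})" by auto
      have "ivar s' ''n'' = card (SIGMA j:{1..nvars I}. {1..dsize I j})"
        using bij_betw_same_card[OF inv[unfolded Inv_def B]] by simp
      also have "\<dots> = n" by (simp add: n_def total_size_def)
      finally show "ivar s' ''n'' = n \<and> bij_betw (\<lambda>p. (iarr s' ''P'' p, iarr s' ''A'' p)) {1..n}
       (SIGMA j:{1..nvars I}. {1..dsize I j})"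
        using inv unfolding Inv_def B by simp
    next
      have "nvars I * (30 + n * 30) \<le> n * (30 + n * 30)"
        using nvars_le_total[OF wf] by (intro mult_right_mono) (auto simp: n_def)
      then show "5 + icost (IConst 1) + icost (next_index NumVars) +
        (Suc (nvars I) - 1) * (20 + n * 30 + 7 + icost (next_index NumVars)) \<le> 18 + n * (30 + n * 30)"
        by (simp add: algebra_simps)
    qed (auto simp: Inv_def s0 bij_betw_def)
  qed simp
qed

section \<open>Tabulating \<open>W\<close> and choosing a first transversal\<close>

definition rows_prog :: com where
  "rows_prog =
    IStore ''R'' (IConst 0) (IConst 0) ;;
    For ''p'' (IConst 0) (IVar ''n'')
      (IStore ''R'' (next_index (IVar ''p'')) (IAdd (IArr ''R'' (IVar ''p'')) (next_index (IVar ''n''))))"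

definition cap_body :: com where
  "cap_body =
    If (ILess (Part (IVar ''p'')) (Part (IVar ''q'')))
      (If (VLess (Bin (IVar ''p'') (IVar ''q'')) VInf)
        (VAssign ''M'' (VAdd (VVar ''M'') (Bin (IVar ''p'') (IVar ''q'')))) Skip) Skip"

definition cap_row :: com where
  "cap_row =
    VAssign ''M'' (VAdd (VVar ''M'') (UnTable (Part (IVar ''p'')) (Val (IVar ''p'')))) ;;
    For ''q'' (IConst 1) (next_index (IVar ''n'')) cap_body"

definition cap_prog :: com where
  "cap_prog = VAssign ''M'' VOne ;; For ''p'' (IConst 1) (next_index (IVar ''n'')) cap_row"

definition cross_body :: com where
  "cross_body =
    If (ILess (Part (IVar ''p'')) (Part (IVar ''q'')))
      (VAssign ''t'' (Bin (IVar ''p'') (IVar ''q'')))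
      (If (ILess (Part (IVar ''q'')) (Part (IVar ''p'')))
        (VAssign ''t'' (Bin (IVar ''q'') (IVar ''p''))) (VAssign ''t'' VZero)) ;;
    If (VLess (VVar ''M'') (VVar ''t'')) (VAssign ''t'' (VVar ''M'')) Skip ;;
    VStore ''W'' (cell (IVar ''p'') (IVar ''q'')) (VVar ''t'')"

definition cross_prog :: com where
  "cross_prog = For ''p'' (IConst 1) (next_index (IVar ''n''))
    (For ''q'' (IConst 1) (next_index (IVar ''n'')) cross_body)"

text \<open>Positions start at 1, so \<open>z = 0\<close> can signal that no element of another part
  has been met yet.\<close>

definition closest_body :: com where
  "closest_body =
    If (ieq (Part (IVar ''p'')) (Part (IVar ''q''))) Skip
      (If (ILess (IVar ''z'') (IConst 1)) (IAssign ''z'' (IVar ''q''))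
        (If (VLess (VArr ''W'' (cell (IVar ''p'') (IVar ''z''))) (VArr ''W'' (cell (IVar ''p'') (IVar ''q''))))
          (IAssign ''z'' (IVar ''q'')) Skip))"

text \<open>Only entries between different parts are read and only entries within a part are
  written, so the table can be completed in place.\<close>

definition same_body :: com where
  "same_body =
    If (ieq (Part (IVar ''p'')) (Part (IVar ''q'')))
      (If (ieq (IVar ''p'') (IVar ''q'')) Skip
        (If (VLess (VArr ''W'' (cell (IVar ''p'') (IVar ''z''))) (VArr ''W'' (cell (IVar ''q'') (IVar ''z''))))
          (VStore ''W'' (cell (IVar ''p'') (IVar ''q'')) (VArr ''W'' (cell (IVar ''p'') (IVar ''z''))))
          (VStore ''W'' (cell (IVar ''p'') (IVar ''q'')) (VArr ''W'' (cell (IVar ''q'') (IVar ''z'')))))) Skip"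

definition same_row :: com where
  "same_row =
    IAssign ''z'' (IConst 0) ;;
    For ''q'' (IConst 1) (next_index (IVar ''n'')) closest_body ;;
    For ''q'' (IConst 1) (next_index (IVar ''n'')) same_body"

definition same_prog :: com where
  "same_prog = For ''p'' (IConst 1) (next_index (IVar ''n'')) same_row"

text \<open>Later elements overwrite earlier ones of the same part. Any transversal is a valid
  start, since it is optimal while all parts are frozen.\<close>

definition choose_prog :: com where
  "choose_prog = For ''p'' (IConst 1) (next_index (IVar ''n''))
    (IStore ''S'' (Part (IVar ''p'')) (IVar ''p''))"

context flat_instance
begin

text \<open>The stride is \<open>Suc n\<close> because column indices run over
  \<open>{0..n}\<close>. Since \<open>r \<le> n\<close>, the same offsets serve the tables indexed
  by parts.\<close>

definition idx :: "nat \<Rightarrow> nat \<Rightarrow> nat" where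
  "idx p q = p * Suc n + q"

lemma idx_inj: "q \<le> n \<Longrightarrow> q' \<le> n \<Longrightarrow> idx p q = idx p' q' \<longleftrightarrow> p = p' \<and> q = q'"
proof
  assume q: "q \<le> n" "q' \<le> n" and eq: "idx p q = idx p' q'"
  have "(a * Suc n + b) div Suc n = a" if "b \<le> n" for a b
    using that div_mult_self3[of "Suc n" a b] by (simp del: mult_Suc_right)
  then have p: "p = p'" using eq q unfolding idx_def by metis
  then show "p = p' \<and> q = q'" using eq by (simp add: idx_def)
qed simp

definition loaded :: "state \<Rightarrow> bool" where
  "loaded s \<longleftrightarrow> ivar s ''n'' = n \<and> iarr s ''P'' = Pt \<and> iarr s ''A'' = Vl"

definition indexed :: "state \<Rightarrow> bool" where
  "indexed s \<longleftrightarrow> loaded s \<and> (\<forall>p\<le>n. \<forall>q. iarr s ''R'' p + q = idx p q)"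

lemma Pt_range: "1 \<le> p \<Longrightarrow> p \<le> n \<Longrightarrow> 1 \<le> Pt p \<and> Pt p \<le> r \<and> Vl p \<in> dom_of I (Pt p)"
  using flat_mem[of p] by auto

lemma c_less: "Pt p < Pt q \<Longrightarrow> bin_table I (Pt p) (Pt q) (Vl p) (Vl q) = c p q"
  by (simp add: c_def bcost_def)

lemma runs_rows:
  assumes "loaded s"
  shows "runs I rows_prog s (20 + n * 20) indexed"
  unfolding rows_prog_def
proof (rule runs_Seq)
  show "runs I (IStore ''R'' (IConst 0) (IConst 0)) s 3 (\<lambda>s. loaded s \<and> iarr s ''R'' 0 = 0)"
    using assms by (intro runs_wp) (auto simp: loaded_def)
  fix s0 assume s0: "loaded s0 \<and> iarr s0 ''R'' 0 = 0"
  show "runs I (For ''p'' (IConst 0) (IVar ''n'')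
      (IStore ''R'' (next_index (IVar ''p'')) (IAdd (IArr ''R'' (IVar ''p'')) (next_index (IVar ''n'')))))
      s0 (17 + n * 20) indexed"
    by (rule runs_For[where a = 0 and b = n and Tb = 12 and
          Inv = "\<lambda>k s. loaded s \<and> (\<forall>p\<le>k. iarr s ''R'' p = p * Suc n)"])
       (use s0 in \<open>auto simp: loaded_def indexed_def idx_def le_Suc_eq intro!: runs_wp\<close>)
qed simp

lemma sum_Suc: "Suc 0 \<le> k \<Longrightarrow> sum g {Suc 0..<Suc k} = sum g {Suc 0..<k} + (g k :: real)"
  by simp

lemma runs_cap_body:
  assumes "loaded s" "ivar s ''p'' = p" "ivar s ''q'' = q" "p \<in> {1..n}" "q \<in> {1..n}" "vvar s ''M'' = ereal x"
  shows "runs I cap_body s 50 (\<lambda>s'. vvar s' ''M'' = ereal (x + fin_c p q))"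
proof (intro runs_wp)
  have p: "1 \<le> Pt p" "Pt p \<le> r" "Vl p \<in> dom_of I (Pt p)" and q: "1 \<le> Pt q" "Pt q \<le> r" "Vl q \<in> dom_of I (Pt q)"
    using Pt_range[of p] Pt_range[of q] assms by auto
  consider "\<not> Pt p < Pt q" | "Pt p < Pt q" "c p q = \<infinity>" | y where "Pt p < Pt q" "c p q = ereal y"
    using c_nonneg[OF assms(4,5)] by (cases "Pt p < Pt q"; cases "c p q") auto
  then show "wp I cap_body s (\<lambda>s'. vvar s' ''M'' = ereal (x + fin_c p q))"
    by cases (use assms(1-3,6) p q in \<open>simp_all add: cap_body_def loaded_def c_less fin_c_def\<close>)
qed (simp add: cap_body_def)

lemma runs_cap:
  assumes "loaded s"
  shows "runs I cap_prog s (20 + n * (50 + n * 70)) (\<lambda>s'. vvar s' ''M'' = ereal cap)"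
  unfolding cap_prog_def
proof (rule runs_Seq)
  show "runs I (VAssign ''M'' VOne) s 2 (\<lambda>s. loaded s \<and> vvar s ''M'' = 1)"
    using assms by (intro runs_wp) (auto simp: loaded_def)
  fix s0 assume s0: "loaded s0 \<and> vvar s0 ''M'' = 1"
  let ?g = "\<lambda>p. un p + (\<Sum>q\<in>{1..n}. fin_c p q)"
  show "runs I (For ''p'' (IConst 1) (next_index (IVar ''n'')) cap_row) s0 (18 + n * (50 + n * 70))
    (\<lambda>s'. vvar s' ''M'' = ereal cap)"
  proof (rule runs_For[where a = 1 and b = "Suc n" and Tb = "30 + n * 70" and
      Inv = "\<lambda>k s. vvar s ''M'' = ereal (1 + (\<Sum>p\<in>{1..<k}. ?g p))"])
    fix p s1
    assume p: "1 \<le> p" "p < Suc n" and inv: "vvar s1 ''M'' = ereal (1 + (\<Sum>p\<in>{1..<p}. ?g p))"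
      and ps: "ivar s1 ''p'' = p"
      and fr: "frame (For ''p'' (IConst 1) (next_index (IVar ''n'')) cap_row) s0 s1"
    have l: "loaded s1" using s0 fr by (simp add: frame_def loaded_def cap_row_def cap_body_def)
    show "runs I cap_row s1 (30 + n * 70) (\<lambda>s'. vvar (s'\<lparr>ivar := (ivar s')(''p'' := Suc p)\<rparr>) ''M''
        = ereal (1 + (\<Sum>p\<in>{1..<Suc p}. ?g p)))"
      unfolding cap_row_def
    proof (rule runs_Seq)
      show "runs I (VAssign ''M'' (VAdd (VVar ''M'') (UnTable (Part (IVar ''p'')) (Val (IVar ''p''))))) s1 8
        (\<lambda>s. loaded s \<and> ivar s ''p'' = p \<and> vvar s ''M'' = ereal (1 + (\<Sum>p\<in>{1..<p}. ?g p) + un p))"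
        using p l ps inv Pt_range[of p] by (intro runs_wp) (auto simp: loaded_def un_def)
      fix s2 assume s2: "loaded s2 \<and> ivar s2 ''p'' = p \<and> vvar s2 ''M'' = ereal (1 + (\<Sum>p\<in>{1..<p}. ?g p) + un p)"
      show "runs I (For ''q'' (IConst 1) (next_index (IVar ''n'')) cap_body) s2 (22 + n * 70)
        (\<lambda>s'. vvar (s'\<lparr>ivar := (ivar s')(''p'' := Suc p)\<rparr>) ''M'' = ereal (1 + (\<Sum>p\<in>{1..<Suc p}. ?g p)))"
      proof (rule runs_For[where a = 1 and b = "Suc n" and Tb = 50 and
          Inv = "\<lambda>k s. vvar s ''M'' = ereal (1 + (\<Sum>p\<in>{1..<p}. ?g p) + un p + (\<Sum>q\<in>{1..<k}. fin_c p q))"])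
        fix q s3
        assume q: "1 \<le> q" "q < Suc n"
          and inv: "vvar s3 ''M'' = ereal (1 + (\<Sum>p\<in>{1..<p}. ?g p) + un p + (\<Sum>q\<in>{1..<q}. fin_c p q))"
          and qs: "ivar s3 ''q'' = q"
          and fr: "frame (For ''q'' (IConst 1) (next_index (IVar ''n'')) cap_body) s2 s3"
        have "loaded s3" "ivar s3 ''p'' = p" using s2 fr by (simp_all add: frame_def loaded_def cap_body_def)
        from runs_cap_body[OF this(1,2) qs _ _ inv]
        show "runs I cap_body s3 50 (\<lambda>s'. vvar (s'\<lparr>ivar := (ivar s')(''q'' := Suc q)\<rparr>) ''M'' =
          ereal (1 + (\<Sum>p\<in>{1..<p}. ?g p) + un p + (\<Sum>q\<in>{1..<Suc q}. fin_c p q)))"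
          using p q by (simp add: sum_Suc algebra_simps del: sum.op_ivl_Suc)
      next
        fix s' assume "vvar s' ''M'' = ereal (1 + (\<Sum>p\<in>{1..<p}. ?g p) + un p + (\<Sum>q\<in>{1..<Suc n}. fin_c p q))"
        then show "vvar (s'\<lparr>ivar := (ivar s')(''p'' := Suc p)\<rparr>) ''M'' = ereal (1 + (\<Sum>p\<in>{1..<Suc p}. ?g p))"
          using p by (simp add: sum_Suc atLeastLessThanSuc_atLeastAtMost[of _ n] algebra_simps del: sum.op_ivl_Suc)
      qed (use s2 p in \<open>auto simp: frame_def loaded_def cap_body_def\<close>)
    qed simp
  qed (use s0 in \<open>auto simp: frame_def loaded_def cap_row_def cap_body_def cap_def one_ereal_def atLeastLessThanSuc_atLeastAtMost algebra_simps simp del: sum.op_ivl_Suc\<close>)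
qed simp

text \<open>The 0 within a part is a placeholder until \<open>same_prog\<close> overwrites it; on
  the diagonal it is already the right value.\<close>

definition cross :: "nat \<Rightarrow> nat \<Rightarrow> real" where
  "cross p q = (if Pt p \<noteq> Pt q then W p q else 0)"

lemma ereal_cross:
  assumes "p \<in> {1..n}" "q \<in> {1..n}"
  shows "ereal (cross p q) = min (if Pt p \<noteq> Pt q then c p q else 0) (ereal cap)"
proof (cases "Pt p = Pt q")
  case True
  then show ?thesis using cap_ge_one by (simp add: cross_def min_def)
next
  case False
  then show ?thesis using ereal_capped[OF assms] by (simp add: cross_def W_cross)
qed

lemma runs_cross_body:
  assumes "indexed s" "vvar s ''M'' = ereal cap"
    and "ivar s ''p'' = p" "ivar s ''q'' = q" "p \<in> {1..n}" "q \<in> {1..n}"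
  shows "runs I cross_body s 70 (\<lambda>s'. varr s' ''W'' = (varr s ''W'')(idx p q := ereal (cross p q)))"
proof (intro runs_wp)
  have p: "1 \<le> Pt p" "Pt p \<le> r" "Vl p \<in> dom_of I (Pt p)" "p \<le> n" and q: "1 \<le> Pt q" "Pt q \<le> r" "Vl q \<in> dom_of I (Pt q)"
    using Pt_range[of p] Pt_range[of q] assms by auto
  have v: "ereal (cross p q) = (if ereal cap < (if Pt p \<noteq> Pt q then c p q else 0) then ereal cap
      else (if Pt p \<noteq> Pt q then c p q else 0))"
    unfolding ereal_cross[OF assms(5,6)] by (simp add: min_def flip: not_le)
  consider "Pt p < Pt q" | "Pt q < Pt p" | "Pt p = Pt q" by linarith
  then show "wp I cross_body s (\<lambda>s'. varr s' ''W'' = (varr s ''W'')(idx p q := ereal (cross p q)))"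
    by cases (use assms(1-4) p q c_less[of p q] c_less[of q p] c_sym[of p q]
        in \<open>simp_all add: cross_body_def loaded_def indexed_def v\<close>)
qed (simp add: cross_body_def)

lemma runs_cross:
  assumes "indexed s" "vvar s ''M'' = ereal cap"
  shows "runs I cross_prog s (20 + n * (30 + n * 90))
    (\<lambda>s'. \<forall>p\<in>{1..n}. \<forall>q\<in>{1..n}. varr s' ''W'' (idx p q) = ereal (cross p q))"
  unfolding cross_prog_def
proof (rule runs_For[where a = 1 and b = "Suc n" and Tb = "20 + n * 90" and
    Inv = "\<lambda>k s. \<forall>p\<in>{1..<k}. \<forall>q\<in>{1..n}. varr s ''W'' (idx p q) = ereal (cross p q)"])
  fix k s1
  assume k: "1 \<le> k" "k < Suc n" and inv: "\<forall>p\<in>{1..<k}. \<forall>q\<in>{1..n}. varr s1 ''W'' (idx p q) = ereal (cross p q)"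
    and ks: "ivar s1 ''p'' = k"
    and fr: "frame (For ''p'' (IConst 1) (next_index (IVar ''n''))
      (For ''q'' (IConst 1) (next_index (IVar ''n'')) cross_body)) s s1"
  have s1: "indexed s1" "vvar s1 ''M'' = ereal cap"
    using fr assms by (simp_all add: frame_def indexed_def loaded_def cross_body_def)
  show "runs I (For ''q'' (IConst 1) (next_index (IVar ''n'')) cross_body) s1 (20 + n * 90)
    (\<lambda>s'. \<forall>p\<in>{1..<Suc k}. \<forall>q\<in>{1..n}. varr (s'\<lparr>ivar := (ivar s')(''p'' := Suc k)\<rparr>) ''W'' (idx p q) = ereal (cross p q))"
  proof (rule runs_For[where a = 1 and b = "Suc n" and Tb = 70 and
      Inv = "\<lambda>l s. \<forall>p\<in>{1..<Suc k}. \<forall>q\<in>{1..n}. p < k \<or> q < l \<longrightarrow> varr s ''W'' (idx p q) = ereal (cross p q)"])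
    fix l s2
    assume l: "1 \<le> l" "l < Suc n"
      and inv: "\<forall>p\<in>{1..<Suc k}. \<forall>q\<in>{1..n}. p < k \<or> q < l \<longrightarrow> varr s2 ''W'' (idx p q) = ereal (cross p q)"
      and ls: "ivar s2 ''q'' = l"
      and fr: "frame (For ''q'' (IConst 1) (next_index (IVar ''n'')) cross_body) s1 s2"
    have s2: "indexed s2" "vvar s2 ''M'' = ereal cap" "ivar s2 ''p'' = k"
      using fr s1 ks by (simp_all add: frame_def indexed_def loaded_def cross_body_def)
    show "runs I cross_body s2 70 (\<lambda>s'. \<forall>p\<in>{1..<Suc k}. \<forall>q\<in>{1..n}. p < k \<or> q < Suc l \<longrightarrow>
        varr (s'\<lparr>ivar := (ivar s')(''q'' := Suc l)\<rparr>) ''W'' (idx p q) = ereal (cross p q))"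
    proof (rule runs_mono[OF runs_cross_body[OF s2 ls] order.refl])
      fix s' assume W: "varr s' ''W'' = (varr s2 ''W'')(idx k l := ereal (cross k l))"
      show "\<forall>p\<in>{1..<Suc k}. \<forall>q\<in>{1..n}. p < k \<or> q < Suc l \<longrightarrow>
        varr (s'\<lparr>ivar := (ivar s')(''q'' := Suc l)\<rparr>) ''W'' (idx p q) = ereal (cross p q)"
      proof (intro ballI impI)
        fix p q assume pq: "p \<in> {1..<Suc k}" "q \<in> {1..n}" "p < k \<or> q < Suc l"
        show "varr (s'\<lparr>ivar := (ivar s')(''q'' := Suc l)\<rparr>) ''W'' (idx p q) = ereal (cross p q)"
        proof (cases "p = k \<and> q = l")
          case False
          then have "p < k \<or> q < l" "idx p q \<noteq> idx k l" using pq l by (auto simp: idx_inj)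
          then show ?thesis using inv[rule_format, OF pq(1,2)] by (simp add: W)
        qed (simp add: W)
      qed
    qed (use k l in auto)
  next
    show "\<forall>p\<in>{1..<Suc k}. \<forall>q\<in>{1..n}. p < k \<or> q < 1 \<longrightarrow>
        varr (s1\<lparr>ivar := (ivar s1)(''q'' := 1)\<rparr>) ''W'' (idx p q) = ereal (cross p q)"
      using inv by auto
  next
    fix s' assume "\<forall>p\<in>{1..<Suc k}. \<forall>q\<in>{1..n}. p < k \<or> q < Suc n \<longrightarrow> varr s' ''W'' (idx p q) = ereal (cross p q)"
    then show "\<forall>p\<in>{1..<Suc k}. \<forall>q\<in>{1..n}. varr (s'\<lparr>ivar := (ivar s')(''p'' := Suc k)\<rparr>) ''W'' (idx p q) = ereal (cross p q)"
      by auto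
  qed (use s1 in \<open>simp_all add: frame_def indexed_def loaded_def cross_body_def\<close>)
next
  fix s' assume "\<forall>p\<in>{1..<Suc n}. \<forall>q\<in>{1..n}. varr s' ''W'' (idx p q) = ereal (cross p q)"
  then show "\<forall>p\<in>{1..n}. \<forall>q\<in>{1..n}. varr s' ''W'' (idx p q) = ereal (cross p q)"
    by (simp add: atLeastLessThanSuc_atLeastAtMost)
qed (use assms in \<open>simp_all add: frame_def indexed_def loaded_def cross_body_def\<close>)

definition partial_W :: "nat \<Rightarrow> nat \<Rightarrow> nat \<Rightarrow> nat \<Rightarrow> real" where
  "partial_W k l p q = (if p < k \<or> p = k \<and> q < l \<or> Pt p \<noteq> Pt q then W p q else 0)"

definition holds_W :: "state \<Rightarrow> (nat \<Rightarrow> nat \<Rightarrow> real) \<Rightarrow> bool" where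
  "holds_W s f \<longleftrightarrow> (\<forall>p\<in>{1..n}. \<forall>q\<in>{1..n}. varr s ''W'' (idx p q) = ereal (f p q))"

definition closest :: "nat \<Rightarrow> nat \<Rightarrow> nat \<Rightarrow> bool" where
  "closest k l z \<longleftrightarrow> (if z = 0 then \<forall>q\<in>{1..<l}. Pt q = Pt k
     else z \<in> others k \<and> (\<forall>q\<in>{1..<l}. Pt q \<noteq> Pt k \<longrightarrow> W k q \<le> W k z))"

lemma runs_closest_body:
  assumes "indexed s" "ivar s ''p'' = k" "ivar s ''q'' = l" "k \<in> {1..n}" "l \<in> {1..n}"
    and W: "holds_W s (partial_W k m)" and z: "closest k l (ivar s ''z'')"
  shows "runs I closest_body s 60 (\<lambda>s'. closest k (Suc l) (ivar s' ''z''))"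
proof (intro runs_wp)
  define z where "z = ivar s ''z''"
  have "varr s ''W'' (idx k x) = ereal (W k x)" if "x \<in> {1..n}" "Pt x \<noteq> Pt k" for x
    using W that assms(4) by (auto simp: holds_W_def partial_W_def)
  then have v: "Pt l \<noteq> Pt k \<Longrightarrow> varr s ''W'' (idx k l) = ereal (W k l)"
    "z \<noteq> 0 \<Longrightarrow> varr s ''W'' (idx k z) = ereal (W k z)"
    using z assms(5) by (auto simp: closest_def z_def others_def)
  have kl: "k \<le> n" "l \<le> n" using assms(4,5) by auto
  have keep: "closest k (Suc l) z" if "Pt l = Pt k \<or> z \<noteq> 0 \<and> W k l \<le> W k z"
    using z that unfolding z_def[symmetric] closest_def by (auto simp: less_Suc_eq)
  have new: "closest k (Suc l) l" if "Pt l \<noteq> Pt k" "z = 0 \<or> W k z < W k l"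
  proof -
    have "W k q \<le> W k l" if "q \<in> {1..<Suc l}" "Pt q \<noteq> Pt k" for q
    proof (cases "q = l")
      case False
      then have q: "q \<in> {1..<l}" using that by auto
      then have "z \<noteq> 0 \<and> W k q \<le> W k z"
        using z that(2) unfolding z_def[symmetric] closest_def by (metis (full_types))
      then show ?thesis using \<open>z = 0 \<or> W k z < W k l\<close> by linarith
    qed simp
    then show ?thesis using that assms(5) by (auto simp: closest_def others_def)
  qed
  show "wp I closest_body s (\<lambda>s'. closest k (Suc l) (ivar s' ''z''))"
  proof (cases "Pt l = Pt k")
    case True
    then show ?thesis using assms(1-3) kl keep
      by (simp add: closest_body_def indexed_def loaded_def z_def)
  next
    case False
    then show ?thesis using assms(1-3) kl keep new v
      by (auto simp: closest_body_def indexed_def loaded_def z_def[symmetric] not_less)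
  qed
qed (simp add: closest_body_def)

lemma runs_same_body:
  assumes "indexed s" "ivar s ''p'' = k" "ivar s ''q'' = l" "k \<in> {1..n}" "l \<in> {1..n}"
    and W: "holds_W s (partial_W k l)" and zs: "ivar s ''z'' = z"
    and z: "z \<in> others k" "\<And>y. y \<in> others k \<Longrightarrow> W k y \<le> W k z"
  shows "runs I same_body s 90 (\<lambda>s'. holds_W s' (partial_W k (Suc l)))"
proof (intro runs_wp)
  have zn: "z \<in> {1..n}" "Pt z \<noteq> Pt k" using z by (auto simp: others_def)
  have v: "varr s ''W'' (idx k z) = ereal (W k z)" using W zn assms(4) by (auto simp: holds_W_def partial_W_def)
  have eq: "W k l = (if W k z < W l z then W k z else W l z)" if "Pt l = Pt k" "l \<noteq> k"
  proof -
    have "W k l = min (capped k z) (capped l z)"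
      using z that assms(4,5) by (intro W_same_eq) (auto simp: W_cross others_def)
    then show ?thesis using zn that by (simp add: W_cross min_def)
  qed
  have step: "holds_W s' (partial_W k (Suc l))" if "varr s' ''W'' = (varr s ''W'')(idx k l := ereal (W k l))" for s'
    unfolding holds_W_def
  proof (intro ballI)
    fix p q assume pq: "p \<in> {1..n}" "q \<in> {1..n}"
    show "varr s' ''W'' (idx p q) = ereal (partial_W k (Suc l) p q)"
    proof (cases "p = k \<and> q = l")
      case True
      then show ?thesis by (simp add: that partial_W_def)
    next
      case False
      then have "idx p q \<noteq> idx k l" "partial_W k (Suc l) p q = partial_W k l p q"
        using pq assms(4,5) by (auto simp: idx_inj partial_W_def)
      then show ?thesis using W pq by (simp add: that holds_W_def)
    qed
  qed
  \<comment> \<open>Row \<open>l\<close> may still lack entries within its part, but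
    \<open>l\<close> and \<open>z\<close> lie in different parts, where the table is final.\<close>
  have v2: "varr s ''W'' (idx l z) = ereal (W l z)" if "Pt l = Pt k"
    using W zn assms(5) that by (auto simp: holds_W_def partial_W_def)
  have same: "holds_W s (partial_W k (Suc l))" if "Pt l \<noteq> Pt k \<or> l = k"
  proof -
    have "partial_W k (Suc l) p q = partial_W k l p q" for p q
      using that W_refl[of k] by (auto simp: partial_W_def less_Suc_eq)
    then show ?thesis using W by (simp add: holds_W_def)
  qed
  have kl: "k \<le> n" "l \<le> n" using assms(4,5) by auto
  consider "Pt l \<noteq> Pt k" | "l = k" | "Pt l = Pt k" "l \<noteq> k" by blast
  then show "wp I same_body s (\<lambda>s'. holds_W s' (partial_W k (Suc l)))"
  proof cases
    case 1
    then show ?thesis using same assms(1-3) kl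
      by (auto simp: same_body_def indexed_def loaded_def)
  next
    case 2
    then show ?thesis using same assms(1-3) kl
      by (simp add: same_body_def indexed_def loaded_def)
  next
    case 3
    then show ?thesis using assms(1-3) kl zs v v2 eq[OF 3]
      by (cases "W k z < W l z") (simp_all add: same_body_def indexed_def loaded_def step, linarith+)
  qed
qed (simp add: same_body_def)

lemma runs_same:
  assumes s: "indexed s" "\<forall>p\<in>{1..n}. \<forall>q\<in>{1..n}. varr s ''W'' (idx p q) = ereal (cross p q)"
  shows "runs I same_prog s (20 + n * (60 + n * 200)) (\<lambda>s'. holds_W s' W)"
  unfolding same_prog_def
proof (rule runs_For[where a = 1 and b = "Suc n" and Tb = "50 + n * 200" and
    Inv = "\<lambda>k s. holds_W s (partial_W k 0)"])
  have "partial_W 1 0 p q = cross p q" if "p \<in> {1..n}" for p q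
    using that by (auto simp: partial_W_def cross_def)
  then show "holds_W (s\<lparr>ivar := (ivar s)(''p'' := 1)\<rparr>) (partial_W 1 0)"
    using s(2) by (auto simp: holds_W_def)
  fix k s1
  assume k: "1 \<le> k" "k < Suc n" and inv: "holds_W s1 (partial_W k 0)" and ks: "ivar s1 ''p'' = k"
    and fr: "frame (For ''p'' (IConst 1) (next_index (IVar ''n'')) same_row) s s1"
  have s1: "indexed s1"
    using fr s by (simp add: frame_def indexed_def loaded_def same_row_def same_body_def closest_body_def)
  show "runs I same_row s1 (50 + n * 200)
    (\<lambda>s'. holds_W (s'\<lparr>ivar := (ivar s')(''p'' := Suc k)\<rparr>) (partial_W (Suc k) 0))"
    unfolding same_row_def
  proof (rule runs_Seq)
    show "runs I (IAssign ''z'' (IConst 0)) s1 2 (\<lambda>s. indexed s \<and> holds_W s (partial_W k 0) \<and> ivar s ''p'' = k \<and> ivar s ''z'' = 0)"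
      using s1 inv ks by (intro runs_wp) (auto simp: indexed_def loaded_def holds_W_def)
    fix s2 assume s2: "indexed s2 \<and> holds_W s2 (partial_W k 0) \<and> ivar s2 ''p'' = k \<and> ivar s2 ''z'' = 0"
    show "runs I (For ''q'' (IConst 1) (next_index (IVar ''n'')) closest_body ;;
        For ''q'' (IConst 1) (next_index (IVar ''n'')) same_body) s2 (48 + n * 200)
      (\<lambda>s'. holds_W (s'\<lparr>ivar := (ivar s')(''p'' := Suc k)\<rparr>) (partial_W (Suc k) 0))"
    proof (rule runs_Seq)
      show "runs I (For ''q'' (IConst 1) (next_index (IVar ''n'')) closest_body) s2 (20 + n * 80)
        (\<lambda>s. closest k (Suc n) (ivar s ''z''))"
      proof (rule runs_For[where a = 1 and b = "Suc n" and Tb = 60 and Inv = "\<lambda>l s. closest k l (ivar s ''z'')"])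
        fix l s3
        assume l: "1 \<le> l" "l < Suc n" and inv: "closest k l (ivar s3 ''z'')" and ls: "ivar s3 ''q'' = l"
          and fr: "frame (For ''q'' (IConst 1) (next_index (IVar ''n'')) closest_body) s2 s3"
        have "indexed s3" "ivar s3 ''p'' = k" "holds_W s3 (partial_W k 0)"
          using fr s2 by (simp_all add: frame_def indexed_def loaded_def closest_body_def holds_W_def)
        then have "runs I closest_body s3 60 (\<lambda>s'. closest k (Suc l) (ivar s' ''z''))"
          using k l inv ls by (intro runs_closest_body) simp_all
        then show "runs I closest_body s3 60 (\<lambda>s'. closest k (Suc l) (ivar (s'\<lparr>ivar := (ivar s')(''q'' := Suc l)\<rparr>) ''z''))"
          by simp
      qed (use s2 in \<open>simp_all add: frame_def indexed_def loaded_def closest_body_def closest_def\<close>)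
      fix s3
      assume z: "closest k (Suc n) (ivar s3 ''z'')"
        and fr: "frame (For ''q'' (IConst 1) (next_index (IVar ''n'')) closest_body) s2 s3"
      define z where "z = ivar s3 ''z''"
      have s3: "indexed s3" "ivar s3 ''p'' = k" "holds_W s3 (partial_W k 0)"
        using fr s2 by (simp_all add: frame_def indexed_def loaded_def closest_body_def holds_W_def)
      have z: "closest k (Suc n) z" using z by (simp add: z_def)
      \<comment> \<open>Some element lies in another part, so the scan cannot end with the sentinel
        0.\<close>
      obtain y where "y \<in> {1..<Suc n}" "Pt y \<noteq> Pt k" using others_nonempty[of k]
        by (auto simp: others_def less_Suc_eq_le)
      then have "z \<noteq> 0" using z unfolding closest_def by metis
      then have zk: "z \<in> others k" and max: "\<forall>q\<in>{1..<Suc n}. Pt q \<noteq> Pt k \<longrightarrow> W k q \<le> W k z"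
        using z unfolding closest_def by simp_all
      have zm: "W k y \<le> W k z" if "y \<in> others k" for y
        using max that by (simp add: others_def)
      show "runs I (For ''q'' (IConst 1) (next_index (IVar ''n'')) same_body) s3 (28 + n * 120)
        (\<lambda>s'. holds_W (s'\<lparr>ivar := (ivar s')(''p'' := Suc k)\<rparr>) (partial_W (Suc k) 0))"
      proof (rule runs_For[where a = 1 and b = "Suc n" and Tb = 90 and Inv = "\<lambda>l s. holds_W s (partial_W k l)"])
        fix l s4
        assume l: "1 \<le> l" "l < Suc n" and inv: "holds_W s4 (partial_W k l)" and ls: "ivar s4 ''q'' = l"
          and fr: "frame (For ''q'' (IConst 1) (next_index (IVar ''n'')) same_body) s3 s4"
        have "indexed s4" "ivar s4 ''p'' = k" "ivar s4 ''z'' = z"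
          using fr s3 by (simp_all add: frame_def indexed_def loaded_def same_body_def z_def)
        then have "runs I same_body s4 90 (\<lambda>s'. holds_W s' (partial_W k (Suc l)))"
          using k l inv ls by (intro runs_same_body[OF _ _ _ _ _ _ _ zk zm]) simp_all
        then show "runs I same_body s4 90 (\<lambda>s'. holds_W (s'\<lparr>ivar := (ivar s')(''q'' := Suc l)\<rparr>) (partial_W k (Suc l)))"
          by (simp add: holds_W_def)
      next
        fix s' assume "holds_W s' (partial_W k (Suc n))"
        moreover have "partial_W k (Suc n) p q = partial_W (Suc k) 0 p q" if "q \<in> {1..n}" for p q
          using that by (auto simp: partial_W_def less_Suc_eq)
        ultimately show "holds_W (s'\<lparr>ivar := (ivar s')(''p'' := Suc k)\<rparr>) (partial_W (Suc k) 0)"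
          by (simp add: holds_W_def)
      next
        have "partial_W k 1 p q = partial_W k 0 p q" if "q \<in> {1..n}" for p q
          using that by (auto simp: partial_W_def)
        then show "holds_W (s3\<lparr>ivar := (ivar s3)(''q'' := 1)\<rparr>) (partial_W k 1)"
          using s3(3) by (simp add: holds_W_def)
      qed (use s3 in \<open>simp_all add: frame_def indexed_def loaded_def same_body_def\<close>)
    qed simp
  qed simp
next
  fix s' assume "holds_W s' (partial_W (Suc n) 0)"
  moreover have "partial_W (Suc n) 0 p q = W p q" if "p \<in> {1..n}" for p q
    using that by (auto simp: partial_W_def)
  ultimately show "holds_W s' W" by (simp add: holds_W_def)
qed (use s in \<open>simp_all add: frame_def indexed_def loaded_def same_row_def closest_body_def same_body_def\<close>)

lemma runs_choose:
  assumes s: "loaded s"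
  shows "runs I choose_prog s (20 + n * 30) (\<lambda>s'. transversal (iarr s' ''S''))"
  unfolding choose_prog_def
proof (rule runs_For[where a = 1 and b = "Suc n" and Tb = 10 and
    Inv = "\<lambda>k s. \<forall>p\<in>{1..<k}. iarr s ''S'' (Pt p) \<in> {1..<k} \<and> Pt (iarr s ''S'' (Pt p)) = Pt p"])
  fix k s1
  assume k: "1 \<le> k" "k < Suc n" and ks: "ivar s1 ''p'' = k"
    and inv: "\<forall>p\<in>{1..<k}. iarr s1 ''S'' (Pt p) \<in> {1..<k} \<and> Pt (iarr s1 ''S'' (Pt p)) = Pt p"
    and fr: "frame (For ''p'' (IConst 1) (next_index (IVar ''n'')) (IStore ''S'' (Part (IVar ''p'')) (IVar ''p''))) s s1"
  have P: "iarr s1 ''P'' = Pt" using fr s by (simp add: frame_def loaded_def)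
  have "\<forall>p\<in>{1..<Suc k}. ((iarr s1 ''S'')(Pt k := k)) (Pt p) \<in> {1..<Suc k} \<and> Pt (((iarr s1 ''S'')(Pt k := k)) (Pt p)) = Pt p"
    using inv k by (auto simp: less_Suc_eq)
  then show "runs I (IStore ''S'' (Part (IVar ''p'')) (IVar ''p'')) s1 10
    (\<lambda>s'. \<forall>p\<in>{1..<Suc k}. iarr (s'\<lparr>ivar := (ivar s')(''p'' := Suc k)\<rparr>) ''S'' (Pt p) \<in> {1..<Suc k} \<and>
       Pt (iarr (s'\<lparr>ivar := (ivar s')(''p'' := Suc k)\<rparr>) ''S'' (Pt p)) = Pt p)"
    by (intro runs_wp) (simp_all add: P ks)
next
  fix s' assume inv: "\<forall>p\<in>{1..<Suc n}. iarr s' ''S'' (Pt p) \<in> {1..<Suc n} \<and> Pt (iarr s' ''S'' (Pt p)) = Pt p"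
  show "transversal (iarr s' ''S'')" unfolding transversal_def
  proof
    fix j assume "j \<in> {1..r}"
    then obtain p where "p \<in> {1..n}" "Pt p = j" using two_values by blast
    then show "iarr s' ''S'' j \<in> {1..n} \<and> Pt (iarr s' ''S'' j) = j" using inv by fastforce
  qed
qed (use s in \<open>auto simp: frame_def loaded_def\<close>)

end

section \<open>Gradient and arc weights\<close>

definition sum_body :: com where
  "sum_body = VAssign ''t'' (VAdd (VVar ''t'') (VArr ''W'' (cell (IVar ''p'') (Sel (IVar ''k'')))))"

definition sum_row :: com where
  "sum_row =
    VAssign ''t'' (UnTable (Part (IVar ''p'')) (Val (IVar ''p''))) ;;
    For ''k'' (IConst 1) (next_index NumVars) sum_body ;;
    VStore ''H'' (IVar ''p'') (VVar ''t'')"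

definition sum_prog :: com where
  "sum_prog = For ''p'' (IConst 1) (next_index (IVar ''n'')) sum_row"

definition clear_prog :: com where
  "clear_prog = For ''j'' (IConst 1) (next_index NumVars)
    (For ''l'' (IConst 1) (next_index NumVars)
      (VStore ''c'' (cell (IVar ''j'') (IVar ''l'')) VInf))"

definition arc_body :: com where
  "arc_body =
    VAssign ''t'' (VSub (VSub (VArr ''H'' (IVar ''p'')) (VArr ''W'' (cell (IVar ''p'') (Sel (IVar ''l'')))))
      (VArr ''H'' (Sel (IVar ''l'')))) ;;
    If (VLess (VVar ''t'') (VArr ''c'' (cell (Part (IVar ''p'')) (IVar ''l''))))
      (VStore ''c'' (cell (Part (IVar ''p'')) (IVar ''l'')) (VVar ''t'') ;;
       IStore ''g'' (cell (Part (IVar ''p'')) (IVar ''l'')) (IVar ''p'')) Skip"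

definition arc_row :: com where
  "arc_row = If (ieq (IVar ''p'') (Sel (Part (IVar ''p'')))) Skip
    (For ''l'' (IConst 1) (next_index NumVars) arc_body)"

definition arc_prog :: com where
  "arc_prog = For ''p'' (IConst 1) (next_index (IVar ''n'')) arc_row"

text \<open>Shared by the searches for arc weights and for walk distances. Over the empty set the
  value is infinite and the witness \<open>g\<close> is free, which matches initialization by
  \<open>VInf\<close>.\<close>

definition run_min :: "ereal \<Rightarrow> 'a \<Rightarrow> 'a set \<Rightarrow> ('a \<Rightarrow> real) \<Rightarrow> bool" where
  "run_min v g X f \<longleftrightarrow> (\<forall>p\<in>X. v \<le> ereal (f p)) \<and> (if X = {} then v = \<infinity> else g \<in> X \<and> v = ereal (f g))"

lemma run_min_empty [simp]: "run_min v g {} f \<longleftrightarrow> v = \<infinity>"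
  by (simp add: run_min_def)

lemma run_min_less:
  "run_min v g X f \<Longrightarrow> ereal (f p) < v \<Longrightarrow> run_min (ereal (f p)) p (insert p X) f"
  unfolding run_min_def by (force dest: less_imp_le order_trans)

lemma run_min_not_less:
  "run_min v g X f \<Longrightarrow> \<not> ereal (f p) < v \<Longrightarrow> run_min v g (insert p X) f"
  unfolding run_min_def by (auto simp: not_less split: if_splits)

lemma run_min_Min:
  assumes "run_min v g X f" "finite X" "X \<noteq> {}"
  shows "v = ereal (Min (f ` X))" "g \<in> X" "f g = Min (f ` X)"
proof -
  have g: "g \<in> X" "v = ereal (f g)" "\<forall>p\<in>X. f g \<le> f p" using assms by (auto simp: run_min_def)
  then show "f g = Min (f ` X)" using assms(2) by (intro Min_eqI[symmetric]) auto
  then show "v = ereal (Min (f ` X))" "g \<in> X" using g by auto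
qed

context flat_instance
begin

lemma r_le_n: "r \<le> n"
proof -
  have "card ((\<lambda>p. (Pt p, Vl p)) ` {1..n}) = n"
    using bij_betw_imp_inj_on[OF flat] by (simp add: card_image)
  then have "n = total_size I"
    using bij_betw_imp_surj_on[OF flat] by (simp add: total_size_def)
  then show ?thesis using nvars_le_total[OF wf] by simp
qed

definition ready :: "state \<Rightarrow> bool" where
  "ready s \<longleftrightarrow> indexed s \<and> holds_W s W"

definition swap_sums :: "(nat \<Rightarrow> nat) \<Rightarrow> state \<Rightarrow> bool" where
  "swap_sums S s \<longleftrightarrow> (\<forall>p\<in>{1..n}. varr s ''H'' p = ereal (H S p))"

lemma runs_sum:
  assumes s: "ready s" and S: "transversal S" "iarr s ''S'' = S"
  shows "runs I sum_prog s (20 + n * (60 + r * 40)) (swap_sums S)"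
  unfolding sum_prog_def
proof (rule runs_For[where a = 1 and b = "Suc n" and Tb = "40 + r * 40" and
    Inv = "\<lambda>k s. \<forall>p\<in>{1..<k}. varr s ''H'' p = ereal (H S p)"])
  fix p s1
  assume p: "1 \<le> p" "p < Suc n" and inv: "\<forall>p\<in>{1..<p}. varr s1 ''H'' p = ereal (H S p)" and ps: "ivar s1 ''p'' = p"
    and fr: "frame (For ''p'' (IConst 1) (next_index (IVar ''n'')) sum_row) s s1"
  have s1: "ready s1" "iarr s1 ''S'' = S"
    using fr s S by (simp_all add: frame_def ready_def indexed_def holds_W_def loaded_def sum_row_def sum_body_def)
  show "runs I sum_row s1 (40 + r * 40)
    (\<lambda>s'. \<forall>q\<in>{1..<Suc p}. varr (s'\<lparr>ivar := (ivar s')(''p'' := Suc p)\<rparr>) ''H'' q = ereal (H S q))"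
    unfolding sum_row_def
  proof (rule runs_Seq)
    show "runs I (VAssign ''t'' (UnTable (Part (IVar ''p'')) (Val (IVar ''p'')))) s1 10 (\<lambda>s. vvar s ''t'' = ereal (un p))"
      using p s1 ps Pt_range[of p] by (intro runs_wp) (simp_all add: ready_def indexed_def loaded_def un_def)
    fix s2 assume t: "vvar s2 ''t'' = ereal (un p)"
      and fr: "frame (VAssign ''t'' (UnTable (Part (IVar ''p'')) (Val (IVar ''p'')))) s1 s2"
    have s2: "ready s2" "iarr s2 ''S'' = S" "ivar s2 ''p'' = p" "varr s2 ''H'' = varr s1 ''H''"
      using fr s1 ps by (simp_all add: frame_def ready_def indexed_def holds_W_def loaded_def)
    show "runs I (For ''k'' (IConst 1) (next_index NumVars) sum_body ;; VStore ''H'' (IVar ''p'') (VVar ''t'')) s2 (30 + r * 40)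
      (\<lambda>s'. \<forall>q\<in>{1..<Suc p}. varr (s'\<lparr>ivar := (ivar s')(''p'' := Suc p)\<rparr>) ''H'' q = ereal (H S q))"
    proof (rule runs_Seq)
      show "runs I (For ''k'' (IConst 1) (next_index NumVars) sum_body) s2 (20 + r * 40) (\<lambda>s. vvar s ''t'' = ereal (H S p))"
      proof (rule runs_For[where a = 1 and b = "Suc r" and Tb = 20 and
          Inv = "\<lambda>k s. vvar s ''t'' = ereal (un p + (\<Sum>k\<in>{1..<k}. W p (S k)))"])
        fix k s3
        assume k: "1 \<le> k" "k < Suc r" and inv: "vvar s3 ''t'' = ereal (un p + (\<Sum>k\<in>{1..<k}. W p (S k)))"
          and ks: "ivar s3 ''k'' = k" and fr: "frame (For ''k'' (IConst 1) (next_index NumVars) sum_body) s2 s3"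
        have "ready s3" "iarr s3 ''S'' = S" "ivar s3 ''p'' = p"
          using fr s2 by (simp_all add: frame_def ready_def indexed_def holds_W_def loaded_def sum_body_def)
        moreover have "S k \<in> {1..n}" using S k by (simp add: transversal_def)
        ultimately show "runs I sum_body s3 20 (\<lambda>s'. vvar (s'\<lparr>ivar := (ivar s')(''k'' := Suc k)\<rparr>) ''t'' =
            ereal (un p + (\<Sum>k\<in>{1..<Suc k}. W p (S k))))"
          using p k inv ks
          by (intro runs_wp) (simp_all add: sum_body_def ready_def indexed_def holds_W_def loaded_def sum_Suc add.assoc del: sum.op_ivl_Suc)
      next
        fix s' assume "vvar s' ''t'' = ereal (un p + (\<Sum>k\<in>{1..<Suc r}. W p (S k)))"
        then show "vvar s' ''t'' = ereal (H S p)" by (simp add: H_def atLeastLessThanSuc_atLeastAtMost del: sum.op_ivl_Suc)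
      qed (use t in \<open>simp_all add: sum_body_def\<close>)
      fix s3 assume t: "vvar s3 ''t'' = ereal (H S p)" and fr: "frame (For ''k'' (IConst 1) (next_index NumVars) sum_body) s2 s3"
      have "ivar s3 ''p'' = p" "varr s3 ''H'' = varr s1 ''H''" using fr s2 by (simp_all add: frame_def sum_body_def)
      moreover have "varr s1 ''H'' q = ereal (H S q)" if "q \<in> {1..<Suc p}" "q \<noteq> p" for q
        using inv that by (simp add: less_Suc_eq)
      ultimately show "runs I (VStore ''H'' (IVar ''p'') (VVar ''t'')) s3 5
        (\<lambda>s'. \<forall>q\<in>{1..<Suc p}. varr (s'\<lparr>ivar := (ivar s')(''p'' := Suc p)\<rparr>) ''H'' q = ereal (H S q))"
        using t by (intro runs_wp) simp_all
    qed simp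
  qed simp
next
  fix s' :: state assume "\<forall>p\<in>{1..<Suc n}. varr s' ''H'' p = ereal (H S p)"
  then show "swap_sums S s'" by (simp add: swap_sums_def atLeastLessThanSuc_atLeastAtMost)
qed (use s in \<open>simp_all add: frame_def ready_def indexed_def loaded_def sum_row_def sum_body_def add_mult_distrib2\<close>)

text \<open>The nested loops stand at element \<open>k\<close> and target \<open>m\<close>. Each
  element updates the arcs leaving its own part, one per target, so all arcs take time
  \<open>n r\<close>. Positions \<open>(1, 1)\<close> and \<open>(Suc n, 1)\<close> stand for no
  candidates and for all of them.\<close>

definition processed :: "(nat \<Rightarrow> nat) \<Rightarrow> nat \<Rightarrow> nat \<Rightarrow> nat \<Rightarrow> nat \<Rightarrow> nat set" where
  "processed S k m j l = {p \<in> cand S j. p < k \<or> p = k \<and> l < m}"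

definition arcs_upto :: "(nat \<Rightarrow> nat) \<Rightarrow> nat \<Rightarrow> nat \<Rightarrow> state \<Rightarrow> bool" where
  "arcs_upto S k m s \<longleftrightarrow> (\<forall>j\<in>{1..r}. \<forall>l\<in>{1..r}.
     run_min (varr s ''c'' (idx j l)) (iarr s ''g'' (idx j l)) (processed S k m j l) (\<lambda>p. swap_cost S p l))"

lemma arcs_upto_ivar [simp]: "arcs_upto S k m (s\<lparr>ivar := f\<rparr>) = arcs_upto S k m s"
  by (simp add: arcs_upto_def)

lemma runs_clear:
  assumes s: "indexed s"
  shows "runs I clear_prog s (20 + r * (40 + r * 30)) (arcs_upto S 1 1)"
  unfolding clear_prog_def
proof (rule runs_For[where a = 1 and b = "Suc r" and Tb = "20 + r * 30" and
    Inv = "\<lambda>k s. \<forall>j\<in>{1..<k}. \<forall>l\<in>{1..r}. varr s ''c'' (idx j l) = \<infinity>"])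
  let ?body = "VStore ''c'' (cell (IVar ''j'') (IVar ''l'')) VInf"
  fix k s1
  assume k: "1 \<le> k" "k < Suc r" and inv: "\<forall>j\<in>{1..<k}. \<forall>l\<in>{1..r}. varr s1 ''c'' (idx j l) = \<infinity>"
    and ks: "ivar s1 ''j'' = k"
    and fr: "frame (For ''j'' (IConst 1) (next_index NumVars) (For ''l'' (IConst 1) (next_index NumVars) ?body)) s s1"
  have s1: "indexed s1" using fr s by (simp add: frame_def indexed_def loaded_def)
  show "runs I (For ''l'' (IConst 1) (next_index NumVars) ?body) s1 (20 + r * 30)
    (\<lambda>s'. \<forall>j\<in>{1..<Suc k}. \<forall>l\<in>{1..r}. varr (s'\<lparr>ivar := (ivar s')(''j'' := Suc k)\<rparr>) ''c'' (idx j l) = \<infinity>)"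
  proof (rule runs_For[where a = 1 and b = "Suc r" and Tb = 10 and
    Inv = "\<lambda>l s. \<forall>j\<in>{1..<Suc k}. \<forall>l'\<in>{1..r}. j < k \<or> l' < l \<longrightarrow> varr s ''c'' (idx j l') = \<infinity>"])
    fix l s2
    assume l: "1 \<le> l" "l < Suc r"
      and inv: "\<forall>j\<in>{1..<Suc k}. \<forall>l'\<in>{1..r}. j < k \<or> l' < l \<longrightarrow> varr s2 ''c'' (idx j l') = \<infinity>"
      and ls: "ivar s2 ''l'' = l" and fr: "frame (For ''l'' (IConst 1) (next_index NumVars) ?body) s1 s2"
    have s2: "indexed s2" "ivar s2 ''j'' = k" using fr s1 ks by (simp_all add: frame_def indexed_def loaded_def)
    have *: "((varr s2 ''c'')(idx k l := \<infinity>)) (idx j l') = \<infinity>"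
      if "j \<in> {1..<Suc k}" "l' \<in> {1..r}" "j < k \<or> l' < Suc l" for j l'
    proof (cases "j = k \<and> l' = l")
      case False
      then have "j < k \<or> l' < l" using that by auto
      then show ?thesis using inv[rule_format, OF that(1,2)] by simp
    qed simp
    show "runs I ?body s2 10 (\<lambda>s'. \<forall>j\<in>{1..<Suc k}. \<forall>l'\<in>{1..r}. j < k \<or> l' < Suc l \<longrightarrow>
        varr (s'\<lparr>ivar := (ivar s')(''l'' := Suc l)\<rparr>) ''c'' (idx j l') = \<infinity>)"
      using * s2 ls k r_le_n
      by (intro runs_wp) (simp_all add: indexed_def loaded_def del: fun_upd_apply add: fun_upd_same fun_upd_other)
  next
    show "\<forall>j\<in>{1..<Suc k}. \<forall>l'\<in>{1..r}. j < k \<or> l' < 1 \<longrightarrow> varr (s1\<lparr>ivar := (ivar s1)(''l'' := 1)\<rparr>) ''c'' (idx j l') = \<infinity>"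
      using inv by auto
  next
    fix s' assume "\<forall>j\<in>{1..<Suc k}. \<forall>l'\<in>{1..r}. j < k \<or> l' < Suc r \<longrightarrow> varr s' ''c'' (idx j l') = \<infinity>"
    then show "\<forall>j\<in>{1..<Suc k}. \<forall>l\<in>{1..r}. varr (s'\<lparr>ivar := (ivar s')(''j'' := Suc k)\<rparr>) ''c'' (idx j l) = \<infinity>" by auto
  qed simp_all
next
  fix s' :: state assume "\<forall>j\<in>{1..<Suc r}. \<forall>l\<in>{1..r}. varr s' ''c'' (idx j l) = \<infinity>"
  moreover have "processed S 1 1 j l = {}" if "l \<in> {1..r}" for j l
    using that by (auto simp: processed_def cand_def)
  ultimately show "arcs_upto S 1 1 s'" by (simp add: arcs_upto_def atLeastLessThanSuc_atLeastAtMost)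
qed (simp_all add: algebra_simps)

lemma runs_arc_body:
  assumes s: "ready s" "swap_sums S s" "iarr s ''S'' = S" and S: "transversal S"
    and p: "ivar s ''p'' = p" "p \<in> {1..n}" "p \<noteq> S (Pt p)" and l: "ivar s ''l'' = l" "l \<in> {1..r}"
    and inv: "arcs_upto S p l s"
  shows "runs I arc_body s 70 (arcs_upto S p (Suc l))"
proof (intro runs_wp)
  have Sl: "S l \<in> {1..n}" using S l by (simp add: transversal_def)
  have Pp: "Pt p \<in> {1..r}" "Pt p \<le> n" using flat_mem[OF p(2)] r_le_n by auto
  have cost: "varr s ''H'' p - varr s ''W'' (idx p (S l)) - varr s ''H'' (S l) = ereal (swap_cost S p l)"
    using s p(2) Sl by (simp add: swap_sums_def ready_def holds_W_def swap_cost_def)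
  \<comment> \<open>\<open>VSub\<close> is undefined for an infinite subtrahend; without capping the
    program could get stuck here.\<close>
  have fin: "varr s ''W'' (idx p (S l)) \<noteq> \<infinity>" "varr s ''H'' (S l) \<noteq> \<infinity>"
    using s p(2) Sl by (simp_all add: swap_sums_def ready_def holds_W_def)
  have new: "processed S p (Suc l) (Pt p) l = insert p (processed S p l (Pt p) l)"
    using p by (auto simp: processed_def cand_def)
  have old: "processed S p (Suc l) j l' = processed S p l j l'" if "j \<noteq> Pt p \<or> l' \<noteq> l" for j l'
    using that by (auto simp: processed_def cand_def less_Suc_eq)
  have min: "run_min (varr s ''c'' (idx j l')) (iarr s ''g'' (idx j l')) (processed S p l j l') (\<lambda>p. swap_cost S p l')"
    if "j \<in> {1..r}" "l' \<in> {1..r}" for j l' using inv that by (simp add: arcs_upto_def)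
  have up: "arcs_upto S p (Suc l) s'"
    if v: "varr s' ''c'' = (varr s ''c'')(idx (Pt p) l := v)" and g: "iarr s' ''g'' = (iarr s ''g'')(idx (Pt p) l := x)"
      and m: "run_min v x (insert p (processed S p l (Pt p) l)) (\<lambda>p. swap_cost S p l)" for s' v x
    unfolding arcs_upto_def
  proof (intro ballI)
    fix j l' assume jl: "j \<in> {1..r}" "l' \<in> {1..r}"
    show "run_min (varr s' ''c'' (idx j l')) (iarr s' ''g'' (idx j l')) (processed S p (Suc l) j l') (\<lambda>p. swap_cost S p l')"
    proof (cases "j = Pt p \<and> l' = l")
      case True
      then show ?thesis using m new by (simp add: v g)
    next
      case False
      then have "idx j l' \<noteq> idx (Pt p) l" using jl l(2) r_le_n by (simp add: idx_inj)
      then show ?thesis using min[OF jl] old False by (simp add: v g)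
    qed
  qed
  show "wp I arc_body s (arcs_upto S p (Suc l))"
  proof (cases "ereal (swap_cost S p l) < varr s ''c'' (idx (Pt p) l)")
    case True
    have "arcs_upto S p (Suc l) s'"
      if "varr s' ''c'' = (varr s ''c'')(idx (Pt p) l := ereal (swap_cost S p l))"
        "iarr s' ''g'' = (iarr s ''g'')(idx (Pt p) l := p)" for s'
      by (rule up[OF that run_min_less[OF min[OF Pp(1) l(2)] True]])
    then show ?thesis using s(1,3) p l Sl Pp True cost fin
      by (simp add: arc_body_def ready_def indexed_def loaded_def)
  next
    case False
    have "arcs_upto S p (Suc l) s'"
      if "varr s' ''c'' = varr s ''c''" "iarr s' ''g'' = iarr s ''g''" for s'
      by (rule up[OF _ _ run_min_not_less[OF min[OF Pp(1) l(2)] False]]) (simp_all add: that)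
    then show ?thesis using s(1,3) p l Sl Pp False cost fin
      by (simp add: arc_body_def ready_def indexed_def loaded_def)
  qed
qed (simp add: arc_body_def)

definition arcs :: "(nat \<Rightarrow> nat) \<Rightarrow> state \<Rightarrow> bool" where
  "arcs S s \<longleftrightarrow> realizes_arcs S (\<lambda>j l. iarr s ''g'' (idx j l)) \<and>
     (\<forall>j\<in>{1..r}. \<forall>l\<in>{1..r}. varr s ''c'' (idx j l) = ereal (arc S j l))"

lemma arcs_upto_all: "arcs_upto S (Suc n) 1 s \<Longrightarrow> arcs S s"
proof -
  assume a: "arcs_upto S (Suc n) 1 s"
  have "processed S (Suc n) 1 j l = cand S j" for j l by (auto simp: processed_def cand_def)
  then have "run_min (varr s ''c'' (idx j l)) (iarr s ''g'' (idx j l)) (cand S j) (\<lambda>p. swap_cost S p l)"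
    if "j \<in> {1..r}" "l \<in> {1..r}" for j l using a that by (simp add: arcs_upto_def)
  from run_min_Min[OF this finite_cand cand_nonempty] show ?thesis
    unfolding arcs_def realizes_arcs_def arc_def by simp
qed

lemma runs_arc:
  assumes s: "ready s" "swap_sums S s" "iarr s ''S'' = S" and S: "transversal S" and inv0: "arcs_upto S 1 1 s"
  shows "runs I arc_prog s (20 + n * (70 + r * 90)) (arcs S)"
  unfolding arc_prog_def
proof (rule runs_For[where a = 1 and b = "Suc n" and Tb = "40 + r * 90" and Inv = "\<lambda>k. arcs_upto S k 1"])
  fix p s1
  assume p: "1 \<le> p" "p < Suc n" and inv: "arcs_upto S p 1 s1" and ps: "ivar s1 ''p'' = p"
    and fr: "frame (For ''p'' (IConst 1) (next_index (IVar ''n'')) arc_row) s s1"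
  have s1: "ready s1" "swap_sums S s1" "iarr s1 ''S'' = S"
    using fr s by (simp_all add: frame_def ready_def indexed_def holds_W_def loaded_def swap_sums_def arc_row_def arc_body_def)
  have Pp: "Pt p \<in> {1..r}" "Pt p \<le> n" using flat_mem[of p] r_le_n p by auto
  show "runs I arc_row s1 (40 + r * 90) (\<lambda>s'. arcs_upto S (Suc p) 1 (s'\<lparr>ivar := (ivar s')(''p'' := Suc p)\<rparr>))"
    unfolding arc_row_def
  proof (rule runs_If)
    show "beval I s1 (ieq (IVar ''p'') (Sel (Part (IVar ''p'')))) = Some (p = S (Pt p))"
      using s1 ps by (auto simp: ready_def indexed_def loaded_def)
  next
    assume eq: "p = S (Pt p)"
    have "processed S (Suc p) 1 j l = processed S p 1 j l" if "l \<in> {1..r}" for j l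
    proof -
      have "p \<notin> cand S j" using eq by (auto simp: cand_def)
      then have "x \<in> cand S j \<Longrightarrow> x \<noteq> p" for x by blast
      then show ?thesis using that by (auto simp: processed_def less_Suc_eq)
    qed
    then have "arcs_upto S (Suc p) 1 (s1\<lparr>ivar := (ivar s1)(''p'' := Suc p)\<rparr>)"
      using inv by (simp add: arcs_upto_def)
    then show "runs I Skip s1 (22 + r * 90) (\<lambda>s'. arcs_upto S (Suc p) 1 (s'\<lparr>ivar := (ivar s')(''p'' := Suc p)\<rparr>))"
      by (intro runs_wp) simp_all
  next
    assume ne: "p \<noteq> S (Pt p)"
    show "runs I (For ''l'' (IConst 1) (next_index NumVars) arc_body) s1 (22 + r * 90)
      (\<lambda>s'. arcs_upto S (Suc p) 1 (s'\<lparr>ivar := (ivar s')(''p'' := Suc p)\<rparr>))"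
    proof (rule runs_For[where a = 1 and b = "Suc r" and Tb = 70 and Inv = "\<lambda>l. arcs_upto S p l"])
      fix l s2
      assume l: "1 \<le> l" "l < Suc r" and inv: "arcs_upto S p l s2" and ls: "ivar s2 ''l'' = l"
        and fr: "frame (For ''l'' (IConst 1) (next_index NumVars) arc_body) s1 s2"
      have s2: "ready s2" "swap_sums S s2" "iarr s2 ''S'' = S" "ivar s2 ''p'' = p"
        using fr s1 ps by (simp_all add: frame_def ready_def indexed_def holds_W_def loaded_def swap_sums_def arc_body_def)
      have "runs I arc_body s2 70 (arcs_upto S p (Suc l))"
        using p l by (intro runs_arc_body[OF s2(1-3) S s2(4) _ ne ls _ inv]) simp_all
      then show "runs I arc_body s2 70 (\<lambda>s'. arcs_upto S p (Suc l) (s'\<lparr>ivar := (ivar s')(''l'' := Suc l)\<rparr>))"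
        by simp
    next
      fix s' assume "arcs_upto S p (Suc r) s'"
      moreover have "processed S p (Suc r) j l = processed S (Suc p) 1 j l" if "l \<in> {1..r}" for j l
        using that by (auto simp: processed_def less_Suc_eq)
      ultimately show "arcs_upto S (Suc p) 1 (s'\<lparr>ivar := (ivar s')(''p'' := Suc p)\<rparr>)"
        by (simp add: arcs_upto_def)
    qed (use inv in \<open>simp_all add: arc_body_def\<close>)
  qed simp
qed (use s inv0 arcs_upto_all in \<open>simp_all add: frame_def ready_def indexed_def loaded_def arcs_upto_def arc_row_def arc_body_def add_mult_distrib2\<close>)

end

section \<open>Walk distances, choice of the walk, augmentation\<close>

definition dist_init :: com where
  "dist_init = For ''j'' (IConst 1) (next_index (IVar ''i''))
    (VStore ''D'' (cell (IConst 0) (IVar ''j'')) (VArr ''c'' (cell (IVar ''i'') (IVar ''j''))))"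

abbreviation step_exp :: vexp where
  "step_exp \<equiv> VAdd (VArr ''D'' (cell (ISub (IVar ''m'') (IConst 1)) (IVar ''l'')))
     (VArr ''c'' (cell (IVar ''l'') (IVar ''j'')))"

definition dist_body :: com where
  "dist_body = If (VLess step_exp (VVar ''t''))
     (VAssign ''t'' step_exp ;; IStore ''e'' (cell (IVar ''m'') (IVar ''j'')) (IVar ''l'')) Skip"

definition dist_cell :: com where
  "dist_cell =
    VAssign ''t'' VInf ;;
    For ''l'' (IConst 1) (IVar ''i'') dist_body ;;
    VStore ''D'' (cell (IVar ''m'') (IVar ''j'')) (VVar ''t'')"

text \<open>Bellman-Ford rounds by exact number of intermediate nodes. All rows are kept: the first
  row attaining the minimum and the predecessors along the whole walk are wanted later.\<close>

definition dist_prog :: com where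
  "dist_prog = dist_init ;;
    For ''m'' (IConst 1) (IVar ''i'') (For ''j'' (IConst 1) (next_index (IVar ''i'')) dist_cell)"

definition best_body :: com where
  "best_body = If (VLess (VArr ''D'' (cell (IVar ''m'') (IVar ''i''))) (VVar ''t''))
     (VAssign ''t'' (VArr ''D'' (cell (IVar ''m'') (IVar ''i''))) ;; IAssign ''b'' (IVar ''m'')) Skip"

text \<open>Starting from 0 under a strict comparison settles two points: \<open>b\<close> stays at
  \<open>i\<close> unless some closed walk has negative cost, and among the cheapest ones it ends at
  the fewest intermediate nodes.\<close>

definition best_prog :: com where
  "best_prog = VAssign ''t'' VZero ;; IAssign ''b'' (IVar ''i'') ;; For ''m'' (IConst 0) (IVar ''i'') best_body"

text \<open>The walk is traced from its end. The elements in \<open>g\<close> were recorded for the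
  old \<open>S\<close> and are not recomputed, so \<open>S\<close> may be overwritten on the
  way.\<close>

definition apply_body :: com where
  "apply_body =
    IAssign ''l'' (IArr ''e'' (cell (ISub (IVar ''b'') (IVar ''m'')) (IVar ''u''))) ;;
    IStore ''S'' (IVar ''l'') (IArr ''g'' (cell (IVar ''l'') (IVar ''u''))) ;;
    IAssign ''u'' (IVar ''l'')"

definition apply_prog :: com where
  "apply_prog = If (ILess (IVar ''b'') (IVar ''i''))
    (IAssign ''u'' (IVar ''i'') ;;
     For ''m'' (IConst 0) (IVar ''b'') apply_body ;;
     IStore ''S'' (IVar ''i'') (IArr ''g'' (cell (IVar ''i'') (IVar ''u'')))) Skip"

definition phase_prog :: com where
  "phase_prog = sum_prog ;; clear_prog ;; arc_prog ;; dist_prog ;; best_prog ;; apply_prog"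

context flat_instance
begin

text \<open>Row 0 consists of single arcs out of \<open>Suc h\<close>; it records no
  predecessors.\<close>

definition row_ok :: "(nat \<Rightarrow> nat) \<Rightarrow> nat \<Rightarrow> state \<Rightarrow> nat \<Rightarrow> nat \<Rightarrow> bool" where
  "row_ok S h s k a \<longleftrightarrow> (\<forall>j\<in>{1..<a}. varr s ''D'' (idx k j) = ereal (walk_dist S h k j) \<and>
     (k \<noteq> 0 \<longrightarrow> iarr s ''e'' (idx k j) \<in> {1..h} \<and>
       walk_dist S h (k - 1) (iarr s ''e'' (idx k j)) + arc S (iarr s ''e'' (idx k j)) j = walk_dist S h k j))"

lemma row_ok_upd [simp]: "row_ok S h (s\<lparr>ivar := f\<rparr>) k a = row_ok S h s k a"
  by (simp add: row_ok_def)

lemma row_ok_cong: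
  assumes "\<And>j. j \<in> {1..<a} \<Longrightarrow> varr s' ''D'' (idx k j) = varr s ''D'' (idx k j)"
    and "\<And>j. j \<in> {1..<a} \<Longrightarrow> iarr s' ''e'' (idx k j) = iarr s ''e'' (idx k j)"
    and "row_ok S h s k a"
  shows "row_ok S h s' k a"
  using assms by (simp add: row_ok_def)

lemma idx_Suc: "idx p (Suc q) = Suc (idx p q)"
  by (simp add: idx_def)

lemma runs_dist_init:
  assumes s: "indexed s" "arcs S s" and h: "ivar s ''i'' = Suc h" "Suc h \<le> r"
  shows "runs I dist_init s (20 + r * 30) (\<lambda>s'. row_ok S h s' 0 (Suc (Suc h)))"
  unfolding dist_init_def
proof (rule runs_For[where a = 1 and b = "Suc (Suc h)" and Tb = 15 and Inv = "\<lambda>j s. row_ok S h s 0 j"])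
  let ?body = "VStore ''D'' (cell (IConst 0) (IVar ''j'')) (VArr ''c'' (cell (IVar ''i'') (IVar ''j'')))"
  fix j s1
  assume j: "1 \<le> j" "j < Suc (Suc h)" and inv: "row_ok S h s1 0 j" and js: "ivar s1 ''j'' = j"
    and fr: "frame (For ''j'' (IConst 1) (next_index (IVar ''i'')) ?body) s s1"
  have s1: "indexed s1" "ivar s1 ''i'' = Suc h" "varr s1 ''c'' = varr s ''c''"
    using fr s h by (simp_all add: frame_def indexed_def loaded_def)
  have c: "varr s1 ''c'' (idx (Suc h) j) = ereal (arc S (Suc h) j)"
    using s(2) h(2) j s1(3) by (simp add: arcs_def)
  have "row_ok S h s' 0 (Suc j)" if "varr s' ''D'' = (varr s1 ''D'')(idx 0 j := ereal (arc S (Suc h) j))" for s'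
    unfolding row_ok_def
  proof (intro ballI)
    fix j' assume j': "j' \<in> {1..<Suc j}"
    show "varr s' ''D'' (idx 0 j') = ereal (walk_dist S h 0 j') \<and>
     (0 \<noteq> (0::nat) \<longrightarrow> iarr s' ''e'' (idx 0 j') \<in> {1..h} \<and>
       walk_dist S h (0 - 1) (iarr s' ''e'' (idx 0 j')) + arc S (iarr s' ''e'' (idx 0 j')) j' = walk_dist S h 0 j')"
    proof (cases "j' = j")
      case False
      then have "j' \<in> {1..<j}" "j' \<le> n" "j \<le> n" using j' j h(2) r_le_n by auto
      then have "j' \<in> {1..<j}" "idx 0 j' \<noteq> idx 0 j" using False by (simp_all add: idx_inj)
      then show ?thesis using inv by (simp add: row_ok_def that)
    qed (simp add: that)
  qed
  then show "runs I ?body s1 15 (\<lambda>s'. row_ok S h (s'\<lparr>ivar := (ivar s')(''j'' := Suc j)\<rparr>) 0 (Suc j))"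
    using s1 c js h(2) r_le_n by (intro runs_wp) (simp_all add: indexed_def loaded_def)
next
  show "5 + icost (IConst 1) + icost (next_index (IVar ''i'')) +
    (Suc (Suc h) - 1) * (15 + 7 + icost (next_index (IVar ''i''))) \<le> 20 + r * 30"
    using h(2) by simp
qed (use h in \<open>simp_all add: frame_def row_ok_def\<close>)

lemma runs_dist_cell:
  assumes s: "indexed s" "arcs S s" and h: "ivar s ''i'' = Suc h" "Suc h \<le> r"
    and m: "ivar s ''m'' = m" "1 \<le> m" "m < Suc h" and j: "ivar s ''j'' = j" "1 \<le> j" "j < Suc (Suc h)"
    and rows: "\<And>k. k < m \<Longrightarrow> row_ok S h s k (Suc (Suc h))" and row: "row_ok S h s m j"
  shows "runs I dist_cell s (30 + r * 60)
    (\<lambda>s'. (\<forall>k<m. row_ok S h s' k (Suc (Suc h))) \<and> row_ok S h s' m (Suc j))"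
  unfolding dist_cell_def
proof (rule runs_Seq)
  let ?f = "\<lambda>l. walk_dist S h (m - 1) l + arc S l j"
  have n: "h < n" "m \<le> n" "j \<le> n" using h m j r_le_n by auto
  show "runs I (VAssign ''t'' VInf) s 2 (\<lambda>s. vvar s ''t'' = \<infinity>)" by (intro runs_wp) simp_all
  fix s1 assume t: "vvar s1 ''t'' = \<infinity>" and fr: "frame (VAssign ''t'' VInf) s s1"
  have s1: "indexed s1" "ivar s1 ''i'' = Suc h" "ivar s1 ''m'' = m" "ivar s1 ''j'' = j"
    "varr s1 ''D'' = varr s ''D''" "varr s1 ''c'' = varr s ''c''" "iarr s1 ''e'' = iarr s ''e''"
    using fr s h m j by (simp_all add: frame_def indexed_def loaded_def)
  show "runs I (For ''l'' (IConst 1) (IVar ''i'') dist_body ;; VStore ''D'' (cell (IVar ''m'') (IVar ''j'')) (VVar ''t''))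
    s1 (28 + r * 60) (\<lambda>s'. (\<forall>k<m. row_ok S h s' k (Suc (Suc h))) \<and> row_ok S h s' m (Suc j))"
  proof (rule runs_Seq)
    show "runs I (For ''l'' (IConst 1) (IVar ''i'') dist_body) s1 (10 + r * 60)
      (\<lambda>s'. run_min (vvar s' ''t'') (iarr s' ''e'' (idx m j)) {1..h} ?f \<and>
         (\<forall>x. x \<noteq> idx m j \<longrightarrow> iarr s' ''e'' x = iarr s ''e'' x))"
    proof (rule runs_For[where a = 1 and b = "Suc h" and Tb = 50 and
        Inv = "\<lambda>l s'. run_min (vvar s' ''t'') (iarr s' ''e'' (idx m j)) {1..<l} ?f \<and>
         (\<forall>x. x \<noteq> idx m j \<longrightarrow> iarr s' ''e'' x = iarr s ''e'' x)"])
      fix l s2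
      assume l: "1 \<le> l" "l < Suc h"
        and inv: "run_min (vvar s2 ''t'') (iarr s2 ''e'' (idx m j)) {1..<l} ?f \<and>
         (\<forall>x. x \<noteq> idx m j \<longrightarrow> iarr s2 ''e'' x = iarr s ''e'' x)"
        and ls: "ivar s2 ''l'' = l" and fr: "frame (For ''l'' (IConst 1) (IVar ''i'') dist_body) s1 s2"
      have s2: "indexed s2" "ivar s2 ''m'' = m" "ivar s2 ''j'' = j" "varr s2 ''D'' = varr s ''D''" "varr s2 ''c'' = varr s ''c''"
        using fr s1 by (simp_all add: frame_def indexed_def loaded_def dist_body_def)
      have D: "varr s2 ''D'' (idx (m - 1) l) = ereal (walk_dist S h (m - 1) l)"
        using rows[of "m - 1"] m l s2(4) by (simp add: row_ok_def)
      have c: "varr s2 ''c'' (idx l j) = ereal (arc S l j)"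
        using s(2) l j h(2) s2(5) by (simp add: arcs_def)
      have ins: "{1..<Suc l} = insert l {1..<l}" using l by auto
      show "runs I dist_body s2 50 (\<lambda>s'. run_min (vvar (s'\<lparr>ivar := (ivar s')(''l'' := Suc l)\<rparr>) ''t'')
          (iarr (s'\<lparr>ivar := (ivar s')(''l'' := Suc l)\<rparr>) ''e'' (idx m j)) {1..<Suc l} ?f \<and>
         (\<forall>x. x \<noteq> idx m j \<longrightarrow> iarr (s'\<lparr>ivar := (ivar s')(''l'' := Suc l)\<rparr>) ''e'' x = iarr s ''e'' x))"
      proof (intro runs_wp)
        have "m - Suc 0 \<le> n" "l \<le> n" using n l by auto
        then show "wp I dist_body s2 (\<lambda>s'. run_min (vvar (s'\<lparr>ivar := (ivar s')(''l'' := Suc l)\<rparr>) ''t'')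
          (iarr (s'\<lparr>ivar := (ivar s')(''l'' := Suc l)\<rparr>) ''e'' (idx m j)) {1..<Suc l} ?f \<and>
         (\<forall>x. x \<noteq> idx m j \<longrightarrow> iarr (s'\<lparr>ivar := (ivar s')(''l'' := Suc l)\<rparr>) ''e'' x = iarr s ''e'' x))"
          unfolding ins using s2 n ls inv D c
            run_min_less[of "vvar s2 ''t''" "iarr s2 ''e'' (idx m j)" "{1..<l}" ?f l]
            run_min_not_less[of "vvar s2 ''t''" "iarr s2 ''e'' (idx m j)" "{1..<l}" ?f l]
          by (simp add: dist_body_def indexed_def loaded_def)
      qed (simp add: dist_body_def)
    next
      fix s' assume "run_min (vvar s' ''t'') (iarr s' ''e'' (idx m j)) {1..<Suc h} ?f \<and>
         (\<forall>x. x \<noteq> idx m j \<longrightarrow> iarr s' ''e'' x = iarr s ''e'' x)"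
      then show "run_min (vvar s' ''t'') (iarr s' ''e'' (idx m j)) {1..h} ?f \<and>
         (\<forall>x. x \<noteq> idx m j \<longrightarrow> iarr s' ''e'' x = iarr s ''e'' x)"
        by (simp add: atLeastLessThanSuc_atLeastAtMost)
    next
      show "5 + icost (IConst 1) + icost (IVar ''i'') + (Suc h - 1) * (50 + 7 + icost (IVar ''i'')) \<le> 10 + r * 60"
        using h(2) by simp
    qed (use s1 t in \<open>simp_all add: frame_def dist_body_def\<close>)
    fix s2
    assume post: "run_min (vvar s2 ''t'') (iarr s2 ''e'' (idx m j)) {1..h} ?f \<and>
         (\<forall>x. x \<noteq> idx m j \<longrightarrow> iarr s2 ''e'' x = iarr s ''e'' x)"
      and fr: "frame (For ''l'' (IConst 1) (IVar ''i'') dist_body) s1 s2"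
    have s2: "indexed s2" "ivar s2 ''m'' = m" "ivar s2 ''j'' = j" "varr s2 ''D'' = varr s ''D''"
      using fr s1 by (simp_all add: frame_def indexed_def loaded_def dist_body_def)
    obtain m' where m': "m = Suc m'" using m by (cases m) auto
    \<comment> \<open>A round \<open>m\<close> occurs only if \<open>1 \<le> m \<le> h\<close>, so
      the minimum is over a nonempty set.\<close>
    have "{1..h} \<noteq> {}" using m by auto
    from run_min_Min[OF conjunct1[OF post] finite_atLeastAtMost this]
    have t: "vvar s2 ''t'' = ereal (walk_dist S h m j)" and e: "iarr s2 ''e'' (idx m j) \<in> {1..h}"
      and em: "walk_dist S h (m - 1) (iarr s2 ''e'' (idx m j)) + arc S (iarr s2 ''e'' (idx m j)) j = walk_dist S h m j"
      by (simp_all add: m')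
    have keep: "(\<forall>k<m. row_ok S h s' k (Suc (Suc h))) \<and> row_ok S h s' m (Suc j)"
      if D': "varr s' ''D'' = (varr s ''D'')(idx m j := ereal (walk_dist S h m j))" and e': "iarr s' ''e'' = iarr s2 ''e''" for s'
    proof (intro conjI allI impI)
      fix k assume k: "k < m"
      show "row_ok S h s' k (Suc (Suc h))"
      proof (rule row_ok_cong[OF _ _ rows[OF k]])
        fix j' assume "j' \<in> {1..<Suc (Suc h)}"
        then have "idx k j' \<noteq> idx m j" using k n by (simp add: idx_inj)
        then show "varr s' ''D'' (idx k j') = varr s ''D'' (idx k j')" "iarr s' ''e'' (idx k j') = iarr s ''e'' (idx k j')"
          using post by (simp_all add: D' e')
      qed
    next
      have "row_ok S h s' m j"
      proof (rule row_ok_cong[OF _ _ row])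
        fix j' assume "j' \<in> {1..<j}"
        then have "idx m j' \<noteq> idx m j" using n by (simp add: idx_inj)
        then show "varr s' ''D'' (idx m j') = varr s ''D'' (idx m j')" "iarr s' ''e'' (idx m j') = iarr s ''e'' (idx m j')"
          using post by (simp_all add: D' e')
      qed
      moreover have "varr s' ''D'' (idx m j) = ereal (walk_dist S h m j)" by (simp add: D')
      ultimately show "row_ok S h s' m (Suc j)"
        using e em by (auto simp: row_ok_def e' less_Suc_eq)
    qed
    show "runs I (VStore ''D'' (cell (IVar ''m'') (IVar ''j'')) (VVar ''t'')) s2 18
      (\<lambda>s'. (\<forall>k<m. row_ok S h s' k (Suc (Suc h))) \<and> row_ok S h s' m (Suc j))"
    proof (intro runs_wp)
      show "wp I (VStore ''D'' (cell (IVar ''m'') (IVar ''j'')) (VVar ''t'')) s2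
        (\<lambda>s'. (\<forall>k<m. row_ok S h s' k (Suc (Suc h))) \<and> row_ok S h s' m (Suc j))"
        using s2 t n keep[of "s2\<lparr>varr := (varr s2)(''D'' := (varr s ''D'')(idx m j := ereal (walk_dist S h m j)))\<rparr>"]
        by (simp add: indexed_def loaded_def)
    qed simp
  qed simp
qed simp

lemma runs_dist:
  assumes s: "indexed s" "arcs S s" and h: "ivar s ''i'' = Suc h" "Suc h \<le> r"
  shows "runs I dist_prog s (50 + r * (80 + r * (80 + r * 70))) (\<lambda>s'. \<forall>k\<le>h. row_ok S h s' k (Suc (Suc h)))"
  unfolding dist_prog_def
proof (rule runs_Seq[OF runs_dist_init[OF s h]])
  fix s0 assume row0: "row_ok S h s0 0 (Suc (Suc h))" and fr: "frame dist_init s s0"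
  have s0: "indexed s0" "arcs S s0" "ivar s0 ''i'' = Suc h"
    using fr s h by (simp_all add: frame_def indexed_def loaded_def arcs_def dist_init_def)
  show "runs I (For ''m'' (IConst 1) (IVar ''i'') (For ''j'' (IConst 1) (next_index (IVar ''i'')) dist_cell)) s0
    (30 + r * (50 + r * (80 + r * 70))) (\<lambda>s'. \<forall>k\<le>h. row_ok S h s' k (Suc (Suc h)))"
  proof (rule runs_For[where a = 1 and b = "Suc h" and Tb = "20 + r * (50 + r * 60)" and
      Inv = "\<lambda>m s. \<forall>k<m. row_ok S h s k (Suc (Suc h))"])
    fix m s1
    assume m: "1 \<le> m" "m < Suc h" and inv: "\<forall>k<m. row_ok S h s1 k (Suc (Suc h))" and ms: "ivar s1 ''m'' = m"
      and fr: "frame (For ''m'' (IConst 1) (IVar ''i'') (For ''j'' (IConst 1) (next_index (IVar ''i'')) dist_cell)) s0 s1"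
    have s1: "indexed s1" "arcs S s1" "ivar s1 ''i'' = Suc h"
      using fr s0 by (simp_all add: frame_def indexed_def loaded_def arcs_def dist_cell_def dist_body_def)
    show "runs I (For ''j'' (IConst 1) (next_index (IVar ''i'')) dist_cell) s1 (20 + r * (50 + r * 60))
      (\<lambda>s'. \<forall>k<Suc m. row_ok S h (s'\<lparr>ivar := (ivar s')(''m'' := Suc m)\<rparr>) k (Suc (Suc h)))"
    proof (rule runs_For[where a = 1 and b = "Suc (Suc h)" and Tb = "30 + r * 60" and
        Inv = "\<lambda>j s. (\<forall>k<m. row_ok S h s k (Suc (Suc h))) \<and> row_ok S h s m j"])
      fix j s2
      assume j: "1 \<le> j" "j < Suc (Suc h)" and inv: "(\<forall>k<m. row_ok S h s2 k (Suc (Suc h))) \<and> row_ok S h s2 m j"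
        and js: "ivar s2 ''j'' = j" and fr: "frame (For ''j'' (IConst 1) (next_index (IVar ''i'')) dist_cell) s1 s2"
      have s2: "indexed s2" "arcs S s2" "ivar s2 ''i'' = Suc h" "ivar s2 ''m'' = m"
        using fr s1 ms by (simp_all add: frame_def indexed_def loaded_def arcs_def dist_cell_def dist_body_def)
      show "runs I dist_cell s2 (30 + r * 60) (\<lambda>s'. (\<forall>k<m. row_ok S h (s'\<lparr>ivar := (ivar s')(''j'' := Suc j)\<rparr>) k (Suc (Suc h)))
          \<and> row_ok S h (s'\<lparr>ivar := (ivar s')(''j'' := Suc j)\<rparr>) m (Suc j))"
        using runs_dist_cell[OF s2(1-3) h(2) s2(4) m js j] inv by simp
    next
      show "5 + icost (IConst 1) + icost (next_index (IVar ''i'')) +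
        (Suc (Suc h) - 1) * (30 + r * 60 + 7 + icost (next_index (IVar ''i''))) \<le> 20 + r * (50 + r * 60)"
        using mult_right_mono[OF h(2), of "40 + r * 60"] by (simp add: algebra_simps)
    qed (use s1 inv in \<open>simp_all add: frame_def dist_cell_def dist_body_def row_ok_def[of _ _ _ _ "Suc 0"] less_Suc_eq\<close>)
  next
    show "5 + icost (IConst 1) + icost (IVar ''i'') + (Suc h - 1) * (20 + r * (50 + r * 60) + 7 + icost (IVar ''i''))
      \<le> 30 + r * (50 + r * (80 + r * 70))"
      using mult_right_mono[of h r "28 + r * (50 + r * 60)"] h(2) by (simp add: algebra_simps)
  qed (use s0 row0 in \<open>simp_all add: frame_def dist_cell_def dist_body_def less_Suc_eq_le\<close>)
qed (simp add: algebra_simps)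

text \<open>Here \<open>b = Suc h\<close> encodes that no closed walk of negative cost exists.\<close>

definition best :: "(nat \<Rightarrow> nat) \<Rightarrow> nat \<Rightarrow> nat \<Rightarrow> nat \<Rightarrow> bool" where
  "best S h k b \<longleftrightarrow> (if b = Suc h then \<forall>x<k. 0 \<le> walk_dist S h x (Suc h)
    else b < k \<and> walk_dist S h b (Suc h) < 0 \<and> (\<forall>x<k. walk_dist S h b (Suc h) \<le> walk_dist S h x (Suc h)) \<and>
      (\<forall>x<b. walk_dist S h b (Suc h) < walk_dist S h x (Suc h)))"

lemma runs_best:
  assumes s: "indexed s" and h: "ivar s ''i'' = Suc h" "Suc h \<le> r" and rows: "\<forall>k\<le>h. row_ok S h s k (Suc (Suc h))"
  shows "runs I best_prog s (30 + r * 60) (\<lambda>s'. best S h (Suc h) (ivar s' ''b''))"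
  unfolding best_prog_def
proof (rule runs_Seq)
  let ?d = "\<lambda>k. walk_dist S h k (Suc h)"
  \<comment> \<open>The value held in the variable \<open>t\<close> is determined by
    \<open>b\<close>: it is 0 as long as no walk has been chosen.\<close>
  define v where "v b = (if b = Suc h then 0 else ?d b)" for b
  show "runs I (VAssign ''t'' VZero) s 2 (\<lambda>s. vvar s ''t'' = 0)" by (intro runs_wp) simp_all
  fix s1 assume t: "vvar s1 ''t'' = 0" and fr1: "frame (VAssign ''t'' VZero) s s1"
  show "runs I (IAssign ''b'' (IVar ''i'') ;; For ''m'' (IConst 0) (IVar ''i'') best_body) s1 (28 + r * 60)
    (\<lambda>s'. best S h (Suc h) (ivar s' ''b''))"
  proof (rule runs_Seq)
    show "runs I (IAssign ''b'' (IVar ''i'')) s1 2 (\<lambda>s. ivar s ''b'' = Suc h)"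
      using fr1 h by (intro runs_wp) (simp_all add: frame_def)
    fix s2 assume b: "ivar s2 ''b'' = Suc h" and fr2: "frame (IAssign ''b'' (IVar ''i'')) s1 s2"
    have s2: "indexed s2" "ivar s2 ''i'' = Suc h" "varr s2 ''D'' = varr s ''D''" "vvar s2 ''t'' = 0"
      using fr1 fr2 s h t by (simp_all add: frame_def indexed_def loaded_def)
    show "runs I (For ''m'' (IConst 0) (IVar ''i'') best_body) s2 (26 + r * 60) (\<lambda>s'. best S h (Suc h) (ivar s' ''b''))"
    proof (rule runs_For[where a = 0 and b = "Suc h" and Tb = 40 and
        Inv = "\<lambda>k s. vvar s ''t'' = ereal (v (ivar s ''b'')) \<and> best S h k (ivar s ''b'')"])
      fix k s3
      assume k: "k < Suc h" and inv: "vvar s3 ''t'' = ereal (v (ivar s3 ''b'')) \<and> best S h k (ivar s3 ''b'')"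
        and ks: "ivar s3 ''m'' = k" and fr: "frame (For ''m'' (IConst 0) (IVar ''i'') best_body) s2 s3"
      have s3: "indexed s3" "ivar s3 ''i'' = Suc h" "varr s3 ''D'' = varr s ''D''"
        using fr s2 by (simp_all add: frame_def indexed_def loaded_def best_body_def)
      have D: "varr s3 ''D'' (idx k (Suc h)) = ereal (?d k)"
        using rows k s3(3) by (simp add: row_ok_def)
      have b: "best S h k (ivar s3 ''b'')" using inv by simp
      have new: "best S h (Suc k) k \<and> v k = ?d k" if "?d k < v (ivar s3 ''b'')"
        using b that k unfolding best_def v_def
        by (cases "ivar s3 ''b'' = Suc h") (force simp: less_Suc_eq)+
      have keep: "best S h (Suc k) (ivar s3 ''b'')" if "\<not> ?d k < v (ivar s3 ''b'')"
        using b that k unfolding best_def v_def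
        by (cases "ivar s3 ''b'' = Suc h") (simp_all add: less_Suc_eq not_less all_conj_distrib)
      show "runs I best_body s3 40 (\<lambda>s'. vvar (s'\<lparr>ivar := (ivar s')(''m'' := Suc k)\<rparr>) ''t'' =
          ereal (v (ivar (s'\<lparr>ivar := (ivar s')(''m'' := Suc k)\<rparr>) ''b'')) \<and>
          best S h (Suc k) (ivar (s'\<lparr>ivar := (ivar s')(''m'' := Suc k)\<rparr>) ''b''))"
      proof (intro runs_wp)
        have kn: "k \<le> n" using k h(2) r_le_n by simp
        show "wp I best_body s3 (\<lambda>s'. vvar (s'\<lparr>ivar := (ivar s')(''m'' := Suc k)\<rparr>) ''t'' =
          ereal (v (ivar (s'\<lparr>ivar := (ivar s')(''m'' := Suc k)\<rparr>) ''b'')) \<and>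
          best S h (Suc k) (ivar (s'\<lparr>ivar := (ivar s')(''m'' := Suc k)\<rparr>) ''b''))"
        proof (cases "?d k < v (ivar s3 ''b'')")
          case True
          then show ?thesis using new[OF True] s3 kn ks D inv by (simp add: best_body_def indexed_def loaded_def idx_Suc)
        next
          case False
          then show ?thesis using keep[OF False] s3 kn ks D inv by (simp add: best_body_def indexed_def loaded_def idx_Suc)
        qed
      qed (simp add: best_body_def)
    qed (use s2 b h in \<open>simp_all add: frame_def best_body_def v_def best_def\<close>)
  qed simp
qed simp

lemma runs_apply:
  assumes s: "indexed s" "arcs S s" and h: "ivar s ''i'' = Suc h" "Suc h \<le> r"
    and rows: "\<forall>k\<le>h. row_ok S h s k (Suc (Suc h))" and S: "iarr s ''S'' = S" "optimal_upto h S"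
    and best: "best S h (Suc h) (ivar s ''b'')"
  shows "runs I apply_prog s (60 + r * 60) (\<lambda>s'. optimal_upto (Suc h) (iarr s' ''S''))"
  unfolding apply_prog_def
proof (rule runs_If)
  define b where "b = ivar s ''b''"
  define gf where "gf j l = iarr s ''g'' (idx j l)" for j l
  have g: "realizes_arcs S gf" using s(2) by (simp add: arcs_def gf_def[abs_def])
  show "beval I s (ILess (IVar ''b'') (IVar ''i'')) = Some (b < Suc h)" using h by (simp add: b_def)
  {
    assume nb: "\<not> b < Suc h"
    then have "b = Suc h" using best unfolding best_def b_def[symmetric] by (meson less_irrefl linorder_neqE_nat)
    then have "\<forall>x<Suc h. 0 \<le> walk_dist S h x (Suc h)" using best by (simp add: best_def b_def[symmetric])
    then have "0 \<le> min_dist S h (Suc h)" using min_dist_attained[of h S "Suc h"] by (metis le_imp_less_Suc)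
    then show "runs I Skip s (50 + r * 60) (\<lambda>s'. optimal_upto (Suc h) (iarr s' ''S''))"
      using optimal_upto_keep[OF S(2) h(2)] S(1) by (intro runs_wp) simp_all
  next
    assume bh: "b < Suc h"
    have neg: "walk_dist S h b (Suc h) < 0" and le: "\<And>x. x < Suc h \<Longrightarrow> walk_dist S h b (Suc h) \<le> walk_dist S h x (Suc h)"
      and first: "\<And>x. x < b \<Longrightarrow> walk_dist S h b (Suc h) < walk_dist S h x (Suc h)"
      using best bh unfolding best_def b_def[symmetric] by simp_all
    have md: "min_dist S h (Suc h) = walk_dist S h b (Suc h)"
      using min_dist_attained[of h S "Suc h"] le min_dist_le[of b h S "Suc h"] bh
      by (metis antisym less_Suc_eq_le)
    \<comment> \<open>After \<open>k\<close> steps \<open>zs\<close> holds the last \<open>k\<close>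
      intermediate nodes. The distance still to be traced and the cost of the traced end always add
      up to the cost of the whole walk.\<close>
    define traced where "traced k s' \<longleftrightarrow> (\<exists>zs. length zs = k \<and> set zs \<subseteq> {1..h} \<and>
      ivar s' ''u'' = hd (zs @ [Suc h]) \<and>
      walk_dist S h (b - k) (ivar s' ''u'') + walk_cost (arc S) (zs @ [Suc h]) = walk_dist S h b (Suc h) \<and>
      iarr s' ''S'' = apply_walk gf (zs @ [Suc h]) S)" for k and s' :: state
    show "runs I (IAssign ''u'' (IVar ''i'') ;; For ''m'' (IConst 0) (IVar ''b'') apply_body ;;
      IStore ''S'' (IVar ''i'') (IArr ''g'' (cell (IVar ''i'') (IVar ''u'')))) s (50 + r * 60)
      (\<lambda>s'. optimal_upto (Suc h) (iarr s' ''S''))"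
    proof (rule runs_Seq)
      show "runs I (IAssign ''u'' (IVar ''i'')) s 2 (\<lambda>s. ivar s ''u'' = Suc h)"
        using h by (intro runs_wp) simp_all
      fix s1 assume u: "ivar s1 ''u'' = Suc h" and fr: "frame (IAssign ''u'' (IVar ''i'')) s s1"
      have s1: "indexed s1" "ivar s1 ''i'' = Suc h" "ivar s1 ''b'' = b" "iarr s1 ''S'' = S"
        "iarr s1 ''g'' = iarr s ''g''" "iarr s1 ''e'' = iarr s ''e''"
        using fr s h S(1) by (simp_all add: frame_def indexed_def loaded_def b_def)
      show "runs I (For ''m'' (IConst 0) (IVar ''b'') apply_body ;;
        IStore ''S'' (IVar ''i'') (IArr ''g'' (cell (IVar ''i'') (IVar ''u'')))) s1 (48 + r * 60)
        (\<lambda>s'. optimal_upto (Suc h) (iarr s' ''S''))"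
      proof (rule runs_Seq)
        show "runs I (For ''m'' (IConst 0) (IVar ''b'') apply_body) s1 (20 + r * 60) (traced b)"
        proof (rule runs_For[where a = 0 and b = b and Tb = 30 and Inv = traced])
          fix k s2
          assume k: "k < b" and inv: "traced k s2" and ks: "ivar s2 ''m'' = k"
            and fr: "frame (For ''m'' (IConst 0) (IVar ''b'') apply_body) s1 s2"
          have s2: "indexed s2" "ivar s2 ''b'' = b" "iarr s2 ''g'' = iarr s ''g''" "iarr s2 ''e'' = iarr s ''e''"
            using fr s1 by (simp_all add: frame_def indexed_def loaded_def apply_body_def)
          obtain zs where zs: "length zs = k" "set zs \<subseteq> {1..h}" and us: "ivar s2 ''u'' = hd (zs @ [Suc h])"
            and cost: "walk_dist S h (b - k) (ivar s2 ''u'') + walk_cost (arc S) (zs @ [Suc h]) = walk_dist S h b (Suc h)"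
            and S2: "iarr s2 ''S'' = apply_walk gf (zs @ [Suc h]) S"
            using inv unfolding traced_def by blast
          define u where "u = ivar s2 ''u''"
          define l where "l = iarr s ''e'' (idx (b - k) u)"
          have u: "u \<in> {1..<Suc (Suc h)}" using zs(2) us by (cases zs) (auto simp: u_def)
          have "row_ok S h s (b - k) (Suc (Suc h))" using rows bh by simp
          then have l: "l \<in> {1..h}" and step: "walk_dist S h (b - k - 1) l + arc S l u = walk_dist S h (b - k) u"
            using u k by (simp_all add: row_ok_def l_def)
          have ln: "l \<le> n" "b - k \<le> n" using l h(2) r_le_n bh by auto
          obtain ws where ws: "zs @ [Suc h] = u # ws" using us by (cases zs) (auto simp: u_def)
          have "traced (Suc k) s'" if "ivar s' ''u'' = l" "iarr s' ''S'' = (iarr s2 ''S'')(l := gf l u)" for s'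
            unfolding traced_def
          proof (intro exI[of _ "l # zs"] conjI)
            show "walk_dist S h (b - Suc k) (ivar s' ''u'') + walk_cost (arc S) ((l # zs) @ [Suc h]) = walk_dist S h b (Suc h)"
              using cost step that(1) unfolding append_Cons ws by (simp add: u_def)
            show "iarr s' ''S'' = apply_walk gf ((l # zs) @ [Suc h]) S"
              using S2 that(2) unfolding append_Cons ws by simp
          qed (use zs l that in simp_all)
          then show "runs I apply_body s2 30 (\<lambda>s'. traced (Suc k) (s'\<lparr>ivar := (ivar s')(''m'' := Suc k)\<rparr>))"
            using s2 ks ln by (intro runs_wp) (simp_all add: apply_body_def indexed_def loaded_def
              u_def[symmetric] l_def[symmetric] gf_def)
        next
          show "5 + icost (IConst 0) + icost (IVar ''b'') + (b - 0) * (30 + 7 + icost (IVar ''b'')) \<le> 20 + r * 60"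
            using bh h(2) by simp
        next
          show "traced 0 (s1\<lparr>ivar := (ivar s1)(''m'' := 0)\<rparr>)"
            using u s1 by (simp add: traced_def)
        qed (use s1 in \<open>simp_all add: frame_def apply_body_def\<close>)
        fix s2 assume tr: "traced b s2" and fr: "frame (For ''m'' (IConst 0) (IVar ''b'') apply_body) s1 s2"
        have s2: "indexed s2" "ivar s2 ''i'' = Suc h" "iarr s2 ''g'' = iarr s ''g''"
          using fr s1 by (simp_all add: frame_def indexed_def loaded_def apply_body_def)
        obtain zs where zs: "length zs = b" "set zs \<subseteq> {1..h}" and us: "ivar s2 ''u'' = hd (zs @ [Suc h])"
          and cost: "walk_dist S h 0 (ivar s2 ''u'') + walk_cost (arc S) (zs @ [Suc h]) = walk_dist S h b (Suc h)"
          and S2: "iarr s2 ''S'' = apply_walk gf (zs @ [Suc h]) S"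
          using tr unfolding traced_def by auto
        define u where "u = ivar s2 ''u''"
        obtain ws where ws: "zs @ [Suc h] = u # ws" using us by (cases zs) (auto simp: u_def)
        \<comment> \<open>The remaining distance, of row 0, is the arc out of \<open>Suc h\<close>,
          which closes the walk.\<close>
        have "walk_cost (arc S) (Suc h # zs @ [Suc h]) = min_dist S h (Suc h)"
          using cost unfolding ws md by (simp add: u_def)
        then have "optimal_upto (Suc h) (apply_walk gf (Suc h # zs @ [Suc h]) S)"
          using first neg zs md by (intro optimal_upto_augment[OF S(2) h(2) g]) simp_all
        also have "apply_walk gf (Suc h # zs @ [Suc h]) S = (iarr s2 ''S'')(Suc h := gf (Suc h) u)"
          unfolding S2 unfolding ws by simp
        finally show "runs I (IStore ''S'' (IVar ''i'') (IArr ''g'' (cell (IVar ''i'') (IVar ''u'')))) s2 28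
          (\<lambda>s'. optimal_upto (Suc h) (iarr s' ''S''))"
          using s2 h(2) r_le_n
          by (intro runs_wp) (simp_all add: indexed_def loaded_def gf_def u_def fun_upd_same del: fun_upd_apply)
      qed simp
    qed simp
  }
qed simp

text \<open>The budgets are round overestimates decreasing from stage to stage, so that each step
  compares coefficients. The product of \<open>n\<close> and \<open>r\<close> pays for gradient and
  arcs, the cube of \<open>r\<close> for the walk distances.\<close>

lemma runs_phase:
  assumes s: "ready s" and h: "ivar s ''i'' = Suc h" "Suc h \<le> r" and opt: "optimal_upto h (iarr s ''S'')"
  shows "runs I phase_prog s (1000 + n * (1000 + r * 1000) + r * (1000 + r * (1000 + r * 1000)))
    (\<lambda>s'. optimal_upto (Suc h) (iarr s' ''S''))"
proof -
  define S where "S = iarr s ''S''"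
  have S: "transversal S" "optimal_upto h S" using opt by (simp_all add: S_def optimal_upto_def)
  note fd = frame_def ready_def indexed_def loaded_def holds_W_def swap_sums_def arcs_def row_ok_def
    sum_prog_def sum_row_def sum_body_def clear_prog_def arc_prog_def arc_row_def arc_body_def
    dist_prog_def dist_init_def dist_cell_def dist_body_def best_prog_def best_body_def
  show ?thesis
    unfolding phase_prog_def
  proof (rule runs_Seq[OF runs_sum[OF s S(1) S_def[symmetric]]])
    fix s1 assume 1: "swap_sums S s1" and fr1: "frame sum_prog s s1"
    have s1: "ready s1" "iarr s1 ''S'' = S" "ivar s1 ''i'' = Suc h"
      using fr1 s h by (simp_all add: fd S_def)
    then have i1: "indexed s1" by (simp add: ready_def)
    show "runs I (clear_prog ;; arc_prog ;; dist_prog ;; best_prog ;; apply_prog) s1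
      (900 + n * (900 + r * 900) + r * (900 + r * (900 + r * 900))) (\<lambda>s'. optimal_upto (Suc h) (iarr s' ''S''))"
    proof (rule runs_Seq[OF runs_clear[OF i1, of S]])
      fix s2 assume 2: "arcs_upto S 1 1 s2" and fr2: "frame clear_prog s1 s2"
      have s2: "ready s2" "swap_sums S s2" "iarr s2 ''S'' = S" "ivar s2 ''i'' = Suc h"
        using fr2 s1 1 by (simp_all add: fd)
      show "runs I (arc_prog ;; dist_prog ;; best_prog ;; apply_prog) s2
        (800 + n * (800 + r * 800) + r * (800 + r * (800 + r * 800))) (\<lambda>s'. optimal_upto (Suc h) (iarr s' ''S''))"
      proof (rule runs_Seq[OF runs_arc[OF s2(1-3) S(1) 2]])
        fix s3 assume 3: "arcs S s3" and fr3: "frame arc_prog s2 s3"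
        have s3: "indexed s3" "iarr s3 ''S'' = S" "ivar s3 ''i'' = Suc h"
          using fr3 s2 by (simp_all add: fd)
        show "runs I (dist_prog ;; best_prog ;; apply_prog) s3
          (600 + r * (700 + r * (700 + r * 700))) (\<lambda>s'. optimal_upto (Suc h) (iarr s' ''S''))"
        proof (rule runs_Seq[OF runs_dist[OF s3(1) 3 s3(3) h(2)]])
          fix s4 assume 4: "\<forall>k\<le>h. row_ok S h s4 k (Suc (Suc h))" and fr4: "frame dist_prog s3 s4"
          have s4: "indexed s4" "arcs S s4" "iarr s4 ''S'' = S" "ivar s4 ''i'' = Suc h"
            using fr4 s3 3 by (simp_all add: fd)
          show "runs I (best_prog ;; apply_prog) s4 (500 + r * (600 + r * (600 + r * 600)))
            (\<lambda>s'. optimal_upto (Suc h) (iarr s' ''S''))"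
          proof (rule runs_Seq[OF runs_best[OF s4(1,4) h(2) 4]])
            fix s5 assume 5: "best S h (Suc h) (ivar s5 ''b'')" and fr5: "frame best_prog s4 s5"
            have s5: "indexed s5" "arcs S s5" "iarr s5 ''S'' = S" "ivar s5 ''i'' = Suc h"
              "\<forall>k\<le>h. row_ok S h s5 k (Suc (Suc h))"
              using fr5 s4 4 by (simp_all add: fd)
            show "runs I apply_prog s5 (60 + r * 60) (\<lambda>s'. optimal_upto (Suc h) (iarr s' ''S''))"
              by (rule runs_apply[OF s5(1,2,4) h(2) s5(5,3) S(2) 5])
          qed (simp add: algebra_simps)
        qed (simp add: algebra_simps)
      qed (simp add: algebra_simps)
    qed (simp add: algebra_simps)
  qed (simp add: algebra_simps)
qed

end

section \<open>Assembling the program and its running time\<close>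

definition output_prog :: com where
  "output_prog = For ''j'' (IConst 1) (next_index NumVars)
    (IStore ''x'' (IVar ''j'') (Val (Sel (IVar ''j''))))"

definition solve_prog :: com where
  "solve_prog =
    rows_prog ;; cap_prog ;; cross_prog ;; same_prog ;; choose_prog ;;
    For ''i'' (IConst 1) (next_index NumVars) phase_prog ;; output_prog"

context flat_instance
begin

lemma runs_output:
  assumes s: "loaded s" and S: "optimal_upto r (iarr s ''S'')"
  shows "runs I output_prog s (20 + r * 20)
    (\<lambda>s'. is_arg_min (objective I) (\<lambda>x. x \<in> assignments I) (result I s'))"
proof -
  define S where "S = iarr s ''S''"
  show ?thesis
    unfolding output_prog_def
  proof (rule runs_For[where a = 1 and b = "Suc r" and Tb = 10 and
      Inv = "\<lambda>k s. \<forall>j\<in>{1..<k}. iarr s ''x'' j = Vl (S j)"])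
    fix k s1
    assume k: "1 \<le> k" "k < Suc r" and inv: "\<forall>j\<in>{1..<k}. iarr s1 ''x'' j = Vl (S j)" and ks: "ivar s1 ''j'' = k"
      and fr: "frame (For ''j'' (IConst 1) (next_index NumVars) (IStore ''x'' (IVar ''j'') (Val (Sel (IVar ''j''))))) s s1"
    have "iarr s1 ''A'' = Vl" "iarr s1 ''S'' = S" using fr s by (simp_all add: frame_def loaded_def S_def)
    moreover have "iarr s1 ''x'' j = Vl (S j)" if "j \<in> {1..<Suc k}" "j \<noteq> k" for j
      using inv that by (simp add: less_Suc_eq)
    ultimately show "runs I (IStore ''x'' (IVar ''j'') (Val (Sel (IVar ''j'')))) s1 10
      (\<lambda>s'. \<forall>j\<in>{1..<Suc k}. iarr (s'\<lparr>ivar := (ivar s')(''j'' := Suc k)\<rparr>) ''x'' j = Vl (S j))"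
      using ks by (intro runs_wp) simp_all
  next
    fix s' :: state assume "\<forall>j\<in>{1..<Suc r}. iarr s' ''x'' j = Vl (S j)"
    then have "result I s' = assign S"
      by (intro ext) (simp add: result_def assign_def restrict_def less_Suc_eq_le)
    then show "is_arg_min (objective I) (\<lambda>x. x \<in> assignments I) (result I s')"
      using optimal_is_arg_min S by (simp add: S_def)
  qed simp_all
qed

lemma runs_phases:
  assumes s: "ready s" and S: "transversal (iarr s ''S'')"
  shows "runs I (For ''i'' (IConst 1) (next_index NumVars) phase_prog) s
    (20 + r * (2000 + n * (1000 + r * 1000) + r * (1000 + r * (1000 + r * 1000))))
    (\<lambda>s'. optimal_upto r (iarr s' ''S''))"
\<comment> \<open>The counter is the variable to be released next, whence \<open>k - 1\<close>; at
  the start nothing is released.\<close>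
proof (rule runs_For[where a = 1 and b = "Suc r" and
    Tb = "1000 + n * (1000 + r * 1000) + r * (1000 + r * (1000 + r * 1000))" and
    Inv = "\<lambda>k s. optimal_upto (k - 1) (iarr s ''S'')"])
  note fd = frame_def ready_def indexed_def loaded_def holds_W_def phase_prog_def
    sum_prog_def sum_row_def sum_body_def clear_prog_def arc_prog_def arc_row_def arc_body_def
    dist_prog_def dist_init_def dist_cell_def dist_body_def best_prog_def best_body_def
    apply_prog_def apply_body_def
  show "''i'' \<notin> ivar_writes phase_prog" by (simp add: fd)
  show "optimal_upto (1 - 1) (iarr (s\<lparr>ivar := (ivar s)(''i'' := 1)\<rparr>) ''S'')"
    using S by (simp add: optimal_upto_0)
  fix k s1
  assume k: "1 \<le> k" "k < Suc r" and inv: "optimal_upto (k - 1) (iarr s1 ''S'')" and ks: "ivar s1 ''i'' = k"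
    and fr: "frame (For ''i'' (IConst 1) (next_index NumVars) phase_prog) s s1"
  have s1: "ready s1" using fr s by (simp add: fd)
  obtain h where h: "k = Suc h" using k by (cases k) auto
  show "runs I phase_prog s1 (1000 + n * (1000 + r * 1000) + r * (1000 + r * (1000 + r * 1000)))
    (\<lambda>s'. optimal_upto (Suc k - 1) (iarr (s'\<lparr>ivar := (ivar s')(''i'' := Suc k)\<rparr>) ''S''))"
    using runs_phase[OF s1, of h] ks k inv by (simp add: h)
qed (simp_all add: algebra_simps)

definition solve_time :: nat where
  "solve_time = 1000 * n * n + 1000 * n + 200 +
     r * (2100 + n * (1000 + r * 1000) + r * (1000 + r * (1000 + r * 1000)))"

lemma runs_solve:
  assumes s: "loaded s"
  shows "runs I solve_prog s solve_time
    (\<lambda>s'. is_arg_min (objective I) (\<lambda>x. x \<in> assignments I) (result I s'))"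
    (is "runs I _ s _ ?Q")
proof -
  note fd = frame_def ready_def indexed_def loaded_def holds_W_def rows_prog_def cap_prog_def cap_row_def
    cap_body_def cross_prog_def cross_body_def same_prog_def same_row_def same_body_def closest_body_def
    choose_prog_def
  let ?T = "20 + r * (2000 + n * (1000 + r * 1000) + r * (1000 + r * (1000 + r * 1000)))"
  show ?thesis
    unfolding solve_prog_def
  proof (rule runs_Seq[OF runs_rows[OF s]])
    fix s1 assume s1: "indexed s1"
    then have l1: "loaded s1" by (simp add: indexed_def)
    show "runs I (cap_prog ;; cross_prog ;; same_prog ;; choose_prog ;;
      For ''i'' (IConst 1) (next_index NumVars) phase_prog ;; output_prog) s1
      (?T + 20 + r * 20 + (120 + n * (800 + n * 800))) ?Q"
    proof (rule runs_Seq[OF runs_cap[OF l1]])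
      fix s2 assume 2: "vvar s2 ''M'' = ereal cap" and fr: "frame cap_prog s1 s2"
      have s2: "indexed s2" using fr s1 by (simp add: fd)
      show "runs I (cross_prog ;; same_prog ;; choose_prog ;;
        For ''i'' (IConst 1) (next_index NumVars) phase_prog ;; output_prog) s2
        (?T + 20 + r * 20 + (100 + n * (600 + n * 600))) ?Q"
      proof (rule runs_Seq[OF runs_cross[OF s2 2]])
        fix s3 assume 3: "\<forall>p\<in>{1..n}. \<forall>q\<in>{1..n}. varr s3 ''W'' (idx p q) = ereal (cross p q)"
          and fr: "frame cross_prog s2 s3"
        have s3: "indexed s3" using fr s2 by (simp add: fd)
        show "runs I (same_prog ;; choose_prog ;;
          For ''i'' (IConst 1) (next_index NumVars) phase_prog ;; output_prog) s3
          (?T + 20 + r * 20 + (80 + n * (400 + n * 400))) ?Q"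
        proof (rule runs_Seq[OF runs_same[OF s3 3]])
          fix s4 assume 4: "holds_W s4 W" and fr: "frame same_prog s3 s4"
          have s4: "indexed s4" using fr s3 by (simp add: fd)
          then have l4: "loaded s4" by (simp add: indexed_def)
          show "runs I (choose_prog ;;
            For ''i'' (IConst 1) (next_index NumVars) phase_prog ;; output_prog) s4
            (?T + 20 + r * 20 + (60 + n * 100)) ?Q"
          proof (rule runs_Seq[OF runs_choose[OF l4]])
            fix s5 assume 5: "transversal (iarr s5 ''S'')" and fr: "frame choose_prog s4 s5"
            have s5: "ready s5" using fr s4 4 by (simp add: fd)
            show "runs I (For ''i'' (IConst 1) (next_index NumVars) phase_prog ;; output_prog) s5
              (?T + 20 + r * 20) ?Q"
            proof (rule runs_Seq[OF runs_phases[OF s5 5]])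
              fix s6 assume 6: "optimal_upto r (iarr s6 ''S'')"
                and fr: "frame (For ''i'' (IConst 1) (next_index NumVars) phase_prog) s5 s6"
              have "loaded s6" using fr s5
                by (simp add: frame_def ready_def indexed_def loaded_def phase_prog_def
                  sum_prog_def sum_row_def sum_body_def clear_prog_def arc_prog_def arc_row_def arc_body_def
                  dist_prog_def dist_init_def dist_cell_def dist_body_def best_prog_def best_body_def
                  apply_prog_def apply_body_def)
              from runs_output[OF this 6] show "runs I output_prog s6 (20 + r * 20) ?Q" .
            qed simp
          qed (simp add: algebra_simps)
        qed (simp add: algebra_simps)
      qed (simp add: algebra_simps)
    qed (simp add: algebra_simps)
  qed (simp add: algebra_simps solve_time_def)
qed

text \<open>By \<open>1 \<le> r \<le> n\<close> each monomial is at most \<open>n * r ^ 3\<close> or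
  \<open>n ^ 2\<close>, including \<open>r ^ 4\<close> for the walk distances of all
  \<open>r\<close> phases. The respective coefficients add up to 7100 and 2200.\<close>

lemma solve_time_le: "solve_time \<le> 10000 * (n * r ^ 3 + n ^ 2)"
proof -
  have r: "1 \<le> r" using wf by (simp add: wf_inst_def)
  have n: "1 \<le> n" using r r_le_n by linarith
  have r3: "r ^ k \<le> r ^ 3" if "k \<le> 3" for k using that r by (intro power_increasing) auto
  have m1: "r ^ k \<le> n * r ^ 3" if "1 \<le> k" "k \<le> 4" for k
    using mult_le_mono[OF r_le_n r3[of "k - 1"]] that by (cases k) simp_all
  have m2: "n * r ^ k \<le> n * r ^ 3" if "k \<le> 3" for k using r3[OF that] by (rule mult_le_mono2)
  have "r ^ 1 \<le> n * r ^ 3" "r ^ 2 \<le> n * r ^ 3" "r ^ 3 \<le> n * r ^ 3" "r ^ 4 \<le> n * r ^ 3"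
    by (rule m1; simp)+
  moreover have "n * r ^ 1 \<le> n * r ^ 3" "n * r ^ 2 \<le> n * r ^ 3"
    by (rule m2; simp)+
  moreover have "n \<le> n ^ 2" "1 \<le> n ^ 2" using n by (simp_all add: power2_eq_square)
  moreover have "solve_time = 1000 * n ^ 2 + 1000 * n + 200 + 2100 * r ^ 1 + 1000 * (n * r ^ 1) + 1000 * (n * r ^ 2)
      + 1000 * r ^ 2 + 1000 * r ^ 3 + 1000 * r ^ 4"
    by (simp add: solve_time_def algebra_simps power2_eq_square power3_eq_cube power4_eq_xxxx)
  ultimately show ?thesis unfolding add_mult_distrib2 by linarith
qed

end

definition minimize_prog :: com where
  "minimize_prog = flatten_prog ;; solve_prog"

theorem theorem4:
  "\<exists>(p :: com) (C :: real). \<forall>I :: inst.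
     wf_inst I \<and> joint_winner I \<and> z_free I \<longrightarrow>
     (let n = real (total_size I); r = real (nvars I) in
       computes_minimizer_within p I (C * (n * r ^ 3 + n * r * log 2 n + n ^ 2)))"
proof (intro exI[of _ minimize_prog] exI[of _ 20000] allI impI)
  fix I :: inst
  assume I: "wf_inst I \<and> joint_winner I \<and> z_free I"
  define n r where "n = total_size I" and "r = nvars I"
  have n: "1 \<le> n" using I nvars_le_total[of I] unfolding n_def wf_inst_def by linarith
  have "runs I minimize_prog init_state (20000 * (n * r ^ 3 + n ^ 2))
    (\<lambda>s'. is_arg_min (objective I) (\<lambda>x. x \<in> assignments I) (result I s'))"
    unfolding minimize_prog_def
  proof (rule runs_Seq[OF runs_flatten])
    fix s :: state
    assume s: "ivar s ''n'' = total_size I \<and> bij_betw (\<lambda>p. (iarr s ''P'' p, iarr s ''A'' p)) {1..total_size I}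
       (SIGMA j:{1..nvars I}. {1..dsize I j})"
    \<comment> \<open>The arrays filled by \<open>flatten_prog\<close> become the abstract
      numbering.\<close>
    interpret flat_instance I n "iarr s ''P''" "iarr s ''A''"
      using I s by unfold_locales (simp_all add: n_def)
    have "loaded s" unfolding loaded_def using s by (simp add: n_def)
    from runs_solve[OF this]
    show "runs I solve_prog s (10000 * (n * r ^ 3 + n ^ 2))
      (\<lambda>s'. is_arg_min (objective I) (\<lambda>x. x \<in> assignments I) (result I s'))"
      by (rule runs_mono) (use solve_time_le in \<open>simp_all add: r_def\<close>)
  next
    \<comment> \<open>The numbering takes at most \<open>100 * n ^ 2\<close>, well within a second
      share of 10000; with the share of \<open>solve_prog\<close> this gives the constant
      20000.\<close>
    have "n * 1 \<le> n * n" using n by (rule mult_le_mono2)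
    then have "20 + n * (30 + n * 30) \<le> 100 * n ^ 2"
      using n unfolding power2_eq_square add_mult_distrib2 by linarith
    also have "\<dots> \<le> 10000 * (n * r ^ 3 + n ^ 2)" by simp
    finally show "20 + total_size I * (30 + total_size I * 30) + 10000 * (n * r ^ 3 + n ^ 2)
        \<le> 20000 * (n * r ^ 3 + n ^ 2)"
      unfolding n_def[symmetric] by simp
  qed (use I in simp)
  then obtain t s where ts: "exec I minimize_prog init_state t s" "t \<le> 20000 * (n * r ^ 3 + n ^ 2)"
    and min: "is_arg_min (objective I) (\<lambda>x. x \<in> assignments I) (result I s)"
    unfolding runs_def by blast
  have "real t \<le> real (20000 * (n * r ^ 3 + n ^ 2))" using ts(2) by (rule of_nat_mono)
  also have "\<dots> = 20000 * (real n * real r ^ 3 + real n ^ 2)" by simp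
  \<comment> \<open>The added logarithmic summand is nonnegative because
    \<open>1 \<le> n\<close>.\<close>
  also have "\<dots> \<le> 20000 * (real n * real r ^ 3 + real n * real r * log 2 (real n) + real n ^ 2)"
    using n by simp
  finally show "let n = real (total_size I); r = real (nvars I) in
       computes_minimizer_within minimize_prog I (20000 * (n * r ^ 3 + n * r * log 2 n + n ^ 2))"
    using ts(1) min unfolding computes_minimizer_within_def Let_def n_def r_def by blast
qed

end
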